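(* Let $\underline\lambda$ be a Schubert problem on $G(a,b)$ with a composable partition $(\underline\mu,\underline\nu),\underline a,\underline b$, where $\underline\mu=(\mu^1,\dots,\mu^r)$, $\underline\nu=(\nu^1,\dots,\nu^s)$. Let $c,d$ be positive integers and let $\underline\rho=(\underline\alpha,\underline\beta,\underline\gamma)$ be a Schubert problem on $G(c,d)$ with $\underline\alpha=(\alpha^1,\dots,\alpha^r)$, $\underline\beta=(\beta^1,\dots,\beta^s)$, $\underline\gamma=(\gamma^1,\dots,\gamma^t)$. Then the composition $\underline\lambda\circ\underline\rho$ is a Schubert problem on $G(a+c,b+d)$ and \[\delta(\underline\lambda\circ\underline\rho)=\delta(\underline\lambda)\cdot\delta(\underline\rho).\]
   Context: Partitions are weakly decreasing finite sequences of positive integers (the empty/zero partition $\emptyset$ is allowed), $\lambda_i:=0$ beyond the length $\ell(\lambda)$, $|\lambda|=\sum\lambda_i$, $\subseteq$ is componentwise. $\Box_{a,b}$ is the partition with $a$ parts equal to $b$; $\mu+\nu$ has $k$-th part $\mu_k+\nu_k$; $(\mu,\nu)$ is the decreasing rearrangement of the concatenated parts of $\mu$ and $\nu$. $G(a,b)$ is the Grassmannian of $a$-planes in $\mathbb{C}^{a+b}$, with Schubert classes $\sigma_\lambda$ ($\lambda\subseteq\Box_{a,b}$) in its cohomology ring. A Schubert problem on $G(a,b)$ is a list $\underline\lambda=(\lambda^1,\dots,\lambda^r)$ of partitions $\lambda^i\subseteq\Box_{a,b}$ with $\sum_i|\lambda^i|=ab$; $\delta(\underline\lambda)$ is the coefficient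 of $\sigma_{\Box_{a,b}}$ in $\sigma_{\lambda^1}\cdots\sigma_{\lambda^r}$, equivalently the coefficient of the Schur function $S_{\Box_{a,b}}$ in $S_{\lambda^1}\cdots S_{\lambda^r}$ (this is the number of points in an intersection of Schubert varieties $\Omega_{\lambda^i}F^i_\bullet$ for general flags). A composable partition of a Schubert problem $\underline\lambda$ on $G(a,b)$ is a splitting of its list of conditions into two lists $\underline\mu=(\mu^1,\dots,\mu^r)$ and $\underline\nu=(\nu^1,\dots,\nu^s)$, together with nonnegative integers $\underline a=(a_1,\dots,a_r)$, $\underline b=(b_1,\dots,b_s)$ with $a_1+\dots+a_r=a$, $b_1+\dots+b_s=b$, $a_i\ge\ell(\mu^i)$ and $b_j\ge\nu^j_1$ for all $i,j$. Given this and a Schubert problem $\underline\rho=(\underline\alpha,\underline\beta,\underline\gamma)$ on $G(c,d)$ split into lists of lengths $r,s,t$ (entries may be $\emptyset$), the composition $\underline\lambda\circ\underline\rho$ is the list of partitions $(\Box_{a_1,d}+\mu^1,\alpha^1),\dots,(\Box_{a_r,d}+\mu^r,\alpha^r),\ (\Box_{c,b_1},\nu^1)+\beta^1,\dots,(\Box_{c,b_s},\nu^s)+\beta^s,\ \gamma^1,\dots,\gamma^t$. *)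

theory Defs
  imports Main "HOL-Library.Poly_Mapping" "HOL-Library.Multiset"
begin

definition is_partition :: "nat list \<Rightarrow> bool" where
  "is_partition l \<longleftrightarrow> sorted (rev l) \<and> (\<forall>x\<in>set l. 0 < x)"

definition part :: "nat list \<Rightarrow> nat \<Rightarrow> nat" where
  "part l i = (if i < length l then l ! i else 0)"

definition psize :: "nat list \<Rightarrow> nat" where
  "psize l = sum_list l"

definition pcontained :: "nat list \<Rightarrow> nat list \<Rightarrow> bool" where
  "pcontained l m \<longleftrightarrow> (\<forall>i. part l i \<le> part m i)"

definition pbox :: "nat \<Rightarrow> nat \<Rightarrow> nat list" where
  "pbox a b = (if b = 0 then [] else replicate a b)"

definition padd :: "nat list \<Rightarrow> nat list \<Rightarrow> nat list" where
  "padd l m = map (\<lambda>i. part l i + part m i) [0..<max (length l) (length m)]"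

definition pjoin :: "nat list \<Rightarrow> nat list \<Rightarrow> nat list" where
  "pjoin l m = rev (sort (l @ m))"

text \<open>Polynomials over int in variables x_0, x_1, ...; a monomial is an exponent
  vector nat =>0 nat.\<close>
type_synonym ipoly = "(nat \<Rightarrow>\<^sub>0 nat) \<Rightarrow>\<^sub>0 int"

definition cells :: "nat list \<Rightarrow> (nat \<times> nat) set" where
  "cells l = {(i, j). i < length l \<and> j < part l i}"

definition ssyt :: "nat \<Rightarrow> nat list \<Rightarrow> (nat \<times> nat \<Rightarrow> nat) set" where
  "ssyt N l = {T. (\<forall>c. c \<notin> cells l \<longrightarrow> T c = 0)
     \<and> (\<forall>c\<in>cells l. T c < N)
     \<and> (\<forall>i j. (i, Suc j) \<in> cells l \<longrightarrow> T (i, j) \<le> T (i, Suc j))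
     \<and> (\<forall>i j. (Suc i, j) \<in> cells l \<longrightarrow> T (i, j) < T (Suc i, j))}"

definition tab_monomial :: "nat list \<Rightarrow> (nat \<times> nat \<Rightarrow> nat) \<Rightarrow> ipoly" where
  "tab_monomial l T = Poly_Mapping.single (\<Sum>c\<in>cells l. Poly_Mapping.single (T c) 1) 1"

definition schur :: "nat \<Rightarrow> nat list \<Rightarrow> ipoly" where
  "schur N l = (\<Sum>T\<in>ssyt N l. tab_monomial l T)"

text \<open>Coefficient of S_kappa in the Schur expansion of a polynomial p in N variables
  (the expansion is unique, Schur polynomials with at most N rows being linearly
  independent).\<close>
definition schur_coeff :: "nat \<Rightarrow> ipoly \<Rightarrow> nat list \<Rightarrow> int" where
  "schur_coeff N p kappa = (THE c. finite {k. c k \<noteq> 0}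
      \<and> (\<forall>k. c k \<noteq> 0 \<longrightarrow> is_partition k \<and> length k \<le> N)
      \<and> p = (\<Sum>k\<in>{k. c k \<noteq> 0}. of_int (c k) * schur N k)) kappa"

text \<open>delta: coefficient of S_{Box a b} in the product of the Schur functions.
  We work in a*b variables, which is enough since every partition of size a*b
  has at most a*b parts (so this is the coefficient in the ring of symmetric
  functions).\<close>
definition delta :: "nat \<Rightarrow> nat \<Rightarrow> nat list list \<Rightarrow> int" where
  "delta a b L = schur_coeff (a * b) (prod_list (map (schur (a * b)) L)) (pbox a b)"

definition schubert_problem :: "nat \<Rightarrow> nat \<Rightarrow> nat list list \<Rightarrow> bool" where
  "schubert_problem a b L \<longleftrightarrow>
     (\<forall>l\<in>set L. is_partition l \<and> pcontained l (pbox a b))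
     \<and> sum_list (map psize L) = a * b"

definition composable :: "nat \<Rightarrow> nat \<Rightarrow> nat list list \<Rightarrow> nat list list \<Rightarrow> nat list list
    \<Rightarrow> nat list \<Rightarrow> nat list \<Rightarrow> bool" where
  "composable a b L mu nu as bs \<longleftrightarrow>
     mset (mu @ nu) = mset L
     \<and> length as = length mu \<and> length bs = length nu
     \<and> sum_list as = a \<and> sum_list bs = b
     \<and> (\<forall>i<length mu. length (mu ! i) \<le> as ! i)
     \<and> (\<forall>j<length nu. part (nu ! j) 0 \<le> bs ! j)"

definition compose :: "nat \<Rightarrow> nat \<Rightarrow> nat list list \<Rightarrow> nat list list \<Rightarrow> nat list \<Rightarrow> nat list
    \<Rightarrow> nat list list \<Rightarrow> nat list list \<Rightarrow> nat list list \<Rightarrow> nat list list" where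
  "compose c d mu nu as bs alpha beta gamma =
     map (\<lambda>i. pjoin (padd (pbox (as ! i) d) (mu ! i)) (alpha ! i)) [0..<length mu]
     @ map (\<lambda>j. padd (pjoin (pbox c (bs ! j)) (nu ! j)) (beta ! j)) [0..<length nu]
     @ gamma"

end

theory Submission
  imports Defs
begin

text \<open>
  Split the composed problem into the product \<open>P\<close> of the conditions built from \<open>\<mu>, \<alpha>\<close> and the
  product \<open>Q\<close> of those built from \<open>\<nu>, \<beta>, \<gamma>\<close>. Complementation in the rectangle gives
  \<open>\<delta> = \<Sum> [S\<^sub>\<theta>] P \<cdot> [S\<^sub>\<theta>\<^sub>*] Q\<close>, where \<open>\<theta>\<^sub>*\<close> is the complement of \<open>\<theta>\<close>. Comparing
  the terms of highest degree in the first \<open>c\<close> variables bounds the size of the first \<open>c\<close> rows of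
  every \<open>\<eta>\<close> occurring in \<open>Q\<close> from above, and in the extreme case \<open>[S\<^sub>\<eta>] Q\<close> factors into the
  coefficients for the first \<open>c\<close> rows and for the remaining rows. Littlewood--Richardson
  coefficients are also the coefficients of the coproduct, so the same comparison applied to
  \<open>S\<^sub>\<theta>(x\<^sub>1, x\<^sub>2, \<dots>)\<close>, with one alphabet for each factor of \<open>P\<close> and \<open>a\<^sub>i\<close> distinguished variables in
  the \<open>i\<close>-th alphabet, bounds the size of the first \<open>a\<close> rows of every \<open>\<theta>\<close> occurring in \<open>P\<close> from
  below, again with a factorization in the extreme case. For \<open>\<eta> = \<theta>\<^sub>*\<close> the two bounds force
  equality, and then \<open>\<theta>\<close> consists of an \<open>a \<times> d\<close> rectangle with some \<open>\<kappa>\<close> to its right and some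
  \<open>\<tau>\<close> below it. Summing over \<open>\<kappa>\<close> and \<open>\<tau>\<close> gives the product of the two degrees.
\<close>

section \<open>Horizontal strips\<close>

text \<open>The comparisons choose the number of variables freely, whereas \<open>delta\<close>
  fixes it at \<open>a * b\<close>. Symmetric functions are therefore handled as integer functions
  on exponent lists of any length and are matched with the given polynomials only at the end.
  Integer coefficients might cancel, so leading coefficients are read off through linear
  independence of products of Schur polynomials, with one alphabet for the first rows of a shape and
  another for the rest. The upper bound uses the same number \<open>c\<close> of rows in every
  factor. The lower bound has to allow a different number of rows in each factor, and this is why
  the coproduct is used: a bound on the joint degree of one Schur polynomial becomes a bound on the
  pair of lower indices. Two alphabets are treated at a time, and the list is then handled by
  induction. The bounds meet because the large rectangle falls into four: a full one of size
  \<open>a\<close> by \<open>d\<close>, an empty one of size \<open>c\<close> by \<open>b\<close>,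
  one of size \<open>a\<close> by \<open>b\<close> containing \<kappa> and one of size
  \<open>c\<close> by \<open>d\<close> containing \<tau>. A half turn exchanges the full and the
  empty corner, so the complement has the form produced by the other kind of condition.\<close>

type_synonym shape = "nat \<Rightarrow> nat"

text \<open>A partition is represented by the function mapping \<open>i\<close> to its \<open>(i + 1)\<close>-st part.\<close>

definition is_ptn :: "shape \<Rightarrow> bool" where
  "is_ptn f \<longleftrightarrow> (\<forall>i. f (Suc i) \<le> f i) \<and> (\<exists>n. f n = 0)"

definition weight :: "shape \<Rightarrow> nat" where
  "weight f = (\<Sum>i | f i \<noteq> 0. f i)"

definition Ptns :: "nat \<Rightarrow> shape set" where
  "Ptns n = {f. is_ptn f \<and> weight f = n}"

definition rows :: "nat \<Rightarrow> shape \<Rightarrow> bool" where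
  "rows n f \<longleftrightarrow> (\<forall>i\<ge>n. f i = 0)"

definition horiz_strip :: "shape \<Rightarrow> shape \<Rightarrow> bool" where
  "horiz_strip g h \<longleftrightarrow> (\<forall>i. g i \<le> h i \<and> h (Suc i) \<le> g i)"

lemma is_ptn_mono: "is_ptn f \<Longrightarrow> i \<le> j \<Longrightarrow> f j \<le> f i"
  unfolding is_ptn_def by (metis lift_Suc_antimono_le)

lemma is_ptn_rows: assumes "is_ptn f" obtains n where "rows n f"
proof -
  obtain n where "f n = 0" using assms unfolding is_ptn_def by blast
  then have "rows n f" unfolding rows_def using is_ptn_mono[OF assms] by (metis le_zero_eq)
  then show ?thesis by (rule that)
qed

lemma rows_mono: "rows n f \<Longrightarrow> n \<le> m \<Longrightarrow> rows m f"
  unfolding rows_def by auto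

lemma rows_zero_iff: "is_ptn f \<Longrightarrow> rows n f \<longleftrightarrow> f n = 0"
  unfolding rows_def by (metis le_refl le_zero_eq is_ptn_mono)

lemma weight_rows: "rows n f \<Longrightarrow> weight f = (\<Sum>i<n. f i)"
  unfolding weight_def rows_def
  by (rule sum.mono_neutral_left) (auto simp: not_less[symmetric])

lemma weight_zero [simp]: "weight (\<lambda>_. 0) = 0"
  by (simp add: weight_def)

lemma is_ptn_zero [simp]: "is_ptn (\<lambda>_. 0)"
  by (simp add: is_ptn_def)

text \<open>Each nonzero row holds at least one cell, so the size bounds the number of rows. Hence
  \<open>Ptns n\<close> is finite, and \<open>n\<close> variables are enough to separate Schur
  polynomials of degree \<open>n\<close>.\<close>

lemma is_ptn_rows_weight: assumes "is_ptn f" shows "rows (weight f) f"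
proof -
  obtain n where n: "rows n f" using is_ptn_rows[OF assms] by blast
  have "f (weight f) = 0"
  proof (rule ccontr)
    assume nz: "f (weight f) \<noteq> 0"
    then have lt: "weight f < n" using n unfolding rows_def by (meson not_less)
    have "Suc (weight f) = (\<Sum>i<Suc (weight f). 1)" by simp
    also have "\<dots> \<le> (\<Sum>i<Suc (weight f). f i)"
    proof (rule sum_mono)
      fix i assume "i \<in> {..<Suc (weight f)}"
      then have "f (weight f) \<le> f i" using is_ptn_mono[OF assms] by simp
      then show "1 \<le> f i" using nz by simp
    qed
    also have "\<dots> \<le> (\<Sum>i<n. f i)" by (rule sum_mono2) (use lt in auto)
    also have "\<dots> = weight f" using weight_rows[OF n] by simp
    finally show False by simp
  qed
  then show ?thesis using rows_zero_iff[OF assms] by simp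
qed

lemma finite_Ptns: "finite (Ptns n)"
proof -
  have "Ptns n \<subseteq> {f. \<forall>i. (i \<in> {..<n} \<longrightarrow> f i \<in> {..n}) \<and> (i \<notin> {..<n} \<longrightarrow> f i = 0)}"
  proof (rule subsetI, rule CollectI, rule allI)
    fix f i assume f: "f \<in> Ptns n"
    then have r: "rows n f" using is_ptn_rows_weight by (auto simp: Ptns_def)
    have s: "(\<Sum>i<n. f i) = n" using weight_rows[OF r] f by (simp add: Ptns_def)
    have "f i \<le> n" if "i < n"
      using member_le_sum[of i "{..<n}" f] that s by simp
    moreover have "f i = 0" if "i \<notin> {..<n}" using r that by (simp add: rows_def)
    ultimately show "(i \<in> {..<n} \<longrightarrow> f i \<in> {..n}) \<and> (i \<notin> {..<n} \<longrightarrow> f i = 0)" by auto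
  qed
  moreover have "finite {f::shape. \<forall>i. (i \<in> {..<n} \<longrightarrow> f i \<in> {..n}) \<and> (i \<notin> {..<n} \<longrightarrow> f i = 0)}"
    by (rule finite_set_of_finite_funs) auto
  ultimately show ?thesis by (rule finite_subset)
qed

lemma Ptns_zero: "Ptns 0 = {\<lambda>_. 0}"
proof safe
  fix f :: shape assume f: "f \<in> Ptns 0"
  then have "rows 0 f" using is_ptn_rows_weight[of f] by (simp add: Ptns_def)
  then show "f = (\<lambda>_. 0)" by (auto simp: rows_def)
qed (simp add: Ptns_def)

lemma weight_mono: assumes "is_ptn f" "\<And>i. g i \<le> f i" shows "weight g \<le> weight f"
proof -
  obtain n where n: "rows n f" using is_ptn_rows[OF assms(1)] .
  then have "rows n g" using assms(2) unfolding rows_def by (metis le_zero_eq)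
  then show ?thesis using n weight_rows assms(2) by (simp add: sum_mono)
qed

text \<open>Used wherever an extreme case pins a shape down: containment together with the size
  leaves one choice.\<close>

lemma le_weight_eq: assumes "is_ptn f" "\<And>i. g i \<le> f i" "weight f \<le> weight g" shows "g = f"
proof -
  obtain n where n: "rows n f" using is_ptn_rows[OF assms(1)] .
  then have n': "rows n g" using assms(2) unfolding rows_def by (metis le_zero_eq)
  have "weight g = weight f" using weight_mono[OF assms(1,2)] assms(3) by simp
  then have s: "sum g {..<n} = sum f {..<n}" using weight_rows[OF n] weight_rows[OF n'] by simp
  show ?thesis
  proof
    fix i show "g i = f i"
    proof (cases "i < n")
      case True
      then show ?thesis using sum_mono_inv[OF s] assms(2) by simp
    next
      case False then show ?thesis using n n' by (simp add: rows_def)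
    qed
  qed
qed

text \<open>The rows alternate, \<open>h (Suc i)\<close> lying between \<open>g (Suc i)\<close> and
  \<open>g i\<close>, so monotonicity and vanishing pass from either shape to the other.\<close>

lemma horiz_strip_is_ptn: "horiz_strip g h \<Longrightarrow> is_ptn g \<longleftrightarrow> is_ptn h"
  unfolding is_ptn_def horiz_strip_def by (metis le_trans le_zero_eq)

lemma horiz_strip_le: "horiz_strip g h \<Longrightarrow> g i \<le> h i"
  by (simp add: horiz_strip_def)

lemma horiz_strip_weight: "horiz_strip g h \<Longrightarrow> is_ptn h \<Longrightarrow> weight g \<le> weight h"
  by (rule weight_mono) (auto simp: horiz_strip_def)

lemma horiz_strip_refl: "is_ptn f \<Longrightarrow> horiz_strip f f"
  by (simp add: horiz_strip_def is_ptn_def)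

text \<open>\<open>skew_kostka m g f\<close> counts the chains of horizontal strips of sizes \<open>m\<close> leading from \<open>g\<close> to \<open>f\<close>, that
  is, the semistandard tableaux of skew shape \<open>f / g\<close> and content \<open>m\<close>.\<close>

fun skew_kostka :: "nat list \<Rightarrow> shape \<Rightarrow> shape \<Rightarrow> int" where
  "skew_kostka [] g f = of_bool (g = f)"
| "skew_kostka (k # m) g f = (\<Sum>h\<in>Ptns (weight g + k). of_bool (horiz_strip g h) * skew_kostka m h f)"

text \<open>The last conjunct comes from a horizontal strip having at most one cell in each column,
  so that row \<open>i + 1\<close> of the new shape fits under row \<open>i\<close> of the old one.
  For empty \<open>g\<close> it bounds the number of rows by the number of variables.\<close>

lemma skew_kostka_nz:
  "skew_kostka m g f \<noteq> 0 \<Longrightarrow> is_ptn g \<Longrightarrow> f \<in> Ptns (weight g + sum_list m) \<and> (\<forall>i. g i \<le> f i) \<and> (\<forall>i. f (i + length m) \<le> g i)"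
proof (induction m arbitrary: g)
  case Nil
  then show ?case by (auto simp: Ptns_def split: if_splits)
next
  case (Cons k m)
  then obtain h where h: "h \<in> Ptns (weight g + k)" "horiz_strip g h" "skew_kostka m h f \<noteq> 0"
    by (auto elim!: sum.not_neutral_contains_not_neutral)
  then have IH: "f \<in> Ptns (weight h + sum_list m)" "\<forall>i. h i \<le> f i" "\<forall>i. f (i + length m) \<le> h i"
    using Cons.IH[of h] by (auto simp: Ptns_def)
  show ?case
    using IH h unfolding Ptns_def horiz_strip_def
    by (auto simp: add.assoc intro: le_trans) (metis add_Suc add_Suc_right le_trans)+
qed

lemma skew_kostka_append:
  "is_ptn g \<Longrightarrow> skew_kostka (m @ m') g f = (\<Sum>h\<in>Ptns (weight g + sum_list m). skew_kostka m g h * skew_kostka m' h f)"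
proof (induction m arbitrary: g)
  case Nil
  then have "g \<in> Ptns (weight g)" by (simp add: Ptns_def)
  moreover have "(\<Sum>h\<in>Ptns (weight g). skew_kostka [] g h * skew_kostka m' h f) = (\<Sum>h\<in>Ptns (weight g). if h = g then skew_kostka m' g f else 0)"
    by (rule sum.cong) auto
  ultimately show ?case using finite_Ptns[of "weight g"] by simp
next
  case (Cons k m)
  have "skew_kostka ((k # m) @ m') g f = (\<Sum>h\<in>Ptns (weight g + k). of_bool (horiz_strip g h) *
      (\<Sum>h'\<in>Ptns (weight g + k + sum_list m). skew_kostka m h h' * skew_kostka m' h' f))"
    by (auto intro!: sum.cong simp: Cons.IH Ptns_def)
  also have "\<dots> = (\<Sum>h'\<in>Ptns (weight g + k + sum_list m). \<Sum>h\<in>Ptns (weight g + k).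
       of_bool (horiz_strip g h) * (skew_kostka m h h' * skew_kostka m' h' f))"
    unfolding sum_distrib_left by (rule sum.swap)
  finally show ?case by (simp add: sum_distrib_right mult.assoc add.assoc)
qed

lemma skew_kostka_single:
  assumes "is_ptn g" shows "skew_kostka [k] g f = of_bool (horiz_strip g f \<and> weight f = weight g + k)"
proof -
  have "skew_kostka [k] g f = (\<Sum>h\<in>Ptns (weight g + k). if h = f then of_bool (horiz_strip g f) else 0)"
    unfolding skew_kostka.simps by (rule sum.cong) auto
  also have "\<dots> = of_bool (horiz_strip g f \<and> weight f = weight g + k)"
    using finite_Ptns assms horiz_strip_is_ptn[of g f] by (auto simp: Ptns_def)
  finally show ?thesis .
qed

lemma skew_kostka_snoc:
  assumes "is_ptn g"
  shows "skew_kostka (m @ [k]) g f = (\<Sum>h\<in>Ptns (weight g + sum_list m).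
    skew_kostka m g h * of_bool (horiz_strip h f \<and> weight f = weight g + sum_list m + k))"
  unfolding skew_kostka_append[OF assms]
  by (rule sum.cong) (auto simp: skew_kostka_single Ptns_def simp del: skew_kostka.simps)

lemma skew_kostka_zero:
  assumes "is_ptn g" shows "skew_kostka (0 # m) g f = skew_kostka m g f"
proof -
  have "skew_kostka (0 # m) g f = (\<Sum>h\<in>Ptns (weight g). if h = g then skew_kostka m g f else 0)"
  proof (simp, rule sum.cong)
    fix h assume h: "h \<in> Ptns (weight g)"
    show "of_bool (horiz_strip g h) * skew_kostka m h f = (if h = g then skew_kostka m g f else 0)"
    proof (cases "h = g")
      case True then show ?thesis using horiz_strip_refl[OF assms] by simp
    next
      case False
      then have "\<not> horiz_strip g h"
        using le_weight_eq[of h g] h by (auto simp: Ptns_def horiz_strip_def)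
      then show ?thesis using False by simp
    qed
  qed simp
  then show ?thesis using finite_Ptns assms by (simp add: Ptns_def)
qed

text \<open>The summands are the lower and the upper end of the interval available to row
  \<open>i\<close> of a shape between \<open>g\<close> and \<open>f\<close>. The lower end at
  \<open>i\<close> and the upper end at \<open>Suc i\<close> are the maximum and the minimum of the
  same two numbers, so only the last maximum is left unpaired.\<close>

lemma sum_max_min_telescope:
  fixes f g :: shape
  shows "(\<Sum>i<Suc n. max (g i) (f (Suc i)) + (case i of 0 \<Rightarrow> f 0 | Suc j \<Rightarrow> min (f (Suc j)) (g j)))
     = (\<Sum>i<Suc n. f i) + (\<Sum>i<n. g i) + max (g n) (f (Suc n))"
  by (induction n) auto

text \<open>Between two fixed shapes the rows of the middle shape vary independently in intervals;
  reflecting each interval is the Bender--Knuth involution.\<close>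

lemma skew_kostka_swap2:
  assumes "is_ptn g" shows "skew_kostka [j, k] g f = skew_kostka [k, j] g f"
proof -
  have card: "skew_kostka [j, k] g f = (if weight f = weight g + j + k then int (card {h\<in>Ptns (weight g + j). horiz_strip g h \<and> horiz_strip h f}) else 0)" for j k
  proof -
    have "skew_kostka [j, k] g f = (\<Sum>h\<in>Ptns (weight g + j). of_bool (horiz_strip g h) * of_bool (horiz_strip h f \<and> weight f = weight g + j + k))"
      unfolding skew_kostka.simps(2)[of j]
      by (rule sum.cong) (auto simp: skew_kostka_single Ptns_def simp del: skew_kostka.simps)
    also have "\<dots> = (\<Sum>h\<in>Ptns (weight g + j). if horiz_strip g h \<and> horiz_strip h f then of_bool (weight f = weight g + j + k) else 0)"
      by (rule sum.cong) auto
    also have "\<dots> = (\<Sum>h\<in>{h\<in>Ptns (weight g + j). horiz_strip g h \<and> horiz_strip h f}. of_bool (weight f = weight g + j + k))"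
      by (rule sum.inter_filter[symmetric]) (rule finite_Ptns)
    finally show ?thesis by simp
  qed
  define lo where "lo i = max (g i) (f (Suc i))" for i
  define hi where "hi i = (case i of 0 \<Rightarrow> f 0 | Suc j \<Rightarrow> min (f (Suc j)) (g j))" for i
  define r where "r h = (\<lambda>i. lo i + hi i - h i)" for h :: shape
  have between: "horiz_strip g h \<and> horiz_strip h f \<longleftrightarrow> (\<forall>i. lo i \<le> h i \<and> h i \<le> hi i)" for h
  proof
    assume a: "horiz_strip g h \<and> horiz_strip h f"
    show "\<forall>i. lo i \<le> h i \<and> h i \<le> hi i"
    proof
      fix i show "lo i \<le> h i \<and> h i \<le> hi i"
        using a unfolding horiz_strip_def lo_def hi_def by (cases i) auto
    qed
  next
    assume a: "\<forall>i. lo i \<le> h i \<and> h i \<le> hi i"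
    have "g i \<le> h i \<and> h (Suc i) \<le> g i \<and> h i \<le> f i \<and> f (Suc i) \<le> h i" for i
      using a[rule_format, of i] a[rule_format, of "Suc i"] unfolding lo_def hi_def
      by (cases i) auto
    then show "horiz_strip g h \<and> horiz_strip h f" unfolding horiz_strip_def by blast
  qed
  show ?thesis
  proof (cases "weight f = weight g + j + k \<and> is_ptn f")
    case False
    \<comment> \<open>No chain of total size \<open>j + k\<close> reaches such an \<open>f\<close>,
      so both counts vanish.\<close>
    have "skew_kostka [j', k'] g f = 0" if "j' + k' = j + k" for j' k'
    proof (rule ccontr)
      assume "skew_kostka [j', k'] g f \<noteq> 0"
      then have "f \<in> Ptns (weight g + sum_list [j', k'])" using skew_kostka_nz assms by blast
      then show False using False that by (simp add: Ptns_def)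
    qed
    from this[of j k] this[of k j] show ?thesis by simp
  next
    case True
    then obtain n where n: "rows n f" using is_ptn_rows by blast
    obtain n' where n': "rows n' g" using is_ptn_rows[OF assms] by blast
    define N where "N = max n n'"
    have Nf: "rows N f" and Ng: "rows N g" using n n' rows_mono N_def by auto
    have total: "(\<Sum>i<Suc N. lo i + hi i) = weight f + weight g"
      using sum_max_min_telescope[of g f N] Nf Ng weight_rows[OF Nf] weight_rows[OF Ng]
      unfolding lo_def hi_def by (simp add: rows_def)
    have rr: "r h \<in> {h\<in>Ptns (weight g + k'). horiz_strip g h \<and> horiz_strip h f} \<and> r (r h) = h"
      if h: "h \<in> {h\<in>Ptns (weight g + j'). horiz_strip g h \<and> horiz_strip h f}" and jk: "j' + k' = j + k" for h j' k'
    proof -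
      have b: "lo i \<le> h i" "h i \<le> hi i" for i using h between[of h] by auto
      have b': "\<forall>i. lo i \<le> r h i \<and> r h i \<le> hi i"
      proof
        fix i show "lo i \<le> r h i \<and> r h i \<le> hi i" using b[of i] unfolding r_def by linarith
      qed
      then have I: "horiz_strip g (r h)" "horiz_strip (r h) f" using between by auto
      have P: "is_ptn (r h)" using horiz_strip_is_ptn[OF I(1)] assms by simp
      have Nh: "rows N h" "rows N (r h)" using I h Nf unfolding rows_def horiz_strip_def
        by (auto) (metis le_zero_eq)+
      \<comment> \<open>Row by row \<open>h\<close> and \<open>r h\<close> add up to
        \<open>lo + hi\<close>, whose total is \<open>weight f + weight g\<close>; so the reflection
        turns a first strip of size \<open>j'\<close> into one of size \<open>k'\<close>.\<close>
      have "(\<Sum>i<Suc N. h i) + (\<Sum>i<Suc N. r h i) = (\<Sum>i<Suc N. lo i + hi i)"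
        unfolding sum.distrib[symmetric] r_def
        by (rule sum.cong) (simp_all add: trans_le_add2[OF b(2)])
      then have "weight h + weight (r h) = weight f + weight g"
        using total weight_rows[OF rows_mono[OF Nh(1), of "Suc N"]] weight_rows[OF rows_mono[OF Nh(2), of "Suc N"]] by simp
      then have "weight (r h) = weight g + k'" using h jk True by (simp add: Ptns_def)
      moreover have "r (r h) = h" 
      proof
        fix i show "r (r h) i = h i" using b[of i] unfolding r_def by linarith
      qed
      ultimately show ?thesis using I P by (simp add: Ptns_def)
    qed
    define A where "A j = {h\<in>Ptns (weight g + j). horiz_strip g h \<and> horiz_strip h f}" for j
    have AB: "r h \<in> A k \<and> r (r h) = h" if "h \<in> A j" for h
      using rr[OF that[unfolded A_def] refl] unfolding A_def .
    have BA: "r h \<in> A j \<and> r (r h) = h" if "h \<in> A k" for h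
      using rr[OF that[unfolded A_def] add.commute] unfolding A_def .
    have "bij_betw r (A j) (A k)"
      by (rule bij_betw_byWitness[where f' = r]) (use AB BA in auto)
    then have "card (A j) = card (A k)" by (rule bij_betw_same_card)
    then show ?thesis using card[of j k] card[of k j] by (simp add: add_ac A_def)
  qed
qed


section \<open>Symmetric and stable coefficient functions\<close>

lemma skew_kostka_swap:
  assumes "is_ptn g" shows "skew_kostka (u @ j # k # v) g f = skew_kostka (u @ k # j # v) g f"
proof -
  have *: "skew_kostka (j # k # v) h f = skew_kostka (k # j # v) h f" if "is_ptn h" for h
    using skew_kostka_append[OF that, of "[j,k]" v f] skew_kostka_append[OF that, of "[k,j]" v f] skew_kostka_swap2[OF that]
    by (simp add: add_ac del: skew_kostka.simps)
  show ?thesis unfolding skew_kostka_append[OF assms, of u]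
    by (rule sum.cong) (simp_all add: * Ptns_def del: skew_kostka.simps)
qed

text \<open>Adjacent transpositions generate all rearrangements: the entry heading \<open>m\<close>
  is moved to the front of \<open>m'\<close>, and the induction hypothesis is applied to the
  function that prepends this entry.\<close>

lemma swap_invariant_imp_mset_invariant:
  assumes "\<And>u j k v. F (u @ j # k # v) = F (u @ k # j # v)" "mset m = mset m'"
  shows "F m = F m'"
  using assms
proof (induction m arbitrary: F m')
  case (Cons k t)
  have "k \<in> set m'" using Cons.prems(2) by (metis list.set_intros(1) set_mset_mset)
  then obtain u v where m': "m' = u @ k # v" by (meson split_list)
  \<comment> \<open>The arbitrary prefix \<open>w\<close> absorbs the entries that \<open>k\<close>
    has yet to cross.\<close>
  have "F (w @ u @ k # v) = F (w @ k # u @ v)" for w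
  proof (induction u arbitrary: w)
    case (Cons x u)
    show ?case using Cons.IH[of "w @ [x]"] Cons.prems \<open>\<And>u j k v. F (u @ j # k # v) = F (u @ k # j # v)\<close>[of w x k "u @ v"] by simp
  qed simp
  from this[of "[]"] have 1: "F m' = F (k # u @ v)" by (simp add: m')
  have "F (k # t) = F (k # (u @ v))"
  proof (rule Cons.IH[of "\<lambda>x. F (k # x)"])
    show "F (k # u @ j # ka # v) = F (k # u @ ka # j # v)" for u j ka v
      using Cons.prems(1)[of "k # u" j ka v] by simp
    show "mset t = mset (u @ v)" using Cons.prems(2) m' by simp
  qed
  then show ?case using 1 by simp
qed simp

text \<open>Besides symmetry this asks for stability: an extra variable with exponent 0 changes
  nothing. Such a function collects the coefficients of a symmetric function in arbitrarily many
  variables.\<close>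

definition symmetric_coeffs :: "(nat list \<Rightarrow> int) \<Rightarrow> bool" where
  "symmetric_coeffs F \<longleftrightarrow> (\<forall>m m'. mset m = mset m' \<longrightarrow> F m = F m') \<and> (\<forall>m. F (0 # m) = F m)"

lemma symmetric_coeffs_mset: "symmetric_coeffs F \<Longrightarrow> mset m = mset m' \<Longrightarrow> F m = F m'"
  unfolding symmetric_coeffs_def by blast

lemma symmetric_coeffs_zero: "symmetric_coeffs F \<Longrightarrow> F (0 # m) = F m"
  unfolding symmetric_coeffs_def by blast

lemma symmetric_coeffs_skew_kostka: "is_ptn g \<Longrightarrow> symmetric_coeffs (\<lambda>m. skew_kostka m g f)"
  unfolding symmetric_coeffs_def
proof (intro conjI allI impI)
  assume g: "is_ptn g"
  show "skew_kostka m g f = skew_kostka m' g f" if "mset m = mset m'" for m m'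
    by (rule swap_invariant_imp_mset_invariant[where F = "\<lambda>m. skew_kostka m g f", OF skew_kostka_swap[OF g] that])
  show "skew_kostka (0 # m) g f = skew_kostka m g f" for m by (rule skew_kostka_zero[OF g])
qed

lemma is_partition_is_ptn:
  assumes "is_partition l" shows "is_ptn (part l)" "weight (part l) = sum_list l" "rows (length l) (part l)"
proof -
  show r: "rows (length l) (part l)" by (simp add: rows_def part_def)
  have "l ! Suc i \<le> l ! i" if "Suc i < length l" for i
    using assms that unfolding is_partition_def by (auto simp: sorted_rev_iff_nth_Suc)
  then show "is_ptn (part l)" unfolding is_ptn_def by (auto simp: part_def)
  show "weight (part l) = sum_list l"
    unfolding weight_rows[OF r] by (auto simp: sum_list_sum_nth part_def atLeast0LessThan)
qed

lemma symmetric_coeffs_zeros: "symmetric_coeffs F \<Longrightarrow> F (m @ replicate n 0) = F m"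
proof (induction n)
  case (Suc n)
  have "F (m @ replicate (Suc n) 0) = F (0 # m @ replicate n 0)"
    by (rule symmetric_coeffs_mset[OF Suc.prems]) simp
  also have "\<dots> = F (m @ replicate n 0)" using Suc.prems by (rule symmetric_coeffs_zero)
  finally show ?case using Suc by simp
qed simp

lemma symmetric_coeffs_filter: "symmetric_coeffs F \<Longrightarrow> F m = F (filter (\<lambda>x. x \<noteq> 0) m)"
proof (induction m arbitrary: F)
  case (Cons k m)
  show ?case
  proof (cases "k = 0")
    case True then show ?thesis using Cons.IH[OF Cons.prems] symmetric_coeffs_zero[OF Cons.prems] by simp
  next
    case False
    have "symmetric_coeffs (\<lambda>x. F (k # x))"
      unfolding symmetric_coeffs_def
    proof safe
      show "F (k # m) = F (k # m')" if "mset m = mset m'" for m m'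
        by (rule symmetric_coeffs_mset[OF Cons.prems]) (simp add: that)
      have "F (k # 0 # m) = F (0 # k # m)" for m by (rule symmetric_coeffs_mset[OF Cons.prems]) simp
      then show "F (k # 0 # m) = F (k # m)" for m using symmetric_coeffs_zero[OF Cons.prems] by simp
    qed
    from Cons.IH[OF this] show ?thesis using False by simp
  qed
qed simp

lemma length_le_sum_list: "(\<forall>x\<in>set l. (0::nat) < x) \<Longrightarrow> length l \<le> sum_list l"
  by (induction l) (auto simp: Suc_le_eq intro: add_mono)

lemma sum_list_filter_nz: "sum_list (filter (\<lambda>x. x \<noteq> (0::nat)) m) = sum_list m"
  by (induction m) auto

text \<open>Sorting \<open>m\<close> and adjusting the number of zeros gives a partition of
  \<open>sum_list m\<close> written with exactly that many entries. The same \<open>f\<close> serves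
  all \<open>F\<close> at once, so an identity of degree \<open>n\<close> need only be checked at
  finitely many exponents, indexed by the partitions of \<open>n\<close>.\<close>

lemma symmetric_coeffs_canonical:
  obtains f where "f \<in> Ptns (sum_list m)" "\<forall>F. symmetric_coeffs F \<longrightarrow> F m = F (map f [0..<sum_list m])"
proof
  define l where "l = rev (sort (filter (\<lambda>x. x \<noteq> 0) m))"
  have ms: "mset l = mset (filter (\<lambda>x. x \<noteq> 0) m)" by (simp add: l_def)
  have p: "is_partition l" by (auto simp: l_def is_partition_def)
  have sl: "sum_list l = sum_list m"
    using ms sum_list_filter_nz[of m] by (metis sum_mset_sum_list)
  then have len: "length l \<le> sum_list m" using length_le_sum_list[of l] p by (simp add: is_partition_def)
  show "part l \<in> Ptns (sum_list m)" using is_partition_is_ptn[OF p] sl by (simp add: Ptns_def)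
  have mp: "map (part l) [0..<sum_list m] = l @ replicate (sum_list m - length l) 0"
    using len by (intro nth_equalityI) (auto simp: part_def nth_append)
  have "F m = F (map (part l) [0..<sum_list m])" if "symmetric_coeffs F" for F
    unfolding mp symmetric_coeffs_zeros[OF that] using symmetric_coeffs_filter[OF that, of m] symmetric_coeffs_mset[OF that ms] by simp
  then show "\<forall>F. symmetric_coeffs F \<longrightarrow> F m = F (map (part l) [0..<sum_list m])" by blast
qed

section \<open>Expansions in Schur functions\<close>

text \<open>Substitution along increasing \<open>w\<close>. An index \<open>x\<close> of maximal
  \<open>w\<close> is added last: its row of \<open>A\<close> vanishes at the earlier indices, so
  the equations already solved stay intact and \<open>Y x\<close> settles the new one.\<close>

lemma unitriangular_solvable:
  fixes A :: "'a \<Rightarrow> 'a \<Rightarrow> int" and w :: "'a \<Rightarrow> nat"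
  assumes "finite I" "\<And>i. i \<in> I \<Longrightarrow> A i i = 1"
    and "\<And>i j. i \<in> I \<Longrightarrow> j \<in> I \<Longrightarrow> i \<noteq> j \<Longrightarrow> A i j \<noteq> 0 \<Longrightarrow> w i < w j"
  shows "\<exists>X. \<forall>j\<in>I. F j = (\<Sum>i\<in>I. X i * A i j)"
  using assms
proof (induction I rule: finite_ranking_induct[where f = w])
  case (insert x S)
  then obtain X where X: "\<forall>j\<in>S. F j = (\<Sum>i\<in>S. X i * A i j)" by auto
  show ?case
  proof (cases "x \<in> S")
    case True then show ?thesis using X by (auto simp: insert_absorb)
  next
    case False
    define Y where "Y = X(x := F x - (\<Sum>i\<in>S. X i * A i x))"
    have YS: "(\<Sum>i\<in>S. Y i * A i j) = (\<Sum>i\<in>S. X i * A i j)" for j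
      by (rule sum.cong) (use False in \<open>auto simp: Y_def\<close>)
    have Ax: "A x j = 0" if "j \<in> S" for j
      using insert.prems(2)[of x j] insert.hyps(2)[of j] that False by force
    have "F j = (\<Sum>i\<in>insert x S. Y i * A i j)" if "j \<in> insert x S" for j
      using that insert.hyps False YS[of j] Ax X insert.prems(1)[of x] by (auto simp: Y_def)
    then show ?thesis by blast
  qed
qed simp

text \<open>Induction on \<open>w j\<close>: in the equation at \<open>j\<close> every other term
  with a nonzero matrix entry has smaller \<open>w\<close>, so its coefficient is already known to
  vanish.\<close>

lemma unitriangular_inj:
  fixes A :: "'a \<Rightarrow> 'a \<Rightarrow> int" and w :: "'a \<Rightarrow> nat"
  assumes "finite I" "\<And>i. i \<in> I \<Longrightarrow> A i i = 1"
    and "\<And>i j. i \<in> I \<Longrightarrow> j \<in> I \<Longrightarrow> i \<noteq> j \<Longrightarrow> A i j \<noteq> 0 \<Longrightarrow> w i < w j"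
    and "\<And>j. j \<in> I \<Longrightarrow> (\<Sum>i\<in>I. X i * A i j) = 0" and "j \<in> I"
  shows "X j = 0"
  using assms(5)
proof (induction "w j" arbitrary: j rule: less_induct)
  case less
  have "X i * A i j = 0" if "i \<in> I - {j}" for i
    using assms(3)[of i j] less.hyps[of i] less.prems that by (cases "A i j = 0") auto
  then have "(\<Sum>i\<in>I. X i * A i j) = X j * A j j"
    by (subst sum.remove[OF assms(1) less.prems]) (simp add: sum.neutral del: mult_eq_0_iff)
  then show ?case using assms(2,4) less.prems by simp
qed

text \<open>\<open>kostka f m\<close> is the coefficient of \<open>x\<^sup>m\<close> in the Schur polynomial of \<open>f\<close> in \<open>length m\<close>
  variables. Polynomials in any number of variables are represented by such coefficient functions
  on lists of exponents.\<close>

abbreviation kostka :: "shape \<Rightarrow> nat list \<Rightarrow> int" where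
  "kostka f m \<equiv> skew_kostka m (\<lambda>_. 0) f"

lemma kostka_nz:
  assumes "kostka f m \<noteq> 0" shows "f \<in> Ptns (sum_list m)" "rows (length m) f"
  using skew_kostka_nz[OF assms] by (auto simp: rows_def) (metis le_add_diff_inverse2)

lemma kostka_sum_neq: "weight f \<noteq> sum_list m \<Longrightarrow> kostka f m = 0"
  using kostka_nz[of m f] by (auto simp: Ptns_def)

lemma kostka_snoc: "kostka f (m @ [k]) = (\<Sum>h\<in>Ptns (sum_list m). kostka h m * of_bool (horiz_strip h f \<and> weight f = sum_list m + k))"
  by (simp add: skew_kostka_snoc)

text \<open>An entry \<open>i\<close> of a semistandard tableau cannot lie below row
  \<open>i\<close>, so passing from the content to the shape can only lower the total row index, and
  lowers it strictly unless each \<open>i\<close> fills row \<open>i\<close>. This single number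
  replaces the dominance order as the measure of triangularity.\<close>

lemma kostka_triangular:
  assumes "kostka f m \<noteq> 0"
  shows "(\<Sum>i<length m. i * f i) \<le> (\<Sum>i<length m. i * m ! i) \<and>
    ((\<Sum>i<length m. i * f i) = (\<Sum>i<length m. i * m ! i) \<longrightarrow> f = part m)"
  using assms
proof (induction m arbitrary: f rule: rev_induct)
  case Nil
  then have "f = (\<lambda>_. 0)" by (auto split: if_splits)
  then show ?case by (auto simp: part_def)
next
  case (snoc k m)
  define N where "N = length m"
  obtain h where h: "h \<in> Ptns (sum_list m)" "kostka h m \<noteq> 0" "horiz_strip h f" "weight f = sum_list m + k"
    using snoc.prems unfolding kostka_snoc by (auto elim!: sum.not_neutral_contains_not_neutral)
  have rh: "rows N h" and rf: "rows (Suc N) f"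
    using kostka_nz[OF h(2)] kostka_nz[OF snoc.prems] by (auto simp: N_def)
  \<comment> \<open>\<open>e i\<close> is the number of cells of the last strip in row
    \<open>i\<close>. Each cell above row \<open>N\<close> costs at least one unit of the total row
    index, which is the gap estimated below; equality therefore puts all \<open>k\<close> cells into
    row \<open>N\<close>.\<close>
  define e where "e i = f i - h i" for i
  have f: "f i = h i + e i" for i using horiz_strip_le[OF h(3)] by (simp add: e_def)
  have sf: "(\<Sum>i<N. f i) = (\<Sum>i<N. h i) + (\<Sum>i<N. e i)" by (simp add: f sum.distrib)
  have k: "k = (\<Sum>i<N. e i) + f N"
    using weight_rows[OF rh] weight_rows[OF rf] h(1,4) sf by (simp add: Ptns_def)
  have "(\<Sum>i<N. i * f i + e i) \<le> (\<Sum>i<N. i * h i + N * e i)"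
  proof (rule sum_mono)
    fix i assume "i \<in> {..<N}"
    then have "Suc i * e i \<le> N * e i" by (intro mult_right_mono) auto
    then show "i * f i + e i \<le> i * h i + N * e i" by (simp add: f algebra_simps)
  qed
  then have a: "(\<Sum>i<N. i * f i) + (\<Sum>i<N. e i) \<le> (\<Sum>i<N. i * h i) + N * (\<Sum>i<N. e i)"
    by (simp add: sum.distrib sum_distrib_left)
  have IH: "(\<Sum>i<N. i * h i) \<le> (\<Sum>i<N. i * m ! i)" "(\<Sum>i<N. i * h i) = (\<Sum>i<N. i * m ! i) \<Longrightarrow> h = part m"
    using snoc.IH[OF h(2)] by (auto simp: N_def)
  have L: "(\<Sum>i<length (m @ [k]). i * f i) = (\<Sum>i<N. i * f i) + N * f N"
    by (simp add: N_def)
  have R: "(\<Sum>i<length (m @ [k]). i * (m @ [k]) ! i) = (\<Sum>i<N. i * m ! i) + N * ((\<Sum>i<N. e i) + f N)"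
    by (simp add: N_def k nth_append)
  have dist: "N * ((\<Sum>i<N. e i) + f N) = N * (\<Sum>i<N. e i) + N * f N" by (simp add: algebra_simps)
  show ?case unfolding L R dist
  proof (intro conjI impI)
    show "(\<Sum>i<N. i * f i) + N * f N \<le> (\<Sum>i<N. i * m ! i) + (N * sum e {..<N} + N * f N)"
      using a IH(1) by linarith
    assume eq: "(\<Sum>i<N. i * f i) + N * f N = (\<Sum>i<N. i * m ! i) + (N * sum e {..<N} + N * f N)"
    have e0: "(\<Sum>i<N. e i) = 0" and hm: "h = part m"
      using a IH eq by linarith+
    show "f = part (m @ [k])"
    proof
      fix i
      consider "i < N" | "i = N" | "N < i" by linarith
      then show "f i = part (m @ [k]) i"
      proof cases
        case 1
        then have "e i = 0" using e0 by simp
        then show ?thesis using 1 f[of i] hm by (simp add: N_def part_def nth_append)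
      next
        case 2 then show ?thesis using k e0 by (simp add: N_def part_def)
      next
        case 3 then show ?thesis using rf by (simp add: N_def part_def rows_def)
      qed
    qed
  qed
qed

lemma is_ptn_take: "is_ptn f \<Longrightarrow> is_ptn (\<lambda>i. if i < N then f i else 0)"
  unfolding is_ptn_def by auto

text \<open>Only the tableau with all entries of row \<open>i\<close> equal to \<open>i\<close> has
  this content: before the last strip the shape has at most \<open>N\<close> rows, lies in
  \<open>f\<close> and has the size of the first \<open>N\<close> rows of \<open>f\<close>, hence
  equals them.\<close>

lemma kostka_diag: "is_ptn f \<Longrightarrow> rows N f \<Longrightarrow> kostka f (map f [0..<N]) = 1"
proof (induction N arbitrary: f)
  case 0
  then have "f = (\<lambda>_. 0)" by (auto simp: rows_def)
  then show ?case by simp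
next
  case (Suc N)
  define t where "t = (\<lambda>i. if i < N then f i else 0)"
  have t: "is_ptn t" "rows N t" using is_ptn_take[OF Suc.prems(1)] by (auto simp: t_def rows_def)
  have mt: "map f [0..<N] = map t [0..<N]" by (auto simp: t_def)
  have sl: "sum_list (map f [0..<N]) = weight t"
    unfolding mt weight_rows[OF t(2)] by (simp add: sum_list_sum_nth atLeast0LessThan)
  have wf: "weight f = weight t + f N"
    using weight_rows[OF t(2)] weight_rows[OF Suc.prems(2)] by (simp add: t_def)
  have it: "horiz_strip t f"
    using Suc.prems unfolding horiz_strip_def t_def is_ptn_def by (auto simp: rows_def)
  have "kostka f (map f [0..<Suc N]) = (\<Sum>h\<in>Ptns (weight t). kostka h (map f [0..<N]) * of_bool (horiz_strip h f))"
    using kostka_snoc[where f = f and m = "map f [0..<N]" and k = "f N"] by (simp add: sl wf)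
  also have "\<dots> = (\<Sum>h\<in>Ptns (weight t). if h = t then 1 else 0)"
  proof (rule sum.cong)
    fix h assume h: "h \<in> Ptns (weight t)"
    show "kostka h (map f [0..<N]) * of_bool (horiz_strip h f) = (if h = t then 1 else 0)"
    proof (cases "h = t")
      case True then show ?thesis using Suc.IH[OF t] it unfolding mt by simp
    next
      case False
      have "\<not> (kostka h (map f [0..<N]) \<noteq> 0 \<and> horiz_strip h f)"
      proof
        assume a: "kostka h (map f [0..<N]) \<noteq> 0 \<and> horiz_strip h f"
        then have "rows N h" using kostka_nz(2)[of "map f [0..<N]" h] by simp
        then have "h i \<le> t i" for i using a horiz_strip_le[of h f i] by (auto simp: t_def rows_def)
        then have "h = t" using le_weight_eq[OF t(1), of h] h by (simp add: Ptns_def)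
        then show False using False by simp
      qed
      then show ?thesis using False by auto
    qed
  qed simp
  also have "\<dots> = 1" using finite_Ptns t(1) by (simp add: Ptns_def)
  finally show ?case .
qed

text \<open>The set \<open>T\<close> of test points is explicit because the families are restricted
  to exponents of prescribed lengths, and products of such restrictions have to be independent as
  well.\<close>

definition indep :: "'a set \<Rightarrow> ('a \<Rightarrow> 't \<Rightarrow> int) \<Rightarrow> 't set \<Rightarrow> bool" where
  "indep A \<Phi> T \<longleftrightarrow> (\<forall>S X. finite S \<longrightarrow> S \<subseteq> A \<longrightarrow> (\<forall>t\<in>T. (\<Sum>i\<in>S. X i * \<Phi> i t) = 0) \<longrightarrow> (\<forall>i\<in>S. X i = 0))"

lemma indepD:
  "indep A \<Phi> T \<Longrightarrow> finite S \<Longrightarrow> S \<subseteq> A \<Longrightarrow> (\<And>t. t \<in> T \<Longrightarrow> (\<Sum>i\<in>S. X i * \<Phi> i t) = 0) \<Longrightarrow> i \<in> S \<Longrightarrow> X i = 0"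
  unfolding indep_def by blast

lemma part_map_rows: "rows N g \<Longrightarrow> part (map g [0..<N]) = g"
  by (auto simp: part_def rows_def)

lemma kostka_weight_less:
  assumes "rows N g" "kostka f (map g [0..<N]) \<noteq> 0" "f \<noteq> g"
  shows "(\<Sum>i<N. i * f i) < (\<Sum>i<N. i * g i)"
proof -
  have "(\<Sum>i<N. i * map g [0..<N] ! i) = (\<Sum>i<N. i * g i)" by (rule sum.cong) auto
  then show ?thesis using kostka_triangular[OF assms(2)] assms(3) part_map_rows[OF assms(1)]
    by (auto simp: le_less)
qed

text \<open>Testing at the exponent \<open>g\<close> for each shape \<open>g\<close> gives a
  unitriangular system. Shapes with more than \<open>N\<close> rows are left out because their Schur
  polynomials vanish in \<open>N\<close> variables.\<close>

lemma indep_kostka: "indep {f. is_ptn f \<and> rows N f} kostka {m. length m = N}"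
  unfolding indep_def
proof (intro allI impI ballI)
  fix S :: "shape set" and X f
  assume S: "finite S" "S \<subseteq> {f. is_ptn f \<and> rows N f}" "\<forall>t\<in>{m. length m = N}. (\<Sum>i\<in>S. X i * kostka i t) = 0" and f: "f \<in> S"
  show "X f = 0"
  proof (rule unitriangular_inj[where A = "\<lambda>f g. kostka f (map g [0..<N])" and w = "\<lambda>f. \<Sum>i<N. i * f i" and I = S and X = X and j = f])
    show "(\<Sum>i<N. i * f i) < (\<Sum>i<N. i * g i)"
      if "f \<in> S" "g \<in> S" "f \<noteq> g" "kostka f (map g [0..<N]) \<noteq> 0" for f g
      using kostka_weight_less[of N g f] that S by auto
  qed (use S f in \<open>auto intro: kostka_diag\<close>)
qed

lemma indep_prod:
  assumes "indep A \<Phi> T" "indep B \<Psi> U"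
  shows "indep (A \<times> B) (\<lambda>(a, b) (t, u). \<Phi> a t * \<Psi> b u) (T \<times> U)"
  unfolding indep_def
proof (intro allI impI ballI)
  fix S X i
  assume S: "finite S" "S \<subseteq> A \<times> B" and i: "i \<in> S"
    and z: "\<forall>t\<in>T \<times> U. (\<Sum>i\<in>S. X i * (case i of (a, b) \<Rightarrow> \<lambda>(t, u). \<Phi> a t * \<Psi> b u) t) = 0"
  \<comment> \<open>Extending the coefficients by zero from \<open>S\<close> to the product of its
    two projections turns the sum into an iterated one, so the independence of the two families
    applies one after the other.\<close>
  define Y where "Y i = (if i \<in> S then X i else 0)" for i
  have sub: "S \<subseteq> fst ` S \<times> snd ` S" by force
  have *: "(\<Sum>a\<in>fst ` S. (\<Sum>b\<in>snd ` S. Y (a, b) * \<Psi> b u) * \<Phi> a t) = 0" if "t \<in> T" "u \<in> U" for t u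
  proof -
    have "(\<Sum>a\<in>fst ` S. (\<Sum>b\<in>snd ` S. Y (a, b) * \<Psi> b u) * \<Phi> a t)
        = (\<Sum>(a, b)\<in>fst ` S \<times> snd ` S. Y (a, b) * (\<Phi> a t * \<Psi> b u))"
      unfolding sum_distrib_right sum.cartesian_product by (rule sum.cong) (auto simp: mult_ac)
    also have "\<dots> = (\<Sum>(a, b)\<in>S. Y (a, b) * (\<Phi> a t * \<Psi> b u))"
      by (rule sum.mono_neutral_right) (use S sub in \<open>auto simp: Y_def\<close>)
    also have "\<dots> = (\<Sum>i\<in>S. X i * (case i of (a, b) \<Rightarrow> \<lambda>(t, u). \<Phi> a t * \<Psi> b u) (t, u))"
      by (rule sum.cong) (auto simp: Y_def)
    finally show ?thesis using z that by auto
  qed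
  have A: "fst ` S \<subseteq> A" "snd ` S \<subseteq> B" using S(2) by auto
  have "(\<Sum>b\<in>snd ` S. Y (a, b) * \<Psi> b u) = 0" if "a \<in> fst ` S" "u \<in> U" for a u
    by (rule indepD[OF assms(1) _ A(1), where X = "\<lambda>a. \<Sum>b\<in>snd ` S. Y (a, b) * \<Psi> b u"])
      (use * S that in auto)
  then have "Y (fst i, snd i) = 0"
    by (intro indepD[OF assms(2) _ A(2), where X = "\<lambda>b. Y (fst i, b)"]) (use S i in auto)
  then show "X i = 0" using i by (simp add: Y_def)
qed

text \<open>The Kostka matrix over the partitions of \<open>n\<close> is square and unitriangular,
  hence solvable over the integers; \<open>symmetric_coeffs_canonical\<close> then carries the
  solution to all exponents of degree \<open>n\<close>.\<close>

lemma symmetric_coeffs_expansion_exists: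
  assumes "symmetric_coeffs F"
  shows "\<exists>X. \<forall>m. sum_list m = n \<longrightarrow> F m = (\<Sum>f\<in>Ptns n. X f * kostka f m)"
proof -
  have rw: "rows n f" if "f \<in> Ptns n" for f using that is_ptn_rows_weight by (auto simp: Ptns_def)
  have "\<exists>X. \<forall>g\<in>Ptns n. F (map g [0..<n]) = (\<Sum>f\<in>Ptns n. X f * kostka f (map g [0..<n]))"
  proof (rule unitriangular_solvable[where w = "\<lambda>f. \<Sum>i<n. i * f i"])
    show "(\<Sum>i<n. i * f i) < (\<Sum>i<n. i * g i)"
      if "f \<in> Ptns n" "g \<in> Ptns n" "f \<noteq> g" "kostka f (map g [0..<n]) \<noteq> 0" for f g
      using kostka_weight_less[of n g f] that rw by auto
    show "kostka f (map f [0..<n]) = 1" if "f \<in> Ptns n" for f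
      using kostka_diag rw[OF that] that by (auto simp: Ptns_def)
  qed (rule finite_Ptns)
  then obtain X where X: "\<forall>g\<in>Ptns n. F (map g [0..<n]) = (\<Sum>f\<in>Ptns n. X f * kostka f (map g [0..<n]))" by blast
  have "F m = (\<Sum>f\<in>Ptns n. X f * kostka f m)" if "sum_list m = n" for m
  proof -
    obtain g where g: "g \<in> Ptns (sum_list m)" "\<forall>F. symmetric_coeffs F \<longrightarrow> F m = F (map g [0..<sum_list m])"
      by (rule symmetric_coeffs_canonical[of m])
    have "kostka f m = kostka f (map g [0..<sum_list m])" for f using g(2)[rule_format, OF symmetric_coeffs_skew_kostka[OF is_ptn_zero]] .
    then show ?thesis using X g(1) g(2)[rule_format, OF assms] unfolding that by simp
  qed
  then show ?thesis by blast
qed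

text \<open>The choice is meaningful only for symmetric \<open>F\<close>.\<close>

definition schur_coeff_of :: "(nat list \<Rightarrow> int) \<Rightarrow> shape \<Rightarrow> int" where
  "schur_coeff_of F f = (SOME X. \<forall>m. sum_list m = weight f \<longrightarrow> F m = (\<Sum>g\<in>Ptns (weight f). X g * kostka g m)) f"

text \<open>With exactly \<open>n\<close> variables no shape of size \<open>n\<close> is lost, so
  independence applies; exponents of any other degree contribute trivial equations.\<close>

lemma kostka_expansion_unique:
  assumes "\<And>m. sum_list m = n \<Longrightarrow> (\<Sum>g\<in>Ptns n. X g * kostka g m) = (\<Sum>g\<in>Ptns n. Y g * kostka g m)" "f \<in> Ptns n"
  shows "X f = Y f"
proof -
  have "X f - Y f = 0"
  proof (rule indepD[OF indep_kostka[of n] finite_Ptns[of n], where X = "\<lambda>f. X f - Y f"])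
    show "Ptns n \<subseteq> {f. is_ptn f \<and> rows n f}" using is_ptn_rows_weight by (auto simp: Ptns_def)
    fix m
    show "(\<Sum>i\<in>Ptns n. (X i - Y i) * kostka i m) = 0"
    proof (cases "sum_list m = n")
      case True then show ?thesis using assms(1) by (simp add: left_diff_distrib sum_subtractf)
    next
      case False then show ?thesis by (intro sum.neutral) (auto simp: Ptns_def kostka_sum_neq)
    qed
  qed (rule assms(2))
  then show ?thesis by simp
qed

lemma schur_coeff_of_unique:
  assumes "\<And>m. sum_list m = n \<Longrightarrow> F m = (\<Sum>g\<in>Ptns n. X g * kostka g m)" "f \<in> Ptns n"
  shows "schur_coeff_of F f = X f"
proof -
  define Y where "Y = (SOME X. \<forall>m. sum_list m = weight f \<longrightarrow> F m = (\<Sum>g\<in>Ptns (weight f). X g * kostka g m))"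
  have n: "weight f = n" using assms(2) by (simp add: Ptns_def)
  have "\<forall>m. sum_list m = weight f \<longrightarrow> F m = (\<Sum>g\<in>Ptns (weight f). Y g * kostka g m)"
    unfolding Y_def by (rule someI[of _ X]) (use assms(1) n in auto)
  then have "Y f = X f" by (intro kostka_expansion_unique[OF _ assms(2)]) (use assms(1) n in auto)
  then show ?thesis by (simp add: schur_coeff_of_def Y_def)
qed

lemma schur_coeff_of_expansion:
  assumes "symmetric_coeffs F" shows "F m = (\<Sum>g\<in>Ptns (sum_list m). schur_coeff_of F g * kostka g m)"
proof -
  obtain X where X: "\<And>m'. sum_list m' = sum_list m \<Longrightarrow> F m' = (\<Sum>f\<in>Ptns (sum_list m). X f * kostka f m')"
    using symmetric_coeffs_expansion_exists[OF assms] by blast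
  have "(\<Sum>g\<in>Ptns (sum_list m). schur_coeff_of F g * kostka g m) = (\<Sum>g\<in>Ptns (sum_list m). X g * kostka g m)"
    by (rule sum.cong) (simp_all add: schur_coeff_of_unique[OF X])
  then show ?thesis using X[of m] by simp
qed

section \<open>The Pieri rule\<close>

text \<open>\<open>split_sum H m\<close> is the sum of \<open>H x y\<close> over all decompositions \<open>m = x + y\<close>, so that \<open>convolve F G\<close>
  represents the product of the polynomials represented by \<open>F\<close> and \<open>G\<close>.\<close>

fun split_sum :: "(nat list \<Rightarrow> nat list \<Rightarrow> int) \<Rightarrow> nat list \<Rightarrow> int" where
  "split_sum H [] = H [] []"
| "split_sum H (k # m) = (\<Sum>j\<le>k. split_sum (\<lambda>x y. H (j # x) ((k - j) # y)) m)"

lemma split_sum_cong: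
  "(\<And>x y. length x = length m \<Longrightarrow> length y = length m \<Longrightarrow> sum_list x + sum_list y = sum_list m \<Longrightarrow> H x y = H' x y)
    \<Longrightarrow> split_sum H m = split_sum H' m"
proof (induction m arbitrary: H H')
  case (Cons k m)
  show ?case unfolding split_sum.simps
    by (rule sum.cong[OF refl], rule Cons.IH, rule Cons.prems) auto
qed simp

lemma split_sum_sum: "split_sum (\<lambda>x y. \<Sum>i\<in>S. H i x y) m = (\<Sum>i\<in>S. split_sum (H i) m)"
proof (induction m arbitrary: H)
  case (Cons k m)
  show ?case unfolding split_sum.simps Cons.IH by (rule sum.swap)
qed simp

lemma split_sum_scale: "split_sum (\<lambda>x y. c * H x y) m = c * split_sum H m"
  by (induction m arbitrary: H) (simp_all add: sum_distrib_left)

lemma split_sum_scale_right: "split_sum (\<lambda>x y. H x y * c) m = split_sum H m * c"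
  using split_sum_scale[of c H m] by (simp add: mult.commute)

lemma split_sum_zero: "(\<And>x y. length x = length m \<Longrightarrow> length y = length m \<Longrightarrow> sum_list x + sum_list y = sum_list m \<Longrightarrow> H x y = 0)
    \<Longrightarrow> split_sum H m = 0"
  using split_sum_cong[of m H "\<lambda>x y. 0 * 0"] split_sum_scale[of 0 "\<lambda>_ _. 0" m] by simp

lemma split_sum_append: "split_sum H (u @ v) = split_sum (\<lambda>x y. split_sum (\<lambda>x' y'. H (x @ x') (y @ y')) v) u"
  by (induction u arbitrary: H) simp_all

lemma split_sum_commute: "split_sum H m = split_sum (\<lambda>x y. H y x) m"
proof (induction m arbitrary: H)
  case (Cons k m)
  have "split_sum H (k # m) = (\<Sum>j\<le>k. split_sum (\<lambda>x y. H (j # y) ((k - j) # x)) m)"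
    unfolding split_sum.simps by (rule sum.cong[OF refl]) (rule Cons.IH)
  also have "\<dots> = split_sum (\<lambda>x y. H y x) (k # m)" unfolding split_sum.simps
    by (rule sum.reindex_bij_witness[of _ "\<lambda>j. k - j" "\<lambda>j. k - j"]) auto
  finally show ?case .
qed simp

text \<open>In each coordinate both sides run over the splittings of \<open>k\<close> into three
  parts; only the order in which the two cuts are made differs.\<close>

lemma split_sum_assoc:
  "split_sum (\<lambda>x y. split_sum (\<lambda>x1 x2. H x1 x2 y) x) m = split_sum (\<lambda>x1 w. split_sum (\<lambda>x2 y. H x1 x2 y) w) m"
proof (induction m arbitrary: H)
  case (Cons k m)
  have "split_sum (\<lambda>x y. split_sum (\<lambda>x1 x2. H x1 x2 y) x) (k # m)
     = (\<Sum>j\<le>k. \<Sum>i\<le>j. split_sum (\<lambda>x1 w. split_sum (\<lambda>x2 y. H (i # x1) ((j - i) # x2) ((k - j) # y)) w) m)"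
    unfolding split_sum.simps split_sum_sum by (intro sum.cong refl) (rule Cons.IH)
  also have "\<dots> = (\<Sum>(j, i)\<in>(SIGMA j:{..k}. {..j}). split_sum (\<lambda>x1 w. split_sum (\<lambda>x2 y. H (i # x1) ((j - i) # x2) ((k - j) # y)) w) m)"
    by (simp add: sum.Sigma)
  also have "\<dots> = (\<Sum>(i, l)\<in>(SIGMA i:{..k}. {..k - i}). split_sum (\<lambda>x1 w. split_sum (\<lambda>x2 y. H (i # x1) (l # x2) ((k - i - l) # y)) w) m)"
    by (rule sum.reindex_bij_witness[of _ "\<lambda>(i, l). (i + l, i)" "\<lambda>(j, i). (i, j - i)"]) auto
  also have "\<dots> = split_sum (\<lambda>x1 w. split_sum (\<lambda>x2 y. H x1 x2 y) w) (k # m)"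
    by (simp add: split_sum_sum sum.Sigma)
  finally show ?case .
qed simp

abbreviation convolve :: "(nat list \<Rightarrow> int) \<Rightarrow> (nat list \<Rightarrow> int) \<Rightarrow> nat list \<Rightarrow> int" where
  "convolve F G \<equiv> split_sum (\<lambda>x y. F x * G y)"

text \<open>The complete homogeneous symmetric polynomial: every monomial of degree \<open>k\<close>
  occurs once.\<close>

definition hom_sym :: "nat \<Rightarrow> nat list \<Rightarrow> int" where
  "hom_sym k m = of_bool (sum_list m = k)"

lemma convolve_hom_sym_0: "convolve (hom_sym 0) F m = F m"
proof (induction m arbitrary: F)
  case (Cons k m)
  have "split_sum (\<lambda>x y. hom_sym 0 (j # x) * F ((k - j) # y)) m = (if j = 0 then F (k # m) else 0)" for j
  proof (cases "j = 0")
    case True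
    then have "split_sum (\<lambda>x y. hom_sym 0 (j # x) * F ((k - j) # y)) m = convolve (hom_sym 0) (\<lambda>y. F (k # y)) m"
      by (simp add: hom_sym_def)
    then show ?thesis using Cons.IH[of "\<lambda>y. F (k # y)"] True by simp
  next
    case False then show ?thesis by (simp, intro split_sum_zero) (simp add: hom_sym_def)
  qed
  then show ?case by simp
qed (simp add: hom_sym_def)

lemma convolve_assoc: "convolve (convolve F G) H m = convolve F (convolve G H) m"
proof -
  have "convolve (convolve F G) H m = split_sum (\<lambda>x y. split_sum (\<lambda>x1 x2. F x1 * G x2 * H y) x) m"
    by (simp add: split_sum_scale_right)
  also have "\<dots> = convolve F (convolve G H) m"
    by (subst split_sum_assoc) (simp add: mult.assoc split_sum_scale[symmetric])
  finally show ?thesis .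
qed

lemma convolve_commute: "convolve F G m = convolve G F m"
  by (subst split_sum_commute) (simp add: mult.commute)

lemma finite_horiz_strip_below: assumes "is_ptn f" shows "finite {r. is_ptn r \<and> horiz_strip r f}"
proof (rule finite_subset)
  show "{r. is_ptn r \<and> horiz_strip r f} \<subseteq> (\<Union>n\<le>weight f. Ptns n)"
    using horiz_strip_weight assms by (auto simp: Ptns_def)
qed (simp add: finite_Ptns)

text \<open>Unlike in \<open>kostka_snoc\<close>, the index set depends on \<open>f\<close> alone
  and not on \<open>m\<close>. The sum can therefore be pulled out of \<open>split_sum\<close>,
  where the exponents vary.\<close>

lemma kostka_snoc_below:
  assumes "is_ptn f"
  shows "kostka f (m @ [k]) = (\<Sum>r\<in>{r. is_ptn r \<and> horiz_strip r f}. kostka r m * of_bool (weight f = weight r + k))"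
proof -
  have "kostka f (m @ [k]) = (\<Sum>h\<in>{h \<in> Ptns (sum_list m). horiz_strip h f}. kostka h m * of_bool (weight f = sum_list m + k))"
    unfolding kostka_snoc by (rule sum.mono_neutral_cong_right) (auto simp: finite_Ptns)
  also have "\<dots> = (\<Sum>h\<in>{h \<in> Ptns (sum_list m). horiz_strip h f}. kostka h m * of_bool (weight f = weight h + k))"
    by (rule sum.cong) (auto simp: Ptns_def)
  also have "\<dots> = (\<Sum>r\<in>{r. is_ptn r \<and> horiz_strip r f}. kostka r m * of_bool (weight f = weight r + k))"
    by (rule sum.mono_neutral_left) (use finite_horiz_strip_below[OF assms] in \<open>auto simp: Ptns_def dest!: kostka_nz(1)\<close>)
  finally show ?thesis .
qed

text \<open>The minimum and the maximum of a pair add up to the sum of the pair. This fixes the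
  total size of two shapes that are reflections of each other in the intervals of the next
  lemma.\<close>

lemma sum_max_min:
  fixes l v :: shape
  shows "max (l 0) (v 0) + (\<Sum>i<n. min (l i) (v i) + max (l (Suc i)) (v (Suc i)))
    = (\<Sum>i<n. l i) + (\<Sum>i<n. v i) + max (l n) (v n)"
  by (induction n) auto

text \<open>The shapes below and above two fixed shapes vary in the same product of intervals, except
  that the first row of a shape above is unbounded.\<close>

lemma card_horiz_strip_below_above:
  assumes l: "is_ptn l" and v: "is_ptn v" and q: "weight v + q = weight l + k"
  shows "card {r. is_ptn r \<and> horiz_strip r l \<and> horiz_strip r v \<and> weight l \<le> weight r + q}
    = card {u \<in> Ptns (weight l + k). horiz_strip l u \<and> horiz_strip v u}" (is "card ?A = card ?B")
proof -
  define s where "s i = min (l i) (v i) + max (l (Suc i)) (v (Suc i))" for i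
  \<comment> \<open>The rows of \<open>r\<close> are reflected and moved down by one. Row 0 absorbs
    the remaining cells: it exceeds its lower bound by \<open>weight r + q - weight l\<close>, which
    is why the set on the left requires this difference to be nonnegative.\<close>
  define \<phi> where "\<phi> r = (\<lambda>i. case i of 0 \<Rightarrow> max (l 0) (v 0) + (weight r + q - weight l) | Suc j \<Rightarrow> s j - r j)" for r :: shape
  define \<psi> where "\<psi> u = (\<lambda>i. s i - u (Suc i))" for u :: shape
  obtain N where N: "rows N l" "rows N v"
    using is_ptn_rows[OF l] is_ptn_rows[OF v] rows_mono by (metis max.cobounded1 max.cobounded2)
  have below: "horiz_strip r l \<and> horiz_strip r v \<longleftrightarrow> (\<forall>i. max (l (Suc i)) (v (Suc i)) \<le> r i \<and> r i \<le> min (l i) (v i))" for r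
    unfolding horiz_strip_def by auto
  have above: "horiz_strip l u \<and> horiz_strip v u \<longleftrightarrow> max (l 0) (v 0) \<le> u 0 \<and> (\<forall>i. max (l (Suc i)) (v (Suc i)) \<le> u (Suc i) \<and> u (Suc i) \<le> min (l i) (v i))" (is "?L \<longleftrightarrow> ?R") for u
  proof
    assume ?R
    then have "l i \<le> u i \<and> v i \<le> u i" for i by (cases i) auto
    then show ?L using \<open>?R\<close> unfolding horiz_strip_def by auto
  qed (auto simp: horiz_strip_def)
  have total: "max (l 0) (v 0) + (\<Sum>i<N. s i) = weight l + weight v"
    using sum_max_min[of l v N] N weight_rows[OF N(1)] weight_rows[OF N(2)] unfolding s_def by (simp add: rows_def)
  have wts: "weight r + weight u + max (l 0) (v 0) = weight l + weight v + u 0"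
    if "rows N r" "rows (Suc N) u" "\<And>i. r i + u (Suc i) = s i" for r u
  proof -
    have "weight u = u 0 + (\<Sum>i<N. u (Suc i))" unfolding weight_rows[OF that(2)] by (rule sum.lessThan_Suc_shift)
    moreover have "weight r + (\<Sum>i<N. u (Suc i)) = (\<Sum>i<N. s i)"
      unfolding weight_rows[OF that(1)] sum.distrib[symmetric] using that(3) by simp
    ultimately show ?thesis using total by linarith
  qed
  have AB: "\<phi> r \<in> ?B \<and> \<psi> (\<phi> r) = r" if r: "r \<in> ?A" for r
  proof -
    have b: "max (l (Suc i)) (v (Suc i)) \<le> r i" "r i \<le> min (l i) (v i)" for i using r below[of r] by auto
    have s: "r i + \<phi> r (Suc i) = s i" for i
    proof -
      have "r i \<le> s i" using b(2)[of i] unfolding s_def by linarith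
      then show ?thesis by (simp add: \<phi>_def)
    qed
    have b': "max (l (Suc i)) (v (Suc i)) \<le> \<phi> r (Suc i) \<and> \<phi> r (Suc i) \<le> min (l i) (v i)" for i
      using b[of i] s[of i] unfolding s_def by linarith
    have 0: "\<phi> r 0 = max (l 0) (v 0) + (weight r + q - weight l)" by (simp add: \<phi>_def)
    have I: "horiz_strip l (\<phi> r)" "horiz_strip v (\<phi> r)" using above[of "\<phi> r"] b' 0 by auto
    have P: "is_ptn (\<phi> r)" using horiz_strip_is_ptn[OF I(1)] l by simp
    have "rows N r" unfolding rows_def
    proof (intro allI impI)
      fix i assume "N \<le> i" then show "r i = 0" using b(2)[of i] N by (simp add: rows_def)
    qed
    moreover have "rows (Suc N) (\<phi> r)" unfolding rows_def
    proof (intro allI impI)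
      fix i assume "Suc N \<le> i" then show "\<phi> r i = 0" using b'[of "i - 1"] N by (cases i) (auto simp: rows_def)
    qed
    ultimately have "weight r + weight (\<phi> r) + max (l 0) (v 0) = weight l + weight v + \<phi> r 0" using wts s by blast
    then have "weight (\<phi> r) = weight l + k" using 0 r q by auto
    moreover have "\<psi> (\<phi> r) = r"
    proof
      fix i show "\<psi> (\<phi> r) i = r i" using s[of i] unfolding \<psi>_def by linarith
    qed
    ultimately show ?thesis using I P by (simp add: Ptns_def)
  qed
  have BA: "\<psi> u \<in> ?A \<and> \<phi> (\<psi> u) = u" if u: "u \<in> ?B" for u
  proof -
    have b: "max (l (Suc i)) (v (Suc i)) \<le> u (Suc i)" "u (Suc i) \<le> min (l i) (v i)" "max (l 0) (v 0) \<le> u 0" for i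
      using u above[of u] by auto
    have s: "\<psi> u i + u (Suc i) = s i" for i
    proof -
      have "u (Suc i) \<le> s i" using b(2)[of i] unfolding s_def by linarith
      then show ?thesis by (simp add: \<psi>_def)
    qed
    have b': "max (l (Suc i)) (v (Suc i)) \<le> \<psi> u i \<and> \<psi> u i \<le> min (l i) (v i)" for i
      using b(1)[of i] b(2)[of i] s[of i] unfolding s_def by linarith
    then have I: "horiz_strip (\<psi> u) l" "horiz_strip (\<psi> u) v" using below[of "\<psi> u"] by auto
    have P: "is_ptn (\<psi> u)" using horiz_strip_is_ptn[OF I(1)] l by simp
    have "rows N (\<psi> u)" unfolding rows_def
    proof (intro allI impI)
      fix i assume "N \<le> i" then show "\<psi> u i = 0" using b'[of i] N by (simp add: rows_def)
    qed
    moreover have "rows (Suc N) u" unfolding rows_def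
    proof (intro allI impI)
      fix i assume "Suc N \<le> i" then show "u i = 0" using b(2)[of "i - 1"] N by (cases i) (auto simp: rows_def)
    qed
    ultimately have w: "weight (\<psi> u) + weight u + max (l 0) (v 0) = weight l + weight v + u 0" using wts s by blast
    have wu: "weight u = weight l + k" using u by (simp add: Ptns_def)
    have w': "weight (\<psi> u) + q + max (l 0) (v 0) = weight l + u 0" using w wu q by linarith
    then have le: "weight l \<le> weight (\<psi> u) + q" using b(3) by linarith
    have "\<phi> (\<psi> u) = u"
    proof
      fix i show "\<phi> (\<psi> u) i = u i"
      proof (cases i)
        case 0 then show ?thesis using w' le unfolding \<phi>_def by simp
      next
        case (Suc j) then show ?thesis using s[of j] unfolding \<phi>_def by simp
      qed
    qed
    then show ?thesis using I P le by simp
  qed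
  have "bij_betw \<phi> ?A ?B"
  proof (rule bij_betw_byWitness[where f' = \<psi>])
    show "\<forall>a\<in>?A. \<psi> (\<phi> a) = a" by (rule ballI, drule AB, erule conjunct2)
    show "\<forall>a\<in>?B. \<phi> (\<psi> a) = a" by (rule ballI, drule BA, erule conjunct2)
    show "\<phi> ` ?A \<subseteq> ?B" by (rule image_subsetI, drule AB, erule conjunct1)
    show "\<psi> ` ?B \<subseteq> ?A" by (rule image_subsetI, drule BA, erule conjunct1)
  qed
  then show ?thesis by (rule bij_betw_same_card)
qed

lemma sum_of_bool_card: "finite S \<Longrightarrow> (\<Sum>x\<in>S. of_bool (P x)) = int (card {x\<in>S. P x})"
  by (simp add: sum.inter_filter[symmetric] of_bool_def)

text \<open>Induction on the number of variables. Splitting off the last exponent expands both sides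
  in the polynomials \<open>kostka v\<close> of the other variables: on the left through shapes
  \<open>r\<close> below \<open>l\<close> and \<open>v\<close>, on the right through shapes
  \<open>u\<close> above both. The two counts agree by
  \<open>card_horiz_strip_below_above\<close>.\<close>

lemma pieri:
  assumes "is_ptn l"
  shows "convolve (hom_sym k) (kostka l) m = (\<Sum>u\<in>Ptns (weight l + k). of_bool (horiz_strip l u) * kostka u m)"
  using assms
proof (induction m arbitrary: l k rule: rev_induct)
  case Nil
  have "(\<Sum>u\<in>Ptns (weight l + k). of_bool (horiz_strip l u) * kostka u []) = (\<Sum>u\<in>Ptns (weight l + k). if u = (\<lambda>_. 0) then of_bool (horiz_strip l u) else 0)"
    by (rule sum.cong) auto
  also have "\<dots> = of_bool (weight l + k = 0 \<and> horiz_strip l (\<lambda>_. 0))"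
    using finite_Ptns by (auto simp: Ptns_def)
  also have "\<dots> = of_bool (k = 0 \<and> l = (\<lambda>_. 0))"
    by (auto simp: horiz_strip_def)
  finally show ?case by (auto simp: hom_sym_def)
next
  case (snoc q m)
  define D where "D = {r. is_ptn r \<and> horiz_strip r l}"
  have fD: "finite D" using finite_horiz_strip_below[OF snoc.prems] by (simp add: D_def)
  have inner: "split_sum (\<lambda>x y. of_bool (sum_list x + j = k) * kostka r y) m
      = (\<Sum>v\<in>Ptns (sum_list m). of_bool (horiz_strip r v \<and> weight v + j = weight r + k) * kostka v m)" (is "?L = ?R") if r: "is_ptn r" for r j
  proof (cases "j \<le> k")
    case True
    then have "?L = convolve (hom_sym (k - j)) (kostka r) m" by (intro split_sum_cong) (auto simp: hom_sym_def)
    also have "\<dots> = (\<Sum>u\<in>Ptns (weight r + (k - j)). of_bool (horiz_strip r u) * kostka u m)" by (rule snoc.IH[OF r])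
    also have "\<dots> = ?R"
      by (rule sum.mono_neutral_cong) (use True finite_Ptns in \<open>auto simp: Ptns_def kostka_sum_neq\<close>)
    finally show ?thesis .
  next
    case False
    \<comment> \<open>Here \<open>k - j\<close> would truncate to 0, so the vanishing of both sides
      is shown directly.\<close>
    then have "?L = 0" by (intro split_sum_zero) auto
    moreover have "\<not> (horiz_strip r v \<and> weight v + j = weight r + k)" if "v \<in> Ptns (sum_list m)" for v
      using horiz_strip_weight[of r v] that False by (auto simp: Ptns_def)
    ultimately show ?thesis by (simp add: sum.neutral)
  qed
  have "convolve (hom_sym k) (kostka l) (m @ [q]) = split_sum (\<lambda>x y. \<Sum>j\<le>q. hom_sym k (x @ [j]) * kostka l (y @ [q - j])) m"
    unfolding split_sum_append by simp
  also have "\<dots> = split_sum (\<lambda>x y. \<Sum>j\<le>q. \<Sum>r\<in>D. of_bool (weight l = weight r + (q - j)) * (of_bool (sum_list x + j = k) * kostka r y)) m"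
    unfolding kostka_snoc_below[OF snoc.prems] D_def by (simp add: hom_sym_def sum_distrib_left mult_ac)
  also have "\<dots> = (\<Sum>j\<le>q. \<Sum>r\<in>D. of_bool (weight l = weight r + (q - j)) *
      (\<Sum>v\<in>Ptns (sum_list m). of_bool (horiz_strip r v \<and> weight v + j = weight r + k) * kostka v m))"
    unfolding split_sum_sum split_sum_scale by (intro sum.cong) (auto simp: inner D_def)
  also have "\<dots> = (\<Sum>j\<le>q. \<Sum>r\<in>D. \<Sum>v\<in>Ptns (sum_list m).
      of_bool (weight l = weight r + (q - j) \<and> horiz_strip r v \<and> weight v + j = weight r + k) * kostka v m)"
    unfolding sum_distrib_left by (intro sum.cong) auto
  also have "\<dots> = (\<Sum>v\<in>Ptns (sum_list m). (\<Sum>r\<in>D. \<Sum>j\<le>q.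
      of_bool (weight l = weight r + (q - j) \<and> horiz_strip r v \<and> weight v + j = weight r + k)) * kostka v m)"
    unfolding sum_distrib_right
    by (subst sum.swap, subst sum.swap[of _ "Ptns (sum_list m)"]) (rule sum.cong[OF refl], rule sum.swap)
  also have "\<dots> = (\<Sum>v\<in>Ptns (sum_list m). (\<Sum>u\<in>Ptns (weight l + k). of_bool (horiz_strip l u \<and> horiz_strip v u \<and> weight u = sum_list m + q)) * kostka v m)"
  proof (rule sum.cong[OF refl], rule arg_cong[of _ _ "\<lambda>x. x * _"])
    fix v assume v: "v \<in> Ptns (sum_list m)"
    show "(\<Sum>r\<in>D. \<Sum>j\<le>q. of_bool (weight l = weight r + (q - j) \<and> horiz_strip r v \<and> weight v + j = weight r + k))
      = (\<Sum>u\<in>Ptns (weight l + k). of_bool (horiz_strip l u \<and> horiz_strip v u \<and> weight u = sum_list m + q) :: int)"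
    proof (cases "weight v + q = weight l + k")
      case True
      \<comment> \<open>For given \<open>r\<close> the sizes determine \<open>j\<close>, the
        exponent taken by the complete homogeneous factor, so the inner sum has at most one nonzero
        term.\<close>
      have cnt: "(\<Sum>j\<le>q. of_bool (weight l = weight r + (q - j) \<and> horiz_strip r v \<and> weight v + j = weight r + k))
        = (of_bool (horiz_strip r v \<and> weight l \<le> weight r + q) :: int)" if r: "r \<in> D" for r
      proof -
        have "weight r \<le> weight l" using r horiz_strip_weight[of r l] snoc.prems by (simp add: D_def)
        then have "weight l = weight r + (q - j) \<and> horiz_strip r v \<and> weight v + j = weight r + k \<longleftrightarrow> j = weight r + q - weight l \<and> horiz_strip r v \<and> weight l \<le> weight r + q"
          if "j \<le> q" for j using that True by auto
        then have "(\<Sum>j\<le>q. of_bool (weight l = weight r + (q - j) \<and> horiz_strip r v \<and> weight v + j = weight r + k))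
          = (\<Sum>j\<le>q. if j = weight r + q - weight l then of_bool (horiz_strip r v \<and> weight l \<le> weight r + q) else 0 :: int)"
          by (intro sum.cong) auto
        also have "\<dots> = of_bool (horiz_strip r v \<and> weight l \<le> weight r + q)" using \<open>weight r \<le> weight l\<close> by auto
        finally show ?thesis .
      qed
      then have "(\<Sum>r\<in>D. \<Sum>j\<le>q. of_bool (weight l = weight r + (q - j) \<and> horiz_strip r v \<and> weight v + j = weight r + k))
        = int (card {r\<in>D. horiz_strip r v \<and> weight l \<le> weight r + q})" by (simp only: cnt sum_of_bool_card[OF fD] cong: sum.cong)
      also have "{r\<in>D. horiz_strip r v \<and> weight l \<le> weight r + q} = {r. is_ptn r \<and> horiz_strip r l \<and> horiz_strip r v \<and> weight l \<le> weight r + q}"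
        by (auto simp: D_def)
      also have "card \<dots> = card {u \<in> Ptns (weight l + k). horiz_strip l u \<and> horiz_strip v u}"
        using card_horiz_strip_below_above[OF snoc.prems _ True] v by (simp add: Ptns_def)
      also have "{u \<in> Ptns (weight l + k). horiz_strip l u \<and> horiz_strip v u} = {u \<in> Ptns (weight l + k). horiz_strip l u \<and> horiz_strip v u \<and> weight u = sum_list m + q}"
        using True v by (auto simp: Ptns_def)
      also have "int (card \<dots>) = (\<Sum>u\<in>Ptns (weight l + k). of_bool (horiz_strip l u \<and> horiz_strip v u \<and> weight u = sum_list m + q))"
        by (simp only: sum_of_bool_card[OF finite_Ptns])
      finally show ?thesis .
    next
      case False
      have "(\<Sum>r\<in>D. \<Sum>j\<le>q. of_bool (weight l = weight r + (q - j) \<and> horiz_strip r v \<and> weight v + j = weight r + k)) = (0::int)"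
        by (intro sum.neutral ballI) (use False in auto)
      moreover have "(\<Sum>u\<in>Ptns (weight l + k). of_bool (horiz_strip l u \<and> horiz_strip v u \<and> weight u = sum_list m + q)) = (0::int)"
        by (intro sum.neutral ballI) (use False v in \<open>auto simp: Ptns_def\<close>)
      ultimately show ?thesis by simp
    qed
  qed
  also have "\<dots> = (\<Sum>u\<in>Ptns (weight l + k). \<Sum>v\<in>Ptns (sum_list m). of_bool (horiz_strip l u \<and> horiz_strip v u \<and> weight u = sum_list m + q) * kostka v m)"
    unfolding sum_distrib_right by (rule sum.swap)
  also have "\<dots> = (\<Sum>u\<in>Ptns (weight l + k). of_bool (horiz_strip l u) * kostka u (m @ [q]))"
    unfolding kostka_snoc sum_distrib_left by (intro sum.cong) auto
  finally show ?case .
qed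

section \<open>Littlewood--Richardson coefficients\<close>

definition lr_coeff :: "shape \<Rightarrow> shape \<Rightarrow> shape \<Rightarrow> int" where
  "lr_coeff \<theta> \<rho> \<sigma> = schur_coeff_of (\<lambda>m. skew_kostka m \<rho> \<theta>) \<sigma>"

lemma lr_coeff_expansion:
  "is_ptn \<rho> \<Longrightarrow> skew_kostka m \<rho> \<theta> = (\<Sum>\<sigma>\<in>Ptns (sum_list m). lr_coeff \<theta> \<rho> \<sigma> * kostka \<sigma> m)"
  unfolding lr_coeff_def by (rule schur_coeff_of_expansion[OF symmetric_coeffs_skew_kostka])

text \<open>If there were no skew tableau in the degree of \<sigma>, the zero expansion would
  represent the skew Schur polynomial there, and uniqueness would make the coefficient 0. Size and
  containment are then inherited from \<open>skew_kostka_nz\<close>.\<close>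

lemma lr_coeff_nz:
  assumes "is_ptn \<rho>" "is_ptn \<sigma>" "lr_coeff \<theta> \<rho> \<sigma> \<noteq> 0" shows "\<theta> \<in> Ptns (weight \<rho> + weight \<sigma>)" "\<rho> i \<le> \<theta> i"
proof -
  have *: "\<exists>m. sum_list m = weight \<sigma> \<and> skew_kostka m \<rho> \<theta> \<noteq> 0"
  proof (rule ccontr)
    assume "\<not> ?thesis"
    then have "schur_coeff_of (\<lambda>m. skew_kostka m \<rho> \<theta>) \<sigma> = 0"
      by (intro schur_coeff_of_unique[where X = "\<lambda>_. 0" and n = "weight \<sigma>"]) (use assms(2) in \<open>auto simp: Ptns_def\<close>)
    then show False using assms(3) by (simp add: lr_coeff_def)
  qed
  then show "\<theta> \<in> Ptns (weight \<rho> + weight \<sigma>)" "\<rho> i \<le> \<theta> i"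
    using skew_kostka_nz[OF _ assms(1)] by metis+
qed

text \<open>By the Pieri rule a product of complete homogeneous polynomials times the Schur polynomial of
  \<open>\<rho>\<close> expands with skew Kostka numbers as coefficients. Inverting the Kostka matrix identifies the
  coefficients \<open>lr_coeff\<close>, defined through skew Schur polynomials, with the structure constants of the
  multiplication.\<close>

fun hom_prod :: "nat list \<Rightarrow> nat list \<Rightarrow> int" where
  "hom_prod [] = hom_sym 0"
| "hom_prod (k # l) = convolve (hom_prod l) (hom_sym k)"

lemma convolve_sum_right: "convolve F (\<lambda>y. \<Sum>i\<in>S. c i * G i y) m = (\<Sum>i\<in>S. c i * convolve F (G i) m)"
proof -
  have "convolve F (\<lambda>y. \<Sum>i\<in>S. c i * G i y) m = split_sum (\<lambda>x y. \<Sum>i\<in>S. c i * (F x * G i y)) m"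
    by (rule arg_cong[of _ _ "\<lambda>H. split_sum H m"]) (auto simp: sum_distrib_left mult_ac intro!: ext)
  then show ?thesis by (simp add: split_sum_sum split_sum_scale)
qed

lemma convolve_sum_left: "convolve (\<lambda>y. \<Sum>i\<in>S. c i * G i y) F m = (\<Sum>i\<in>S. c i * convolve (G i) F m)"
  unfolding convolve_commute[of _ F] by (rule convolve_sum_right)

text \<open>The Pieri rule iterated: each factor adds a horizontal strip, and the chains of strips
  are what \<open>skew_kostka\<close> counts.\<close>

lemma convolve_hom_prod_kostka:
  "is_ptn \<rho> \<Longrightarrow> convolve (hom_prod l) (kostka \<rho>) m = (\<Sum>\<theta>\<in>Ptns (weight \<rho> + sum_list l). skew_kostka l \<rho> \<theta> * kostka \<theta> m)"
proof (induction l arbitrary: \<rho>)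
  case Nil
  have "(\<Sum>\<theta>\<in>Ptns (weight \<rho>). skew_kostka [] \<rho> \<theta> * kostka \<theta> m) = (\<Sum>\<theta>\<in>Ptns (weight \<rho>). if \<theta> = \<rho> then kostka \<rho> m else 0)"
    by (rule sum.cong) auto
  then show ?case using Nil finite_Ptns by (simp add: convolve_hom_sym_0 Ptns_def)
next
  case (Cons k l)
  have "convolve (hom_prod (k # l)) (kostka \<rho>) m = convolve (hom_prod l) (convolve (hom_sym k) (kostka \<rho>)) m"
    by (simp add: convolve_assoc)
  also have "\<dots> = convolve (hom_prod l) (\<lambda>y. \<Sum>u\<in>Ptns (weight \<rho> + k). of_bool (horiz_strip \<rho> u) * kostka u y) m"
    by (simp only: pieri[OF Cons.prems])
  also have "\<dots> = (\<Sum>u\<in>Ptns (weight \<rho> + k). of_bool (horiz_strip \<rho> u) * convolve (hom_prod l) (kostka u) m)"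
    by (rule convolve_sum_right)
  also have "\<dots> = (\<Sum>u\<in>Ptns (weight \<rho> + k). \<Sum>\<theta>\<in>Ptns (weight \<rho> + k + sum_list l). of_bool (horiz_strip \<rho> u) * (skew_kostka l u \<theta> * kostka \<theta> m))"
    unfolding sum_distrib_left[symmetric]
    by (rule sum.cong) (auto simp: Cons.IH Ptns_def)
  also have "\<dots> = (\<Sum>\<theta>\<in>Ptns (weight \<rho> + sum_list (k # l)). skew_kostka (k # l) \<rho> \<theta> * kostka \<theta> m)"
    by (subst sum.swap) (simp add: sum_distrib_right mult.assoc add.assoc)
  finally show ?case .
qed

lemma kostka_zero: "kostka (\<lambda>_. 0) m = hom_sym 0 m"
proof (cases "sum_list m = 0")
  case True
  then have "filter (\<lambda>x. x \<noteq> 0) m = []" by (auto simp: filter_empty_conv)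
  then show ?thesis using symmetric_coeffs_filter[OF symmetric_coeffs_skew_kostka[OF is_ptn_zero], of m "\<lambda>_. 0"] True by (simp add: hom_sym_def)
next
  case False then show ?thesis by (simp add: hom_sym_def kostka_sum_neq)
qed

text \<open>The case of the empty \<rho> in \<open>convolve_hom_prod_kostka\<close>. These numbers
  are the coefficients of the Cauchy kernel in two alphabets with exponents \<open>l\<close> and
  \<open>m\<close>.\<close>

lemma hom_prod_cauchy: "hom_prod l m = (\<Sum>\<sigma>\<in>Ptns (sum_list l). kostka \<sigma> l * kostka \<sigma> m)"
proof -
  have "hom_prod l m = convolve (hom_prod l) (kostka (\<lambda>_. 0)) m"
    unfolding kostka_zero convolve_commute[of "hom_prod l"] by (rule convolve_hom_sym_0[symmetric])
  then show ?thesis using convolve_hom_prod_kostka[OF is_ptn_zero, of l m] by simp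
qed

lemma kostka_product:
  assumes \<rho>: "is_ptn \<rho>" and \<sigma>: "is_ptn \<sigma>"
  shows "convolve (kostka \<rho>) (kostka \<sigma>) m = (\<Sum>\<theta>\<in>Ptns (weight \<rho> + weight \<sigma>). lr_coeff \<theta> \<rho> \<sigma> * kostka \<theta> m)"
proof -
  define n where "n = weight \<sigma>"
  have "convolve (kostka \<sigma>) (kostka \<rho>) m = (\<Sum>\<theta>\<in>Ptns (weight \<rho> + n). lr_coeff \<theta> \<rho> \<sigma> * kostka \<theta> m)"
  \<comment> \<open>The exponents \<open>m\<close> stay fixed. Both sides are regarded as functions
    of \<sigma> and paired with the Kostka numbers \<open>kostka \<sigma> l\<close> for all
    \<open>l\<close> of degree \<open>n\<close>. Both pairings give the coefficient at
    \<open>m\<close> of \<open>hom_prod l\<close> times \<open>kostka \<rho>\<close>, and uniqueness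
    recovers the values at each \<sigma>.\<close>
  proof (rule kostka_expansion_unique[where X = "\<lambda>\<sigma>. convolve (kostka \<sigma>) (kostka \<rho>) m" and Y = "\<lambda>\<sigma>. \<Sum>\<theta>\<in>Ptns (weight \<rho> + n). lr_coeff \<theta> \<rho> \<sigma> * kostka \<theta> m"])
    show "\<sigma> \<in> Ptns n" using \<sigma> by (simp add: Ptns_def n_def)
    fix l :: "nat list" assume l: "sum_list l = n"
    have "(\<Sum>\<tau>\<in>Ptns n. convolve (kostka \<tau>) (kostka \<rho>) m * kostka \<tau> l) = convolve (hom_prod l) (kostka \<rho>) m"
      unfolding hom_prod_cauchy convolve_sum_left l by (simp add: mult.commute)
    also have "\<dots> = (\<Sum>\<theta>\<in>Ptns (weight \<rho> + n). \<Sum>\<tau>\<in>Ptns n. lr_coeff \<theta> \<rho> \<tau> * kostka \<tau> l * kostka \<theta> m)"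
      unfolding convolve_hom_prod_kostka[OF \<rho>] lr_coeff_expansion[OF \<rho>] l by (simp add: sum_distrib_right)
    also have "\<dots> = (\<Sum>\<tau>\<in>Ptns n. (\<Sum>\<theta>\<in>Ptns (weight \<rho> + n). lr_coeff \<theta> \<rho> \<tau> * kostka \<theta> m) * kostka \<tau> l)"
      unfolding sum_distrib_right by (subst sum.swap) (simp add: mult_ac)
    finally show "(\<Sum>\<tau>\<in>Ptns n. convolve (kostka \<tau>) (kostka \<rho>) m * kostka \<tau> l) = (\<Sum>\<tau>\<in>Ptns n. (\<Sum>\<theta>\<in>Ptns (weight \<rho> + n). lr_coeff \<theta> \<rho> \<tau> * kostka \<theta> m) * kostka \<tau> l)" .
  qed
  then show ?thesis by (subst convolve_commute) (simp add: n_def)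
qed

text \<open>Invisible in the definition through skew shapes, but immediate from commutativity of the
  product. It gives containment of the second lower index, where \<open>lr_coeff_nz\<close> gives
  that of the first.\<close>

lemma lr_coeff_commute:
  assumes "is_ptn \<rho>" "is_ptn \<sigma>" shows "lr_coeff \<theta> \<rho> \<sigma> = lr_coeff \<theta> \<sigma> \<rho>"
proof (cases "\<theta> \<in> Ptns (weight \<rho> + weight \<sigma>)")
  case True
  show ?thesis
    by (rule kostka_expansion_unique[OF _ True])
      (use kostka_product[OF assms] kostka_product[OF assms(2,1)] convolve_commute[of "kostka \<rho>" "kostka \<sigma>"] in \<open>simp add: add.commute\<close>)
next
  case False
  then have "lr_coeff \<theta> \<rho> \<sigma> = 0" "lr_coeff \<theta> \<sigma> \<rho> = 0"
    using lr_coeff_nz(1)[OF assms, of \<theta>] lr_coeff_nz(1)[OF assms(2,1), of \<theta>] by (metis add.commute)+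
  then show ?thesis by simp
qed

section \<open>Products of several Schur functions\<close>

fun prod_coeff :: "shape list \<Rightarrow> nat list \<Rightarrow> int" where
  "prod_coeff [] = hom_sym 0"
| "prod_coeff (l # L) = convolve (kostka l) (prod_coeff L)"

definition total_weight :: "shape list \<Rightarrow> nat" where
  "total_weight L = sum_list (map weight L)"

definition schur_mult :: "shape \<Rightarrow> shape list \<Rightarrow> int" where
  "schur_mult \<theta> L = schur_coeff_of (prod_coeff L) \<theta>"

lemma schur_mult_unique:
  assumes "\<And>m. prod_coeff L m = (\<Sum>\<theta>\<in>Ptns n. X \<theta> * kostka \<theta> m)" "is_ptn \<theta>"
  shows "schur_mult \<theta> L = (if weight \<theta> = n then X \<theta> else 0)"
proof (cases "weight \<theta> = n")
  case True
  then show ?thesis unfolding schur_mult_def using schur_coeff_of_unique[of n "prod_coeff L" X \<theta>] assms by (simp add: Ptns_def)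
next
  case False
  have "prod_coeff L m = (\<Sum>g\<in>Ptns (weight \<theta>). 0 * kostka g m)" if "sum_list m = weight \<theta>" for m
    unfolding assms(1) using that False by (auto intro!: sum.neutral simp: Ptns_def kostka_sum_neq)
  then show ?thesis unfolding schur_mult_def using schur_coeff_of_unique[of "weight \<theta>" "prod_coeff L" "\<lambda>_. 0" \<theta>] assms(2) False by (simp add: Ptns_def)
qed

lemma prod_coeff_expansion:
  assumes "\<forall>l\<in>set L. is_ptn l"
  shows "prod_coeff L m = (\<Sum>\<theta>\<in>Ptns (total_weight L). schur_mult \<theta> L * kostka \<theta> m)"
proof -
  have "\<exists>X. \<forall>m. prod_coeff L m = (\<Sum>\<theta>\<in>Ptns (total_weight L). X \<theta> * kostka \<theta> m)"
    using assms
  proof (induction L)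
    case Nil
    have "prod_coeff [] m = (\<Sum>\<theta>\<in>Ptns (total_weight []). 1 * kostka \<theta> m)" for m by (simp add: total_weight_def Ptns_zero kostka_zero)
    then show ?case by (intro exI[of _ "\<lambda>_. 1"] allI)
  next
    case (Cons l L)
    then obtain X where X: "\<And>m. prod_coeff L m = (\<Sum>\<theta>\<in>Ptns (total_weight L). X \<theta> * kostka \<theta> m)" by auto
    have "prod_coeff (l # L) m = (\<Sum>\<theta>\<in>Ptns (total_weight (l # L)). (\<Sum>\<sigma>\<in>Ptns (total_weight L). X \<sigma> * lr_coeff \<theta> l \<sigma>) * kostka \<theta> m)" for m
    proof -
      have "prod_coeff (l # L) m = (\<Sum>\<sigma>\<in>Ptns (total_weight L). X \<sigma> * convolve (kostka l) (kostka \<sigma>) m)"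
        using X by (simp add: convolve_sum_right)
      also have "\<dots> = (\<Sum>\<sigma>\<in>Ptns (total_weight L). X \<sigma> * (\<Sum>\<theta>\<in>Ptns (total_weight (l # L)). lr_coeff \<theta> l \<sigma> * kostka \<theta> m))"
        by (rule sum.cong) (use Cons.prems in \<open>auto simp: kostka_product Ptns_def total_weight_def\<close>)
      also have "\<dots> = (\<Sum>\<theta>\<in>Ptns (total_weight (l # L)). (\<Sum>\<sigma>\<in>Ptns (total_weight L). X \<sigma> * lr_coeff \<theta> l \<sigma>) * kostka \<theta> m)"
        unfolding sum_distrib_left sum_distrib_right by (subst sum.swap) (simp add: mult_ac)
      finally show ?thesis .
    qed
    then show ?case by (intro exI[of _ "\<lambda>\<theta>. \<Sum>\<sigma>\<in>Ptns (total_weight L). X \<sigma> * lr_coeff \<theta> l \<sigma>"] allI)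
  qed
  then obtain X where X: "\<And>m. prod_coeff L m = (\<Sum>\<theta>\<in>Ptns (total_weight L). X \<theta> * kostka \<theta> m)" by blast
  show ?thesis unfolding X
    by (rule sum.cong) (auto simp: schur_mult_unique[OF X] Ptns_def)
qed

lemma schur_mult_size: "\<forall>l\<in>set L. is_ptn l \<Longrightarrow> is_ptn \<theta> \<Longrightarrow> weight \<theta> \<noteq> total_weight L \<Longrightarrow> schur_mult \<theta> L = 0"
  using schur_mult_unique[OF prod_coeff_expansion, of L \<theta>] by simp

lemma schur_mult_eqI:
  assumes "\<And>m. prod_coeff L m = (\<Sum>\<theta>\<in>Ptns (total_weight L). X \<theta> * kostka \<theta> m)" "\<theta> \<in> Ptns (total_weight L)"
  shows "schur_mult \<theta> L = X \<theta>"
  using schur_mult_unique[OF assms(1), of \<theta>] assms(2) by (simp add: Ptns_def)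

lemma prod_coeff_append: "prod_coeff (L @ L') m = convolve (prod_coeff L) (prod_coeff L') m"
proof (induction L arbitrary: m)
  case Nil then show ?case by (simp add: convolve_hom_sym_0)
next
  case (Cons l L)
  then have "prod_coeff (L @ L') = convolve (prod_coeff L) (prod_coeff L')" by blast
  then show ?case by (simp add: convolve_assoc)
qed

lemma total_weight_append: "total_weight (L @ L') = total_weight L + total_weight L'"
  by (simp add: total_weight_def)

lemma schur_mult_append:
  assumes "\<forall>l\<in>set (L @ L'). is_ptn l" "\<theta> \<in> Ptns (total_weight L + total_weight L')"
  shows "schur_mult \<theta> (L @ L') = (\<Sum>\<rho>\<in>Ptns (total_weight L). \<Sum>\<sigma>\<in>Ptns (total_weight L'). schur_mult \<rho> L * schur_mult \<sigma> L' * lr_coeff \<theta> \<rho> \<sigma>)"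
proof (rule schur_mult_eqI)
  show "\<theta> \<in> Ptns (total_weight (L @ L'))" using assms(2) by (simp add: total_weight_append)
  fix m
  have "prod_coeff (L @ L') m = convolve (\<lambda>y. \<Sum>\<theta>\<in>Ptns (total_weight L). schur_mult \<theta> L * kostka \<theta> y) (\<lambda>y. \<Sum>\<theta>\<in>Ptns (total_weight L'). schur_mult \<theta> L' * kostka \<theta> y) m"
    using prod_coeff_append[of L L' m] prod_coeff_expansion[of L] prod_coeff_expansion[of L'] assms(1) by simp
  also have "\<dots> = (\<Sum>\<rho>\<in>Ptns (total_weight L). schur_mult \<rho> L * (\<Sum>\<sigma>\<in>Ptns (total_weight L'). schur_mult \<sigma> L' * convolve (kostka \<rho>) (kostka \<sigma>) m))"
    unfolding convolve_sum_left convolve_sum_right ..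
  also have "\<dots> = (\<Sum>\<rho>\<in>Ptns (total_weight L). schur_mult \<rho> L * (\<Sum>\<sigma>\<in>Ptns (total_weight L'). schur_mult \<sigma> L' * (\<Sum>\<theta>\<in>Ptns (total_weight L + total_weight L'). lr_coeff \<theta> \<rho> \<sigma> * kostka \<theta> m)))"
    by (intro sum.cong refl arg_cong2[of _ _ _ _ "(*)"]) (auto simp: kostka_product Ptns_def)
  also have "\<dots> = (\<Sum>\<rho>\<in>Ptns (total_weight L). \<Sum>\<theta>\<in>Ptns (total_weight L + total_weight L'). \<Sum>\<sigma>\<in>Ptns (total_weight L'). schur_mult \<rho> L * schur_mult \<sigma> L' * lr_coeff \<theta> \<rho> \<sigma> * kostka \<theta> m)"
    unfolding sum_distrib_left by (rule sum.cong[OF refl], subst sum.swap) (simp add: mult_ac)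
  also have "\<dots> = (\<Sum>\<theta>\<in>Ptns (total_weight (L @ L')). (\<Sum>\<rho>\<in>Ptns (total_weight L). \<Sum>\<sigma>\<in>Ptns (total_weight L'). schur_mult \<rho> L * schur_mult \<sigma> L' * lr_coeff \<theta> \<rho> \<sigma>) * kostka \<theta> m)"
    unfolding sum_distrib_right total_weight_append by (rule sum.swap)
  finally show "prod_coeff (L @ L') m = (\<Sum>\<theta>\<in>Ptns (total_weight (L @ L')). (\<Sum>\<rho>\<in>Ptns (total_weight L). \<Sum>\<sigma>\<in>Ptns (total_weight L'). schur_mult \<rho> L * schur_mult \<sigma> L' * lr_coeff \<theta> \<rho> \<sigma>) * kostka \<theta> m)" .
qed

lemma schur_mult_single:
  assumes "is_ptn l" "is_ptn \<theta>" shows "schur_mult \<theta> [l] = of_bool (\<theta> = l)"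
proof -
  have "prod_coeff [l] m = (\<Sum>\<theta>\<in>Ptns (weight l). of_bool (\<theta> = l) * kostka \<theta> m)" for m
  proof -
    have "(\<Sum>\<theta>\<in>Ptns (weight l). of_bool (\<theta> = l) * kostka \<theta> m) = (\<Sum>\<theta>\<in>Ptns (weight l). if \<theta> = l then kostka l m else 0)"
      by (rule sum.cong) auto
    also have "\<dots> = kostka l m" using finite_Ptns assms by (simp add: Ptns_def)
    also have "\<dots> = prod_coeff [l] m" using convolve_hom_sym_0[of "kostka l" m] by (simp add: convolve_commute[of "kostka l"])
    finally show ?thesis by simp
  qed
  from schur_mult_unique[OF this assms(2)] show ?thesis by auto
qed

lemma schur_mult_Cons:
  assumes "is_ptn l" "\<forall>l\<in>set L. is_ptn l" "\<theta> \<in> Ptns (weight l + total_weight L)"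
  shows "schur_mult \<theta> (l # L) = (\<Sum>\<sigma>\<in>Ptns (total_weight L). lr_coeff \<theta> l \<sigma> * schur_mult \<sigma> L)"
proof -
  have "schur_mult \<theta> ([l] @ L) = (\<Sum>\<rho>\<in>Ptns (total_weight [l]). \<Sum>\<sigma>\<in>Ptns (total_weight L). schur_mult \<rho> [l] * schur_mult \<sigma> L * lr_coeff \<theta> \<rho> \<sigma>)"
    by (rule schur_mult_append) (use assms in \<open>auto simp: total_weight_def\<close>)
  also have "\<dots> = (\<Sum>\<rho>\<in>Ptns (weight l). if \<rho> = l then (\<Sum>\<sigma>\<in>Ptns (total_weight L). lr_coeff \<theta> l \<sigma> * schur_mult \<sigma> L) else 0)"
    by (rule sum.cong) (auto simp: total_weight_def schur_mult_single assms(1) Ptns_def mult.commute)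
  also have "\<dots> = (\<Sum>\<sigma>\<in>Ptns (total_weight L). lr_coeff \<theta> l \<sigma> * schur_mult \<sigma> L)"
    using finite_Ptns assms(1) by (simp add: Ptns_def)
  finally show ?thesis by simp
qed

lemma prod_coeff_mset: assumes "mset L = mset L'" shows "prod_coeff L = prod_coeff L'"
proof (rule swap_invariant_imp_mset_invariant[OF _ assms])
  fix u v :: "shape list" and j k
  have "prod_coeff (j # k # v) = prod_coeff (k # j # v)"
  proof
    fix m
    have "prod_coeff (j # k # v) m = convolve (convolve (kostka j) (kostka k)) (prod_coeff v) m" by (simp add: convolve_assoc)
    also have "convolve (kostka j) (kostka k) = convolve (kostka k) (kostka j)" by (rule ext, rule convolve_commute)
    also have "convolve (convolve (kostka k) (kostka j)) (prod_coeff v) m = prod_coeff (k # j # v) m" by (simp add: convolve_assoc)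
    finally show "prod_coeff (j # k # v) m = prod_coeff (k # j # v) m" .
  qed
  then show "prod_coeff (u @ j # k # v) = prod_coeff (u @ k # j # v)"
    by (intro ext) (simp only: prod_coeff_append)
qed

section \<open>Complements in a rectangle\<close>

definition box :: "nat \<Rightarrow> nat \<Rightarrow> shape" where
  "box a b = (\<lambda>i. if i < a then b else 0)"

definition box_compl :: "nat \<Rightarrow> nat \<Rightarrow> shape \<Rightarrow> shape" where
  "box_compl a b f = (\<lambda>i. if i < a then b - f (a - 1 - i) else 0)"

definition inbox :: "nat \<Rightarrow> nat \<Rightarrow> shape \<Rightarrow> bool" where
  "inbox a b f \<longleftrightarrow> (\<forall>i. f i \<le> box a b i)"

lemma inbox_rows: "inbox a b f \<Longrightarrow> rows a f"
  unfolding rows_def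
proof (intro allI impI)
  fix i assume "inbox a b f" "a \<le> i"
  then have "f i \<le> box a b i" by (simp add: inbox_def)
  then show "f i = 0" using \<open>a \<le> i\<close> by (simp add: box_def)
qed

lemma inbox_le: "inbox a b f \<Longrightarrow> f i \<le> b"
  unfolding inbox_def by (rule order_trans[of _ "box a b i"]) (auto simp: box_def)

lemma inbox_box_compl: "inbox a b (box_compl a b f)"
  by (auto simp: inbox_def box_def box_compl_def)

lemma box_compl_box_compl: "inbox a b f \<Longrightarrow> box_compl a b (box_compl a b f) = f"
proof
  fix i assume f: "inbox a b f"
  show "box_compl a b (box_compl a b f) i = f i"
    using inbox_le[OF f, of i] inbox_rows[OF f] by (auto simp: box_compl_def rows_def)
qed

lemma is_ptn_box_compl: assumes "is_ptn f" shows "is_ptn (box_compl a b f)"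
  unfolding is_ptn_def
proof
  show "\<forall>i. box_compl a b f (Suc i) \<le> box_compl a b f i"
  proof
    fix i
    have "f (a - 1 - i) \<le> f (a - 1 - Suc i)" by (rule is_ptn_mono[OF assms]) simp
    then show "box_compl a b f (Suc i) \<le> box_compl a b f i" by (simp add: box_compl_def diff_le_mono2)
  qed
  show "\<exists>n. box_compl a b f n = 0" by (rule exI[of _ a]) (simp add: box_compl_def)
qed

lemma weight_box_compl: assumes "inbox a b f" shows "weight (box_compl a b f) + weight f = a * b"
proof -
  have "rows a (box_compl a b f)" by (simp add: rows_def box_compl_def)
  then have "weight (box_compl a b f) = (\<Sum>i<a. b - f (a - Suc i))" by (simp add: weight_rows box_compl_def)
  also have "\<dots> = (\<Sum>i<a. b - f i)" by (rule sum.nat_diff_reindex)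
  finally have "weight (box_compl a b f) + weight f = (\<Sum>i<a. b - f i + f i)"
    by (simp add: weight_rows[OF inbox_rows[OF assms]] sum.distrib)
  also have "\<dots> = (\<Sum>i<a. b)" by (rule sum.cong) (use inbox_le[OF assms] in auto)
  finally show ?thesis by simp
qed

lemma box_compl_horiz_strip:
  assumes "horiz_strip g h" "inbox a b h"
  shows "horiz_strip (box_compl a b h) (box_compl a b g)"
  unfolding horiz_strip_def
proof
  fix i
  have 1: "g j \<le> h j" "h (Suc j) \<le> g j" for j using assms(1) by (auto simp: horiz_strip_def)
  show "box_compl a b h i \<le> box_compl a b g i \<and> box_compl a b g (Suc i) \<le> box_compl a b h i"
  proof (cases "Suc i < a")
    case True
    then have "a - 1 - i = Suc (a - 1 - Suc i)" by simp
    then show ?thesis using True 1(1)[of "a - 1 - i"] 1(2)[of "a - 1 - Suc i"]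
      by (simp add: box_compl_def diff_le_mono2)
  next
    case False then show ?thesis using 1(1) by (auto simp: box_compl_def diff_le_mono2)
  qed
qed

lemma box_box_compl_zero: "box_compl a b (box a b) = (\<lambda>_. 0)"
  by (auto simp: box_compl_def box_def)

lemma inbox_mono: "(\<And>i. f i \<le> g i) \<Longrightarrow> inbox a b g \<Longrightarrow> inbox a b f"
  unfolding inbox_def using le_trans by blast

text \<open>A half turn of the rectangle reverses inclusions and preserves horizontal strips, so a
  chain from \<open>g\<close> up to the full rectangle becomes a chain from the empty shape up to
  the complement of \<open>g\<close>, with the strips in reverse order.\<close>

lemma skew_kostka_box:
  "is_ptn g \<Longrightarrow> skew_kostka m g (box a b) = (if inbox a b g then kostka (box_compl a b g) (rev m) else 0)"
proof (induction m arbitrary: g)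
  case Nil
  show ?case
  proof (cases "inbox a b g")
    case True
    have "g = box a b \<longleftrightarrow> box_compl a b g = (\<lambda>_. 0)"
      using box_compl_box_compl[OF True] box_box_compl_zero[of a b] box_compl_box_compl[of a b "box a b"] by (auto simp: inbox_def)
    then show ?thesis using True by auto
  next
    case False
    then have "g \<noteq> box a b" by (auto simp: inbox_def)
    then show ?thesis using False by simp
  qed
next
  case (Cons k m)
  show ?case
  proof (cases "inbox a b g")
    case False
    have "skew_kostka (k # m) g (box a b) = 0"
      using skew_kostka_nz[OF _ Cons.prems, of "k # m" "box a b"] False unfolding inbox_def by blast
    then show ?thesis using False by simp
  next
    case True
    have "skew_kostka (k # m) g (box a b) = (\<Sum>h\<in>{h\<in>Ptns (weight g + k). horiz_strip g h \<and> inbox a b h}. kostka (box_compl a b h) (rev m))"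
      unfolding skew_kostka.simps by (rule sum.mono_neutral_cong_right[OF finite_Ptns]) (auto simp: Cons.IH Ptns_def)
    also have "\<dots> = (\<Sum>h\<in>{h\<in>Ptns (sum_list m). horiz_strip h (box_compl a b g) \<and> weight (box_compl a b g) = sum_list m + k}. kostka h (rev m))"
    proof (cases "weight (box_compl a b g) = sum_list m + k")
      case w: True
      have wg: "weight (box_compl a b g) + weight g = a * b" by (rule weight_box_compl[OF True])
      show ?thesis
      proof (rule sum.reindex_bij_witness[of _ "box_compl a b" "box_compl a b"])
        fix h assume h: "h \<in> {h\<in>Ptns (weight g + k). horiz_strip g h \<and> inbox a b h}"
        then show "box_compl a b (box_compl a b h) = h" by (simp add: box_compl_box_compl)
        have "weight (box_compl a b h) + weight h = a * b" using h weight_box_compl by blast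
        then show "box_compl a b h \<in> {h\<in>Ptns (sum_list m). horiz_strip h (box_compl a b g) \<and> weight (box_compl a b g) = sum_list m + k}"
          using h w wg by (auto simp: Ptns_def is_ptn_box_compl box_compl_horiz_strip)
      next
        fix h assume h: "h \<in> {h\<in>Ptns (sum_list m). horiz_strip h (box_compl a b g) \<and> weight (box_compl a b g) = sum_list m + k}"
        have hb: "inbox a b h" by (rule inbox_mono[OF _ inbox_box_compl[of a b g]]) (use h in \<open>auto simp: horiz_strip_def\<close>)
        then show "box_compl a b (box_compl a b h) = h" by (simp add: box_compl_box_compl)
        have "horiz_strip g (box_compl a b h)"
          using box_compl_horiz_strip[of h "box_compl a b g" a b] h inbox_box_compl box_compl_box_compl[OF True] by simp
        moreover have "weight (box_compl a b h) + weight h = a * b" using hb weight_box_compl by blast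
        ultimately show "box_compl a b h \<in> {h\<in>Ptns (weight g + k). horiz_strip g h \<and> inbox a b h}"
          using h w wg by (auto simp: Ptns_def is_ptn_box_compl inbox_box_compl)
      qed auto
    next
      case w: False
      have "kostka (box_compl a b h) (rev m) = 0" if "h \<in> Ptns (weight g + k)" "inbox a b h" for h
        using that w weight_box_compl[OF True] weight_box_compl[OF that(2)] by (intro kostka_sum_neq) (auto simp: Ptns_def)
      then show ?thesis using w by (auto intro: sum.neutral)
    qed
    also have "\<dots> = kostka (box_compl a b g) (rev (k # m))"
      unfolding rev.simps kostka_snoc by (rule sum.mono_neutral_cong_left) (auto simp: finite_Ptns)
    finally show ?thesis using True by simp
  qed
qed

lemma kostka_mset: "mset m = mset m' \<Longrightarrow> kostka f m = kostka f m'"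
  using symmetric_coeffs_mset[OF symmetric_coeffs_skew_kostka[OF is_ptn_zero]] .

text \<open>What \<rho> leaves of the rectangle has the skew Schur polynomial of the complement; the
  reversed exponents in \<open>skew_kostka_box\<close> are harmless by symmetry. This is the duality
  of Schubert classes.\<close>

lemma lr_coeff_box:
  assumes "is_ptn \<rho>" "is_ptn \<sigma>"
  shows "lr_coeff (box a b) \<rho> \<sigma> = of_bool (inbox a b \<rho> \<and> \<sigma> = box_compl a b \<rho>)"
  unfolding lr_coeff_def
proof (rule schur_coeff_of_unique[where n = "weight \<sigma>"])
  fix m :: "nat list" assume m: "sum_list m = weight \<sigma>"
  have "(\<Sum>g\<in>Ptns (weight \<sigma>). of_bool (inbox a b \<rho> \<and> g = box_compl a b \<rho>) * kostka g m)
      = (\<Sum>g\<in>Ptns (weight \<sigma>). if g = box_compl a b \<rho> then of_bool (inbox a b \<rho>) * kostka (box_compl a b \<rho>) m else 0)"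
    by (rule sum.cong) auto
  also have "\<dots> = of_bool (inbox a b \<rho>) * kostka (box_compl a b \<rho>) m"
    using finite_Ptns m is_ptn_box_compl[OF assms(1)] by (auto simp: Ptns_def kostka_sum_neq)
  also have "\<dots> = skew_kostka m \<rho> (box a b)"
    unfolding skew_kostka_box[OF assms(1)] by (auto intro: kostka_mset)
  finally show "skew_kostka m \<rho> (box a b) = (\<Sum>g\<in>Ptns (weight \<sigma>). of_bool (inbox a b \<rho> \<and> g = box_compl a b \<rho>) * kostka g m)" by simp
qed (use assms in \<open>auto simp: Ptns_def\<close>)

lemma is_ptn_box: "is_ptn (box a b)" and weight_box: "weight (box a b) = a * b"
proof -
  show "is_ptn (box a b)" unfolding is_ptn_def by (auto simp: box_def)
  have "rows a (box a b)" by (simp add: rows_def box_def)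
  then show "weight (box a b) = a * b" by (simp add: weight_rows box_def)
qed

lemma schur_mult_box:
  assumes "\<forall>l\<in>set (L @ L'). is_ptn l" "total_weight L + total_weight L' = a * b"
  shows "schur_mult (box a b) (L @ L') = (\<Sum>\<rho>\<in>{\<rho>\<in>Ptns (total_weight L). inbox a b \<rho>}. schur_mult \<rho> L * schur_mult (box_compl a b \<rho>) L')"
proof -
  have "schur_mult (box a b) (L @ L') = (\<Sum>\<rho>\<in>Ptns (total_weight L). \<Sum>\<sigma>\<in>Ptns (total_weight L'). schur_mult \<rho> L * schur_mult \<sigma> L' * lr_coeff (box a b) \<rho> \<sigma>)"
    by (rule schur_mult_append) (use assms in \<open>auto simp: Ptns_def is_ptn_box weight_box\<close>)
  also have "\<dots> = (\<Sum>\<rho>\<in>Ptns (total_weight L). if inbox a b \<rho> then schur_mult \<rho> L * schur_mult (box_compl a b \<rho>) L' else 0)"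
  proof (rule sum.cong[OF refl])
    fix \<rho> assume \<rho>: "\<rho> \<in> Ptns (total_weight L)"
    have "(\<Sum>\<sigma>\<in>Ptns (total_weight L'). schur_mult \<rho> L * schur_mult \<sigma> L' * lr_coeff (box a b) \<rho> \<sigma>)
        = (\<Sum>\<sigma>\<in>Ptns (total_weight L'). if \<sigma> = box_compl a b \<rho> then (if inbox a b \<rho> then schur_mult \<rho> L * schur_mult (box_compl a b \<rho>) L' else 0) else 0)"
      by (rule sum.cong) (use \<rho> in \<open>auto simp: Ptns_def lr_coeff_box\<close>)
    also have "\<dots> = (if inbox a b \<rho> then schur_mult \<rho> L * schur_mult (box_compl a b \<rho>) L' else 0)"
      using finite_Ptns weight_box_compl[of a b \<rho>] \<rho> assms(2) is_ptn_box_compl[of \<rho> a b] by (auto simp: Ptns_def)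
    finally show "(\<Sum>\<sigma>\<in>Ptns (total_weight L'). schur_mult \<rho> L * schur_mult \<sigma> L' * lr_coeff (box a b) \<rho> \<sigma>) = (if inbox a b \<rho> then schur_mult \<rho> L * schur_mult (box_compl a b \<rho>) L' else 0)" .
  qed
  also have "\<dots> = (\<Sum>\<rho>\<in>{\<rho>\<in>Ptns (total_weight L). inbox a b \<rho>}. schur_mult \<rho> L * schur_mult (box_compl a b \<rho>) L')"
    by (rule sum.inter_filter[symmetric]) (rule finite_Ptns)
  finally show ?thesis .
qed

section \<open>Leading terms\<close>

definition take_rows :: "nat \<Rightarrow> shape \<Rightarrow> shape" where
  "take_rows r f = (\<lambda>i. if i < r then f i else 0)"

definition drop_rows :: "nat \<Rightarrow> shape \<Rightarrow> shape" where
  "drop_rows r f = (\<lambda>i. f (i + r))"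

definition glue :: "nat \<Rightarrow> shape \<Rightarrow> shape \<Rightarrow> shape" where
  "glue r f g = (\<lambda>i. if i < r then f i else g (i - r))"

lemma is_ptn_take_rows: "is_ptn f \<Longrightarrow> is_ptn (take_rows r f)"
  unfolding take_rows_def by (rule is_ptn_take)

lemma rows_take_rows: "rows r (take_rows r f)"
  by (simp add: rows_def take_rows_def)

lemma is_ptn_drop_rows: assumes "is_ptn f" shows "is_ptn (drop_rows r f)"
proof -
  obtain n where "rows n f" using is_ptn_rows[OF assms] .
  then have "drop_rows r f n = 0" by (simp add: rows_def drop_rows_def)
  then show ?thesis using assms unfolding is_ptn_def drop_rows_def by auto
qed

lemma take_rows_glue: "take_rows r (glue r f g) = take_rows r f" and drop_rows_glue: "drop_rows r (glue r f g) = g"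
  by (auto simp: take_rows_def drop_rows_def glue_def)

lemma glue_take_rows_drop_rows: "glue r (take_rows r f) (drop_rows r f) = f"
  by (auto simp: take_rows_def drop_rows_def glue_def)

lemma glue_take_rows: "glue r (take_rows r f) g = glue r f g"
  by (auto simp: take_rows_def glue_def)

lemma weight_take_rows: "weight (take_rows r f) = (\<Sum>i<r. f i)"
  using weight_rows[OF rows_take_rows[of r f]] by (simp add: take_rows_def)

lemma sum_lessThan_add:
  fixes F :: "nat \<Rightarrow> nat"
  shows "(\<Sum>i<r + n. F i) = (\<Sum>i<r. F i) + (\<Sum>i<n. F (r + i))"
  by (induction n) auto

lemma weight_glue: assumes "is_ptn g" shows "weight (glue r f g) = weight (take_rows r f) + weight g"
proof -
  obtain n where n: "rows n g" using is_ptn_rows[OF assms] .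
  have "rows (r + n) (glue r f g)" using n by (auto simp: rows_def glue_def)
  then show ?thesis using weight_rows[OF n] by (simp add: weight_rows sum_lessThan_add weight_take_rows glue_def)
qed

lemma weight_take_rows_drop_rows: "is_ptn f \<Longrightarrow> weight f = weight (take_rows r f) + weight (drop_rows r f)"
  using weight_glue[OF is_ptn_drop_rows[of f r], of r f] glue_take_rows[of r f "drop_rows r f"] by (simp add: glue_take_rows_drop_rows)

lemma is_ptn_glue:
  assumes "is_ptn f" "is_ptn g" "g 0 \<le> f (r - 1) \<or> r = 0" shows "is_ptn (glue r f g)"
proof -
  obtain n where "rows n g" using is_ptn_rows[OF assms(2)] .
  then have "glue r f g (r + n) = 0" by (simp add: rows_def glue_def)
  moreover have "glue r f g (Suc i) \<le> glue r f g i" for i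
  proof -
    consider "Suc i < r" | "Suc i = r" | "r \<le> i" by linarith
    then show ?thesis
    proof cases
      case 3 then show ?thesis using assms(2) by (simp add: glue_def is_ptn_def Suc_diff_le)
    qed (use assms in \<open>auto simp: glue_def is_ptn_def\<close>)
  qed
  ultimately show ?thesis unfolding is_ptn_def by blast
qed

lemma horiz_strip_glue:
  assumes f: "is_ptn f" and g: "horiz_strip g g'" "\<And>i. g' i \<le> drop_rows r f i"
  shows "horiz_strip (glue r f g) (glue r f g')"
  unfolding horiz_strip_def
proof
  fix i
  consider "Suc i < r" | "Suc i = r" | "r \<le> i" by linarith
  then show "glue r f g i \<le> glue r f g' i \<and> glue r f g' (Suc i) \<le> glue r f g i"
  proof cases
    case 1 then show ?thesis using f by (simp add: glue_def is_ptn_def)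
  next
    case 2
    have "g' 0 \<le> f r" using g(2)[of 0] by (simp add: drop_rows_def)
    also have "f r \<le> f i" using 2 by (intro is_ptn_mono[OF f]) simp
    finally show ?thesis using 2 by (simp add: glue_def)
  next
    case 3 then show ?thesis using g(1) by (simp add: glue_def horiz_strip_def Suc_diff_le)
  qed
qed

text \<open>The first \<open>r\<close> rows are already those of \<open>f\<close>, so every strip on
  the way to \<open>f\<close> lies in the rows below, and deleting the first rows loses
  nothing.\<close>

lemma skew_kostka_glue:
  assumes f: "is_ptn f" and "is_ptn g" "\<forall>i. g i \<le> drop_rows r f i"
  shows "skew_kostka v (glue r f g) f = skew_kostka v g (drop_rows r f)"
  using assms(2,3)
proof (induction v arbitrary: g)
  case Nil
  have "glue r f g = f \<longleftrightarrow> g = drop_rows r f"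
  proof
    assume "glue r f g = f" then show "g = drop_rows r f" using drop_rows_glue[of r f g] by simp
  qed (auto simp: glue_def drop_rows_def)
  then show ?case by simp
next
  case (Cons k v)
  have pg: "is_ptn (glue r f g)"
  proof (rule is_ptn_glue[OF f Cons.prems(1)], cases "r = 0")
    case False
    have "g 0 \<le> f r" using Cons.prems(2)[rule_format, of 0] by (simp add: drop_rows_def)
    then show "g 0 \<le> f (r - 1) \<or> r = 0" using is_ptn_mono[OF f, of "r - 1" r] by simp
  qed simp
  define A where "A = {h\<in>Ptns (weight (glue r f g) + k). horiz_strip (glue r f g) h \<and> (\<forall>i. h i \<le> f i)}"
  define B where "B = {h\<in>Ptns (weight g + k). horiz_strip g h \<and> (\<forall>i. h i \<le> drop_rows r f i)}"
  have "skew_kostka (k # v) (glue r f g) f = (\<Sum>h\<in>A. skew_kostka v h f)"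
    unfolding skew_kostka.simps
  proof (rule sum.mono_neutral_cong_right[OF finite_Ptns])
    show "\<forall>h\<in>Ptns (weight (glue r f g) + k) - A. of_bool (horiz_strip (glue r f g) h) * skew_kostka v h f = 0"
    proof
      fix h assume "h \<in> Ptns (weight (glue r f g) + k) - A"
      then show "of_bool (horiz_strip (glue r f g) h) * skew_kostka v h f = 0"
        using skew_kostka_nz[of v h f] by (cases "skew_kostka v h f = 0") (auto simp: A_def Ptns_def)
    qed
  qed (auto simp: A_def)
  also have "\<dots> = (\<Sum>h\<in>B. skew_kostka v h (drop_rows r f))"
  proof (rule sum.reindex_bij_witness[of _ "glue r f" "drop_rows r"])
    fix h assume h: "h \<in> A"
    have eq: "h i = f i" if "i < r" for i
    proof (rule le_antisym)
      show "h i \<le> f i" using h by (simp add: A_def)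
      have "glue r f g i \<le> h i" using h by (simp add: A_def horiz_strip_def)
      then show "f i \<le> h i" using that by (simp add: glue_def)
    qed
    then show gd: "glue r f (drop_rows r h) = h" by (auto simp: glue_def drop_rows_def)
    have ph: "is_ptn (drop_rows r h)" using h is_ptn_drop_rows by (auto simp: A_def Ptns_def)
    have "weight h = weight (take_rows r f) + weight (drop_rows r h)" using weight_glue[OF ph, of r f] gd by simp
    then have "weight (drop_rows r h) = weight g + k" using h weight_glue[OF Cons.prems(1), of r f] by (simp add: A_def Ptns_def)
    moreover have "horiz_strip g (drop_rows r h)" unfolding horiz_strip_def
    proof
      fix i show "g i \<le> drop_rows r h i \<and> drop_rows r h (Suc i) \<le> g i"
      proof -
        have "glue r f g (i + r) \<le> h (i + r) \<and> h (Suc (i + r)) \<le> glue r f g (i + r)"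
          using h unfolding A_def horiz_strip_def by blast
        then show ?thesis by (simp add: glue_def drop_rows_def)
      qed
    qed
    ultimately show "drop_rows r h \<in> B" using ph h by (simp add: B_def Ptns_def A_def drop_rows_def)
    then show "skew_kostka v (drop_rows r h) (drop_rows r f) = skew_kostka v h f"
      using Cons.IH[of "drop_rows r h"] gd by (simp add: B_def Ptns_def)
  next
    fix h assume h: "h \<in> B"
    show "drop_rows r (glue r f h) = h" by (rule drop_rows_glue)
    have i: "horiz_strip (glue r f g) (glue r f h)" using horiz_strip_glue[OF f, of g h r] h by (simp add: B_def)
    have "weight (glue r f h) = weight (glue r f g) + k"
      using h weight_glue[OF Cons.prems(1), of r f] weight_glue[of h r f] by (simp add: B_def Ptns_def)
    moreover have "glue r f h i \<le> f i" for i
    proof (cases "i < r")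
      case False
      have "h (i - r) \<le> drop_rows r f (i - r)" using h unfolding B_def by blast
      then show ?thesis using False by (simp add: glue_def drop_rows_def)
    qed (simp add: glue_def)
    ultimately show "glue r f h \<in> A" using i horiz_strip_is_ptn[OF i] pg by (simp add: A_def Ptns_def)
  qed
  also have "\<dots> = skew_kostka (k # v) g (drop_rows r f)"
    unfolding skew_kostka.simps
  proof (rule sum.mono_neutral_cong_left[OF finite_Ptns])
    show "\<forall>h\<in>Ptns (weight g + k) - B. of_bool (horiz_strip g h) * skew_kostka v h (drop_rows r f) = 0"
    proof
      fix h assume "h \<in> Ptns (weight g + k) - B"
      then show "of_bool (horiz_strip g h) * skew_kostka v h (drop_rows r f) = 0"
        using skew_kostka_nz[of v h "drop_rows r f"] by (cases "skew_kostka v h (drop_rows r f) = 0") (auto simp: B_def Ptns_def)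
    qed
  qed (auto simp: B_def)
  finally show ?case .
qed

text \<open>The part of a Schur polynomial of highest degree in the first variables is the product of
  the Schur polynomials of the first rows and of the remaining rows.\<close>

lemma kostka_top:
  assumes f: "is_ptn f" and u: "length u = r"
  shows "weight (take_rows r f) < sum_list u \<Longrightarrow> kostka f (u @ v) = 0"
    and "sum_list u = weight (take_rows r f) \<Longrightarrow> kostka f (u @ v) = kostka (take_rows r f) u * kostka (drop_rows r f) v"
proof -
  have e: "kostka f (u @ v) = (\<Sum>h\<in>Ptns (sum_list u). kostka h u * skew_kostka v h f)"
    using skew_kostka_append[OF is_ptn_zero, of u v f] by simp
  \<comment> \<open>A contributing \<open>h\<close> has at most \<open>r\<close> rows and lies in
    \<open>f\<close>, hence in the first \<open>r\<close> rows of \<open>f\<close>. So no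
    \<open>h\<close> fits in the first claim, and in the second only \<open>take_rows r f\<close>
    does.\<close>
  have nz: "h i \<le> take_rows r f i" if "h \<in> Ptns (sum_list u)" "kostka h u * skew_kostka v h f \<noteq> 0" for h i
    using kostka_nz(2)[of u h] skew_kostka_nz[of v h f] that u by (auto simp: take_rows_def rows_def Ptns_def)
  show "kostka f (u @ v) = 0" if "weight (take_rows r f) < sum_list u"
    unfolding e
  proof (rule sum.neutral, rule ballI, rule ccontr)
    fix h assume h: "h \<in> Ptns (sum_list u)" "kostka h u * skew_kostka v h f \<noteq> 0"
    show False using weight_mono[OF is_ptn_take_rows[OF f], of h r] nz[OF h] h(1) that by (simp add: Ptns_def)
  qed
  show "kostka f (u @ v) = kostka (take_rows r f) u * kostka (drop_rows r f) v" if s: "sum_list u = weight (take_rows r f)"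
  proof -
    have "(\<Sum>h\<in>Ptns (sum_list u). kostka h u * skew_kostka v h f) = (\<Sum>h\<in>Ptns (sum_list u). if h = take_rows r f then kostka (take_rows r f) u * skew_kostka v (take_rows r f) f else 0)"
    proof (rule sum.cong[OF refl])
      fix h assume h: "h \<in> Ptns (sum_list u)"
      show "kostka h u * skew_kostka v h f = (if h = take_rows r f then kostka (take_rows r f) u * skew_kostka v (take_rows r f) f else 0)"
        using le_weight_eq[OF is_ptn_take_rows[OF f], of h r] nz[OF h] h s by (auto simp: Ptns_def)
    qed
    also have "\<dots> = kostka (take_rows r f) u * skew_kostka v (take_rows r f) f"
      using finite_Ptns s is_ptn_take_rows[OF f] by (simp add: Ptns_def)
    also have "skew_kostka v (take_rows r f) f = kostka (drop_rows r f) v"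
    proof -
      have "take_rows r f = glue r f (\<lambda>_. 0)" by (auto simp: take_rows_def glue_def)
      then show ?thesis using skew_kostka_glue[OF f is_ptn_zero, of r v] by simp
    qed
    finally show ?thesis using e by simp
  qed
qed

text \<open>The left coefficients are transported along the injection \<pi> and extended by 0, after
  which both sides are combinations over the same finite set \<open>S\<close>. The second claim
  comes from the indices where the extension is 0.\<close>

lemma indep_eq:
  assumes "indep A \<Phi> T" "finite S" "S \<subseteq> A" "finite E" "inj_on \<pi> E" "\<pi> ` E \<subseteq> S"
    and eq: "\<And>t. t \<in> T \<Longrightarrow> (\<Sum>e\<in>E. X e * \<Phi> (\<pi> e) t) = (\<Sum>s\<in>S. Y s * \<Phi> s t)"
  shows "e \<in> E \<Longrightarrow> X e = Y (\<pi> e)" and "s \<in> S \<Longrightarrow> s \<notin> \<pi> ` E \<Longrightarrow> Y s = 0"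
proof -
  define Z where "Z s = (if s \<in> \<pi> ` E then X (inv_into E \<pi> s) else 0) - Y s" for s
  have Z: "Z s = 0" if "s \<in> S" for s
  proof (rule indepD[OF assms(1-3) _ that])
    fix t assume t: "t \<in> T"
    have "(\<Sum>s\<in>S. Z s * \<Phi> s t) = (\<Sum>s\<in>S. if s \<in> \<pi> ` E then X (inv_into E \<pi> s) * \<Phi> s t else 0) - (\<Sum>s\<in>S. Y s * \<Phi> s t)"
      unfolding sum_subtractf[symmetric] by (rule sum.cong) (auto simp: Z_def left_diff_distrib)
    also have "(\<Sum>s\<in>S. if s \<in> \<pi> ` E then X (inv_into E \<pi> s) * \<Phi> s t else 0) = (\<Sum>s\<in>\<pi> ` E. X (inv_into E \<pi> s) * \<Phi> s t)"
      by (rule sum.mono_neutral_cong_right) (use assms in auto)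
    also have "\<dots> = (\<Sum>e\<in>E. X e * \<Phi> (\<pi> e) t)"
      unfolding sum.reindex[OF assms(5)] using assms(5) by (auto intro!: sum.cong)
    finally show "(\<Sum>s\<in>S. Z s * \<Phi> s t) = 0" using eq[OF t] by simp
  qed
  show "X e = Y (\<pi> e)" if "e \<in> E" using Z[of "\<pi> e"] assms(5,6) that by (auto simp: Z_def)
  show "Y s = 0" if "s \<in> S" "s \<notin> \<pi> ` E" using Z[OF that(1)] that(2) by (simp add: Z_def)
qed

text \<open>If the functions \<open>\<Phi> i\<close> have independent leading parts \<open>\<Phi>0 (\<pi> i)\<close> of degree \<open>w i\<close>, then the
  leading part of a combination of them determines its leading coefficients.\<close>

lemma lead_zero:
  fixes deg :: "'t \<Rightarrow> nat" and w :: "'i \<Rightarrow> nat"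
  assumes ind: "indep A \<Phi>0 T" and fin: "finite I" and inj: "inj_on \<pi> I" and sub: "\<pi> ` I \<subseteq> A"
    and hi: "\<And>i t. i \<in> I \<Longrightarrow> t \<in> T \<Longrightarrow> w i < deg t \<Longrightarrow> \<Phi> i t = 0"
    and eq: "\<And>i t. i \<in> I \<Longrightarrow> t \<in> T \<Longrightarrow> deg t = w i \<Longrightarrow> \<Phi> i t = \<Phi>0 (\<pi> i) t"
    and ne: "\<And>i t. i \<in> I \<Longrightarrow> t \<in> T \<Longrightarrow> deg t \<noteq> w i \<Longrightarrow> \<Phi>0 (\<pi> i) t = 0"
    and van: "\<And>t. t \<in> T \<Longrightarrow> D < deg t \<Longrightarrow> (\<Sum>i\<in>I. X i * \<Phi> i t) = 0"
    and i: "i \<in> I" "D < w i"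
  shows "X i = 0"
proof (rule ccontr)
  assume "X i \<noteq> 0"
  \<comment> \<open>\<open>M\<close> is the top degree among the indices with nonzero coefficient.
    In degree \<open>M\<close> only leading parts survive, and they sum to 0 because
    \<open>M\<close> exceeds \<open>D\<close>.\<close>
  define M where "M = Max (w ` {i\<in>I. X i \<noteq> 0})"
  have fin': "finite (w ` {i\<in>I. X i \<noteq> 0})" using fin by simp
  have "M \<in> w ` {i\<in>I. X i \<noteq> 0}" unfolding M_def using fin' i(1) \<open>X i \<noteq> 0\<close> by (intro Max_in) auto
  then obtain j where j: "j \<in> I" "X j \<noteq> 0" "w j = M" by auto
  have M: "w k \<le> M" if "k \<in> I" "X k \<noteq> 0" for k unfolding M_def using fin' that by (intro Max_ge) auto
  have "D < M" using M[OF i(1) \<open>X i \<noteq> 0\<close>] i(2) by simp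
  have "X j = 0"
  proof (rule indep_eq(1)[OF ind, where E = "{k\<in>I. w k = M}" and \<pi> = \<pi> and S = "\<pi> ` {k\<in>I. w k = M}" and Y = "\<lambda>_. 0"])
    fix t assume t: "t \<in> T"
    show "(\<Sum>k\<in>{k\<in>I. w k = M}. X k * \<Phi>0 (\<pi> k) t) = (\<Sum>s\<in>\<pi> ` {k\<in>I. w k = M}. 0 * \<Phi>0 s t)"
    proof (cases "deg t = M")
      case True
      have "(\<Sum>k\<in>{k\<in>I. w k = M}. X k * \<Phi>0 (\<pi> k) t) = (\<Sum>k\<in>I. X k * \<Phi> k t)"
      proof (rule sum.mono_neutral_cong_left[OF fin])
        show "\<forall>k\<in>I - {k\<in>I. w k = M}. X k * \<Phi> k t = 0"
          using M hi[OF _ t] True by (auto simp: le_less)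
      qed (use eq[OF _ t] True in auto)
      then show ?thesis using van[OF t] True \<open>D < M\<close> by simp
    next
      case False
      then show ?thesis using ne[OF _ t] by (auto intro!: sum.neutral)
    qed
  qed (use j fin sub inj in \<open>auto intro: inj_on_subset\<close>)
  then show False using j by simp
qed

lemma lead_eq:
  fixes deg :: "'t \<Rightarrow> nat" and w :: "'i \<Rightarrow> nat"
  assumes ind: "indep A \<Phi>0 T" and fin: "finite I" and inj: "inj_on \<pi> I" and sub: "\<pi> ` I \<subseteq> A"
    and hi: "\<And>i t. i \<in> I \<Longrightarrow> t \<in> T \<Longrightarrow> w i < deg t \<Longrightarrow> \<Phi> i t = 0"
    and eq: "\<And>i t. i \<in> I \<Longrightarrow> t \<in> T \<Longrightarrow> deg t = w i \<Longrightarrow> \<Phi> i t = \<Phi>0 (\<pi> i) t"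
    and ne: "\<And>i t. i \<in> I \<Longrightarrow> t \<in> T \<Longrightarrow> deg t \<noteq> w i \<Longrightarrow> \<Phi>0 (\<pi> i) t = 0"
    and van: "\<And>t. t \<in> T \<Longrightarrow> D < deg t \<Longrightarrow> (\<Sum>i\<in>I. X i * \<Phi> i t) = 0"
    and S: "finite S" "S \<subseteq> A" "\<And>i. i \<in> I \<Longrightarrow> w i = D \<Longrightarrow> \<pi> i \<in> S"
    and top: "\<And>t. t \<in> T \<Longrightarrow> deg t = D \<Longrightarrow> (\<Sum>i\<in>I. X i * \<Phi> i t) = (\<Sum>s\<in>S. Y s * \<Phi>0 s t)"
    and neS: "\<And>s t. s \<in> S \<Longrightarrow> t \<in> T \<Longrightarrow> deg t \<noteq> D \<Longrightarrow> \<Phi>0 s t = 0"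
    and i: "i \<in> I" "w i = D"
  shows "X i = Y (\<pi> i)"
proof (rule indep_eq(1)[OF ind S(1,2), where E = "{k\<in>I. w k = D}" and \<pi> = \<pi>])
  \<comment> \<open>Indices of degree above \<open>D\<close> are removed first. At test points of
    degree \<open>D\<close> those of lower degree vanish by \<open>hi\<close>, so only leading parts
    remain.\<close>
  have z: "X i = 0" if "i \<in> I" "D < w i" for i
    by (rule lead_zero[where D = D and X = X and w = w and deg = deg and \<Phi> = \<Phi> and \<pi> = \<pi>, OF ind fin inj sub hi eq ne van that]) auto
  fix t assume t: "t \<in> T"
  show "(\<Sum>k\<in>{k\<in>I. w k = D}. X k * \<Phi>0 (\<pi> k) t) = (\<Sum>s\<in>S. Y s * \<Phi>0 s t)"
  proof (cases "deg t = D")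
    case True
    have "(\<Sum>k\<in>{k\<in>I. w k = D}. X k * \<Phi>0 (\<pi> k) t) = (\<Sum>k\<in>I. X k * \<Phi> k t)"
    proof (rule sum.mono_neutral_cong_left[OF fin])
      show "\<forall>k\<in>I - {k\<in>I. w k = D}. X k * \<Phi> k t = 0"
      proof
        fix k assume "k \<in> I - {k\<in>I. w k = D}"
        then consider "k \<in> I" "D < w k" | "k \<in> I" "w k < D" by force
        then show "X k * \<Phi> k t = 0" using z hi[OF _ t] True by cases auto
      qed
    qed (use eq[OF _ t] True in auto)
    then show ?thesis using top[OF t] True by simp
  next
    case False
    then have "(\<Sum>k\<in>{k\<in>I. w k = D}. X k * \<Phi>0 (\<pi> k) t) = 0" using ne[OF _ t] by (auto intro!: sum.neutral)
    moreover have "(\<Sum>s\<in>S. Y s * \<Phi>0 s t) = 0" using neS[OF _ t False] by (auto intro!: sum.neutral)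
    ultimately show ?thesis by simp
  qed
qed (use fin inj S i in \<open>auto intro: inj_on_subset\<close>)

section \<open>Splitting off rows\<close>

text \<open>Degrees in the first \<open>c\<close> variables add under multiplication, so the leading
  part of a product is the product of the leading parts, and each of these splits by
  \<open>kostka_top\<close>.\<close>

lemma prod_coeff_top:
  assumes "\<forall>l\<in>set R. is_ptn l" "length u = c"
  shows "(total_weight (map (take_rows c) R) < sum_list u \<longrightarrow> prod_coeff R (u @ v) = 0) \<and>
    (sum_list u = total_weight (map (take_rows c) R) \<longrightarrow> prod_coeff R (u @ v) = prod_coeff (map (take_rows c) R) u * prod_coeff (map (drop_rows c) R) v)"
  using assms
proof (induction R arbitrary: u v)
  case Nil
  then show ?case by (auto simp: hom_sym_def total_weight_def simp del: sum_list_eq_0_iff)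
next
  case (Cons l R)
  define D where "D = total_weight (map (take_rows c) R)"
  have l: "is_ptn l" and R: "\<forall>l\<in>set R. is_ptn l" using Cons.prems by auto
  have R': "\<forall>l\<in>set (map (take_rows c) R). is_ptn l" using R is_ptn_take_rows by auto
  have total: "total_weight (map (take_rows c) (l # R)) = weight (take_rows c l) + D" by (simp add: total_weight_def D_def)
  have e: "prod_coeff (l # R) (u @ v) = split_sum (\<lambda>x y. split_sum (\<lambda>x' y'. kostka l (x @ x') * prod_coeff R (y @ y')) v) u"
    by (simp add: split_sum_append)
  have z: "split_sum (\<lambda>x' y'. kostka l (x @ x') * prod_coeff R (y @ y')) v = 0"
    if "length x = c" "length y = c" "weight (take_rows c l) < sum_list x \<or> D < sum_list y" for x y
    using that kostka_top(1)[OF l, of x c] Cons.IH[OF R, of y] by (intro split_sum_zero) (auto simp: D_def)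
  show ?case
  proof (intro conjI impI)
    assume s: "total_weight (map (take_rows c) (l # R)) < sum_list u"
    show "prod_coeff (l # R) (u @ v) = 0"
      unfolding e by (rule split_sum_zero, rule z) (use s total Cons.prems in auto)
  next
    assume s: "sum_list u = total_weight (map (take_rows c) (l # R))"
    have "prod_coeff (l # R) (u @ v) = split_sum (\<lambda>x y. kostka (take_rows c l) x * prod_coeff (map (take_rows c) R) y * convolve (kostka (drop_rows c l)) (prod_coeff (map (drop_rows c) R)) v) u"
      unfolding e
    proof (rule split_sum_cong)
      fix x y :: "nat list"
      assume xy: "length x = length u" "length y = length u" "sum_list x + sum_list y = sum_list u"
      show "split_sum (\<lambda>x' y'. kostka l (x @ x') * prod_coeff R (y @ y')) v
        = kostka (take_rows c l) x * prod_coeff (map (take_rows c) R) y * convolve (kostka (drop_rows c l)) (prod_coeff (map (drop_rows c) R)) v"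
      proof (cases "sum_list x = weight (take_rows c l)")
        case True
        then have "sum_list y = D" using xy s total by simp
        then show ?thesis
          using True kostka_top(2)[OF l, of x c] Cons.IH[OF R, of y] xy Cons.prems(2)
          by (simp add: D_def split_sum_scale[symmetric] mult_ac)
      next
        case False
        \<comment> \<open>The degrees of \<open>x\<close> and \<open>y\<close> add up to the sum of
          the two maximal degrees. If they differ from these, one of them is too large and its
          factor vanishes.\<close>
        then have "kostka (take_rows c l) x = 0" by (intro kostka_sum_neq) auto
        moreover have "split_sum (\<lambda>x' y'. kostka l (x @ x') * prod_coeff R (y @ y')) v = 0"
          by (rule z) (use xy s total False Cons.prems in auto)
        ultimately show ?thesis by simp
      qed
    qed
    then show "prod_coeff (l # R) (u @ v) = prod_coeff (map (take_rows c) (l # R)) u * prod_coeff (map (drop_rows c) (l # R)) v"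
      by (simp add: split_sum_scale_right)
  qed
qed

lemma total_weight_take_rows_drop_rows: "\<forall>l\<in>set R. is_ptn l \<Longrightarrow> total_weight R = total_weight (map (take_rows c) R) + total_weight (map (drop_rows c) R)"
proof (induction R)
  case (Cons l R)
  then show ?case using weight_take_rows_drop_rows[of l c] by (simp add: total_weight_def)
qed (simp add: total_weight_def)

lemma inj_take_rows_drop_rows: "inj (\<lambda>f. (take_rows c f, drop_rows c f))"
  by (rule inj_onI) (metis Pair_inject glue_take_rows_drop_rows)

text \<open>The leading-term lemmas are applied to all shapes of size \<open>n\<close>, with
  \<open>c\<close> distinguished variables and \<open>n\<close> further ones. A leading part is a
  product of two Schur polynomials in separate alphabets, so \<open>indep_prod\<close> supplies the
  independence; \<open>n\<close> further variables accommodate whatever remains below the first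
  \<open>c\<close> rows.\<close>

lemma
  assumes R: "\<forall>l\<in>set R. is_ptn l" and \<eta>: "is_ptn \<eta>"
  shows schur_mult_top_bound: "schur_mult \<eta> R \<noteq> 0 \<Longrightarrow> weight (take_rows c \<eta>) \<le> total_weight (map (take_rows c) R)"
    and schur_mult_top_factor: "weight (take_rows c \<eta>) = total_weight (map (take_rows c) R) \<Longrightarrow>
      schur_mult \<eta> R = schur_mult (take_rows c \<eta>) (map (take_rows c) R) * schur_mult (drop_rows c \<eta>) (map (drop_rows c) R)"
proof -
  define n where "n = total_weight R"
  define D where "D = total_weight (map (take_rows c) R)"
  define q where "q = total_weight (map (drop_rows c) R)"
  have n: "n = D + q" using total_weight_take_rows_drop_rows[OF R] by (simp add: n_def D_def q_def)
  define \<Phi>0 where "\<Phi>0 = (\<lambda>(\<kappa>, \<tau>) (u, v). kostka \<kappa> u * kostka \<tau> v)"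
  define A where "A = {f. is_ptn f \<and> rows c f} \<times> {f. is_ptn f \<and> rows n f}"
  define T where "T = {u::nat list. length u = c} \<times> {v::nat list. length v = n}"
  define \<Phi> where "\<Phi> \<eta> = (\<lambda>(u, v). kostka \<eta> (u @ v))" for \<eta>
  define deg where "deg = (\<lambda>(u::nat list, v::nat list). sum_list u)"
  define w where "w \<eta> = weight (take_rows c \<eta>)" for \<eta>
  define \<pi> where "\<pi> \<eta> = (take_rows c \<eta>, drop_rows c \<eta>)" for \<eta>
  have ind: "indep A \<Phi>0 T" unfolding A_def \<Phi>0_def T_def by (rule indep_prod; rule indep_kostka)
  have fin: "finite (Ptns n)" by (rule finite_Ptns)
  have inj: "inj_on \<pi> (Ptns n)" unfolding \<pi>_def using inj_take_rows_drop_rows inj_on_subset by blast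
  have rdp: "rows n (drop_rows c f)" if "f \<in> Ptns n" for f
    using that is_ptn_rows_weight[of f] by (auto simp: Ptns_def rows_def drop_rows_def)
  have sub: "\<pi> ` Ptns n \<subseteq> A" using rdp by (auto simp: \<pi>_def A_def Ptns_def is_ptn_take_rows is_ptn_drop_rows rows_take_rows)
  have hi: "\<Phi> i t = 0" if "i \<in> Ptns n" "t \<in> T" "w i < deg t" for i t
    using that kostka_top(1)[of i "fst t" c "snd t"] by (auto simp: \<Phi>_def T_def w_def deg_def Ptns_def split: prod.splits)
  have eq: "\<Phi> i t = \<Phi>0 (\<pi> i) t" if "i \<in> Ptns n" "t \<in> T" "deg t = w i" for i t
    using that kostka_top(2)[of i "fst t" c "snd t"]
    by (auto simp: \<Phi>_def \<Phi>0_def T_def w_def \<pi>_def deg_def Ptns_def split: prod.splits)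
  have ne: "\<Phi>0 (\<pi> i) t = 0" if "i \<in> Ptns n" "t \<in> T" "deg t \<noteq> w i" for i t
    using that by (auto simp: \<Phi>0_def w_def \<pi>_def deg_def kostka_sum_neq split: prod.splits)
  have pls: "(\<Sum>i\<in>Ptns n. schur_mult i R * \<Phi> i t) = prod_coeff R (fst t @ snd t)" for t
    unfolding prod_coeff_expansion[OF R] by (simp add: n_def \<Phi>_def case_prod_beta)
  have van: "(\<Sum>i\<in>Ptns n. schur_mult i R * \<Phi> i t) = 0" if "t \<in> T" "D < deg t" for t
    using that prod_coeff_top[OF R, of "fst t" c "snd t"] unfolding pls by (auto simp: T_def deg_def D_def split: prod.splits)
  show "weight (take_rows c \<eta>) \<le> total_weight (map (take_rows c) R)" if nz: "schur_mult \<eta> R \<noteq> 0"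
  proof (rule ccontr)
    assume "\<not> ?thesis"
    then have D: "D < w \<eta>" by (simp add: D_def w_def)
    have \<eta>n: "\<eta> \<in> Ptns n" using schur_mult_size[OF R \<eta>] nz \<eta> by (auto simp: Ptns_def n_def)
    have "schur_mult \<eta> R = 0"
      by (rule lead_zero[where w = w and deg = deg and \<Phi> = \<Phi> and \<pi> = \<pi> and X = "\<lambda>i. schur_mult i R", OF ind fin inj sub hi eq ne van \<eta>n D])
    then show False using nz by simp
  qed
  show "schur_mult \<eta> R = schur_mult (take_rows c \<eta>) (map (take_rows c) R) * schur_mult (drop_rows c \<eta>) (map (drop_rows c) R)"
    if w\<eta>: "weight (take_rows c \<eta>) = total_weight (map (take_rows c) R)"
  proof (cases "weight \<eta> = n")
    case False
    then have "schur_mult \<eta> R = 0" using schur_mult_size[OF R \<eta>] by (simp add: n_def)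
    moreover have "schur_mult (drop_rows c \<eta>) (map (drop_rows c) R) = 0"
      using R w\<eta> weight_take_rows_drop_rows[OF \<eta>, of c] n False by (intro schur_mult_size) (auto simp: is_ptn_drop_rows \<eta> D_def q_def)
    ultimately show ?thesis by simp
  next
    case True
    define S where "S = {\<kappa>\<in>Ptns D. rows c \<kappa>} \<times> Ptns q"
    define Y where "Y = (\<lambda>(\<kappa>, \<tau>). schur_mult \<kappa> (map (take_rows c) R) * schur_mult \<tau> (map (drop_rows c) R))"
    have "schur_mult \<eta> R = Y (\<pi> \<eta>)"
    proof (rule lead_eq[where w = w and deg = deg and \<Phi> = \<Phi> and \<pi> = \<pi>, OF ind fin inj sub hi eq ne van, where S = S])
      show "finite S" unfolding S_def using finite_Ptns by auto
      have "rows n \<tau>" if "is_ptn \<tau>" "weight \<tau> = q" for \<tau>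
        using rows_mono[OF is_ptn_rows_weight[OF that(1)], of n] that n by simp
      then show "S \<subseteq> A" by (auto simp: S_def A_def Ptns_def)
      show "\<pi> i \<in> S" if "i \<in> Ptns n" "w i = D" for i
        using that weight_take_rows_drop_rows[of i c] n by (auto simp: \<pi>_def S_def Ptns_def w_def is_ptn_take_rows is_ptn_drop_rows rows_take_rows)
      show "\<Phi>0 s t = 0" if "s \<in> S" "t \<in> T" "deg t \<noteq> D" for s t
        using that by (auto simp: \<Phi>0_def S_def deg_def Ptns_def kostka_sum_neq split: prod.splits)
      fix t assume t: "t \<in> T" "deg t = D"
      obtain u v where uv: "t = (u, v)" by (cases t)
      have len: "length u = c" "sum_list u = D" using t uv by (auto simp: T_def deg_def)
      have "(\<Sum>i\<in>Ptns n. schur_mult i R * \<Phi> i t) = prod_coeff (map (take_rows c) R) u * prod_coeff (map (drop_rows c) R) v"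
        using prod_coeff_top[OF R len(1), of v] len(2) unfolding pls by (simp add: uv D_def)
      also have "prod_coeff (map (drop_rows c) R) v = (\<Sum>\<tau>\<in>Ptns q. schur_mult \<tau> (map (drop_rows c) R) * kostka \<tau> v)"
        unfolding q_def by (rule prod_coeff_expansion) (use R is_ptn_drop_rows in auto)
      also have "prod_coeff (map (take_rows c) R) u = (\<Sum>\<kappa>\<in>Ptns D. schur_mult \<kappa> (map (take_rows c) R) * kostka \<kappa> u)"
        unfolding D_def by (rule prod_coeff_expansion) (use R is_ptn_take_rows in auto)
      also have "\<dots> = (\<Sum>\<kappa>\<in>{\<kappa>\<in>Ptns D. rows c \<kappa>}. schur_mult \<kappa> (map (take_rows c) R) * kostka \<kappa> u)"
        by (rule sum.mono_neutral_right[OF finite_Ptns]) (use kostka_nz(2)[of u] len(1) in auto)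
      also have "\<dots> * (\<Sum>\<tau>\<in>Ptns q. schur_mult \<tau> (map (drop_rows c) R) * kostka \<tau> v) = (\<Sum>s\<in>S. Y s * \<Phi>0 s t)"
        unfolding sum_product S_def sum.cartesian_product
        by (rule sum.cong) (auto simp: Y_def \<Phi>0_def uv)
      finally show "(\<Sum>i\<in>Ptns n. schur_mult i R * \<Phi> i t) = (\<Sum>s\<in>S. Y s * \<Phi>0 s t)" .
    qed (use True \<eta> w\<eta> in \<open>auto simp: Ptns_def w_def D_def\<close>)
    then show ?thesis by (simp add: Y_def \<pi>_def)
  qed
qed

text \<open>A chain is cut where the first alphabet ends. The part before the cut is a tableau of
  shape \<rho>1, and the part after it is skew and expands by
  \<open>lr_coeff_expansion\<close>.\<close>

lemma kostka_coproduct: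
  "kostka \<theta> (m1 @ m2) = (\<Sum>(\<rho>1, \<rho>2)\<in>Ptns (sum_list m1) \<times> Ptns (sum_list m2). lr_coeff \<theta> \<rho>1 \<rho>2 * (kostka \<rho>1 m1 * kostka \<rho>2 m2))"
proof -
  have "kostka \<theta> (m1 @ m2) = (\<Sum>\<rho>1\<in>Ptns (sum_list m1). kostka \<rho>1 m1 * skew_kostka m2 \<rho>1 \<theta>)"
    using skew_kostka_append[OF is_ptn_zero, of m1 m2 \<theta>] by simp
  also have "\<dots> = (\<Sum>\<rho>1\<in>Ptns (sum_list m1). \<Sum>\<rho>2\<in>Ptns (sum_list m2). lr_coeff \<theta> \<rho>1 \<rho>2 * (kostka \<rho>1 m1 * kostka \<rho>2 m2))"
    by (intro sum.cong refl, subst lr_coeff_expansion) (auto simp: Ptns_def sum_distrib_left mult_ac)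
  finally show ?thesis by (simp add: sum.cartesian_product)
qed

text \<open>Here the Schur polynomial of \<open>\<theta>\<close> is evaluated on two alphabets, and the terms of highest degree
  in the first \<open>a1\<close> variables of one and the first \<open>a2\<close> variables of the other are compared.\<close>

lemma
  assumes \<theta>: "is_ptn \<theta>" and \<rho>: "is_ptn \<rho>1" "is_ptn \<rho>2"
  shows lr_coeff_bottom_bound: "lr_coeff \<theta> \<rho>1 \<rho>2 \<noteq> 0 \<Longrightarrow> weight (take_rows a1 \<rho>1) + weight (take_rows a2 \<rho>2) \<le> weight (take_rows (a1 + a2) \<theta>)"
    and lr_coeff_bottom_factor: "weight (take_rows a1 \<rho>1) + weight (take_rows a2 \<rho>2) = weight (take_rows (a1 + a2) \<theta>) \<Longrightarrow> weight \<theta> = weight \<rho>1 + weight \<rho>2 \<Longrightarrow>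
      lr_coeff \<theta> \<rho>1 \<rho>2 = lr_coeff (take_rows (a1 + a2) \<theta>) (take_rows a1 \<rho>1) (take_rows a2 \<rho>2) * lr_coeff (drop_rows (a1 + a2) \<theta>) (drop_rows a1 \<rho>1) (drop_rows a2 \<rho>2)"
proof -
  define n1 where "n1 = weight \<rho>1"
  define n2 where "n2 = weight \<rho>2"
  define D where "D = weight (take_rows (a1 + a2) \<theta>)"
  define \<Phi>1 where "\<Phi>1 = (\<lambda>(\<kappa>, \<tau>) (u, v). kostka \<kappa> u * kostka \<tau> v)"
  define \<Phi>0 where "\<Phi>0 = (\<lambda>(\<alpha>, \<beta>) (s, t). \<Phi>1 \<alpha> s * \<Phi>1 \<beta> t)"
  define A where "A = ({f. is_ptn f \<and> rows a1 f} \<times> {f. is_ptn f \<and> rows n1 f}) \<times> ({f. is_ptn f \<and> rows a2 f} \<times> {f. is_ptn f \<and> rows n2 f})"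
  define T where "T = ({u::nat list. length u = a1} \<times> {v::nat list. length v = n1}) \<times> ({u::nat list. length u = a2} \<times> {v::nat list. length v = n2})"
  define I where "I = Ptns n1 \<times> Ptns n2"
  define \<Phi> where "\<Phi> = (\<lambda>(\<sigma>1, \<sigma>2) ((u1, v1), (u2, v2)). kostka \<sigma>1 (u1 @ v1) * kostka \<sigma>2 (u2 @ v2))"
  define deg where "deg = (\<lambda>((u1::nat list, v1::nat list), (u2::nat list, v2::nat list)). sum_list u1 + sum_list u2)"
  define w where "w = (\<lambda>(\<sigma>1, \<sigma>2). weight (take_rows a1 \<sigma>1) + weight (take_rows a2 \<sigma>2))"
  define \<pi> where "\<pi> = (\<lambda>(\<sigma>1, \<sigma>2). ((take_rows a1 \<sigma>1, drop_rows a1 \<sigma>1), (take_rows a2 \<sigma>2, drop_rows a2 \<sigma>2)))"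
  define X where "X = (\<lambda>(\<sigma>1, \<sigma>2). lr_coeff \<theta> \<sigma>1 \<sigma>2)"
  have ind: "indep A \<Phi>0 T" unfolding A_def \<Phi>0_def \<Phi>1_def T_def
    by (intro indep_prod indep_kostka)
  have fin: "finite I" by (simp add: I_def finite_Ptns)
  have inj: "inj_on \<pi> I"
    by (rule inj_onI, clarsimp simp: \<pi>_def) (metis glue_take_rows_drop_rows)
  have rdp: "rows n (drop_rows c f)" if "f \<in> Ptns n" for f n c
    using that is_ptn_rows_weight[of f] by (auto simp: Ptns_def rows_def drop_rows_def)
  have sub: "\<pi> ` I \<subseteq> A" using rdp by (auto simp: \<pi>_def I_def A_def Ptns_def is_ptn_take_rows is_ptn_drop_rows rows_take_rows)
  have hi: "\<Phi> i t = 0" if "i \<in> I" "t \<in> T" "w i < deg t" for i t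
  proof -
    obtain \<sigma>1 \<sigma>2 u1 v1 u2 v2 where it: "i = (\<sigma>1, \<sigma>2)" "t = ((u1, v1), (u2, v2))" by (metis prod.exhaust)
    then have "weight (take_rows a1 \<sigma>1) < sum_list u1 \<or> weight (take_rows a2 \<sigma>2) < sum_list u2" using that(3) by (auto simp: w_def deg_def)
    then show ?thesis using that it kostka_top(1)[of \<sigma>1 u1 a1 v1] kostka_top(1)[of \<sigma>2 u2 a2 v2]
      by (auto simp: \<Phi>_def I_def T_def Ptns_def)
  qed
  have eq: "\<Phi> i t = \<Phi>0 (\<pi> i) t" if "i \<in> I" "t \<in> T" "deg t = w i" for i t
  proof -
    obtain \<sigma>1 \<sigma>2 u1 v1 u2 v2 where it: "i = (\<sigma>1, \<sigma>2)" "t = ((u1, v1), (u2, v2))" by (metis prod.exhaust)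
    have "sum_list u1 + sum_list u2 = weight (take_rows a1 \<sigma>1) + weight (take_rows a2 \<sigma>2)"
      using that(3) it by (simp add: w_def deg_def)
    then consider "sum_list u1 = weight (take_rows a1 \<sigma>1)" "sum_list u2 = weight (take_rows a2 \<sigma>2)" | "weight (take_rows a1 \<sigma>1) < sum_list u1" | "weight (take_rows a2 \<sigma>2) < sum_list u2"
      by linarith
    then show ?thesis
    proof cases
      case 1
      then show ?thesis using that it kostka_top(2)[of \<sigma>1 u1 a1 v1] kostka_top(2)[of \<sigma>2 u2 a2 v2]
        by (simp add: \<Phi>_def I_def T_def Ptns_def \<Phi>0_def \<Phi>1_def \<pi>_def)
    next
      case 2
      then show ?thesis using that it kostka_top(1)[of \<sigma>1 u1 a1 v1] kostka_sum_neq[of "take_rows a1 \<sigma>1" u1]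
        by (simp add: \<Phi>_def I_def T_def Ptns_def \<Phi>0_def \<Phi>1_def \<pi>_def)
    next
      case 3
      then show ?thesis using that it kostka_top(1)[of \<sigma>2 u2 a2 v2] kostka_sum_neq[of "take_rows a2 \<sigma>2" u2]
        by (simp add: \<Phi>_def I_def T_def Ptns_def \<Phi>0_def \<Phi>1_def \<pi>_def)
    qed
  qed
  have ne: "\<Phi>0 (\<pi> i) t = 0" if "i \<in> I" "t \<in> T" "deg t \<noteq> w i" for i t
  proof -
    obtain \<sigma>1 \<sigma>2 u1 v1 u2 v2 where it: "i = (\<sigma>1, \<sigma>2)" "t = ((u1, v1), (u2, v2))" by (metis prod.exhaust)
    then have "weight (take_rows a1 \<sigma>1) \<noteq> sum_list u1 \<or> weight (take_rows a2 \<sigma>2) \<noteq> sum_list u2" using that(3) by (auto simp: w_def deg_def)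
    then show ?thesis using kostka_sum_neq[of "take_rows a1 \<sigma>1" u1] kostka_sum_neq[of "take_rows a2 \<sigma>2" u2]
      by (auto simp: it \<Phi>0_def \<Phi>1_def \<pi>_def)
  qed
  \<comment> \<open>By symmetry the distinguished variables of both alphabets may be placed first,
    so that \<open>kostka_top\<close> for \<theta> with \<open>a1 + a2\<close> distinguished
    variables governs the joint degree.\<close>
  have sumI: "(\<Sum>i\<in>I. X i * \<Phi> i ((u1, v1), (u2, v2))) =
    (if sum_list (u1 @ v1) = n1 \<and> sum_list (u2 @ v2) = n2 then kostka \<theta> ((u1 @ u2) @ (v1 @ v2)) else 0)" for u1 v1 u2 v2
  proof (cases "sum_list (u1 @ v1) = n1 \<and> sum_list (u2 @ v2) = n2")
    case True
    have "kostka \<theta> ((u1 @ u2) @ (v1 @ v2)) = kostka \<theta> ((u1 @ v1) @ (u2 @ v2))" by (rule kostka_mset) simp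
    also have "\<dots> = (\<Sum>(\<sigma>1, \<sigma>2)\<in>I. lr_coeff \<theta> \<sigma>1 \<sigma>2 * (kostka \<sigma>1 (u1 @ v1) * kostka \<sigma>2 (u2 @ v2)))"
      by (subst kostka_coproduct) (simp only: I_def True)
    also have "\<dots> = (\<Sum>i\<in>I. X i * \<Phi> i ((u1, v1), (u2, v2)))"
      by (rule sum.cong) (auto simp: X_def \<Phi>_def)
    finally show ?thesis using True by simp
  next
    case False
    have "X i * \<Phi> i ((u1, v1), (u2, v2)) = 0" if i: "i \<in> I" for i
    proof -
      obtain \<sigma>1 \<sigma>2 where "i = (\<sigma>1, \<sigma>2)" by (cases i)
      then show ?thesis using i False kostka_sum_neq[of \<sigma>1 "u1 @ v1"] kostka_sum_neq[of \<sigma>2 "u2 @ v2"]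
        by (auto simp: \<Phi>_def I_def Ptns_def)
    qed
    then have "(\<Sum>i\<in>I. X i * \<Phi> i ((u1, v1), (u2, v2))) = 0" by (intro sum.neutral) blast
    then show ?thesis using False by auto
  qed
  have van: "(\<Sum>i\<in>I. X i * \<Phi> i t) = 0" if "t \<in> T" "D < deg t" for t
  proof -
    obtain u1 v1 u2 v2 where t: "t = ((u1, v1), (u2, v2))" by (metis prod.exhaust)
    then show ?thesis using that kostka_top(1)[OF \<theta>, of "u1 @ u2" "a1 + a2" "v1 @ v2"]
      unfolding t sumI by (simp add: T_def deg_def D_def)
  qed
  show "weight (take_rows a1 \<rho>1) + weight (take_rows a2 \<rho>2) \<le> weight (take_rows (a1 + a2) \<theta>)" if nz: "lr_coeff \<theta> \<rho>1 \<rho>2 \<noteq> 0"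
  proof (rule ccontr)
    assume "\<not> ?thesis"
    then have D: "D < w (\<rho>1, \<rho>2)" by (simp add: D_def w_def)
    have i: "(\<rho>1, \<rho>2) \<in> I" using \<rho> by (simp add: I_def Ptns_def n1_def n2_def)
    have "X (\<rho>1, \<rho>2) = 0"
      by (rule lead_zero[where w = w and deg = deg and \<Phi> = \<Phi> and \<pi> = \<pi>, OF ind fin inj sub hi eq ne van i D])
    then show False using nz by (simp add: X_def)
  qed
  show "lr_coeff \<theta> \<rho>1 \<rho>2 = lr_coeff (take_rows (a1 + a2) \<theta>) (take_rows a1 \<rho>1) (take_rows a2 \<rho>2) * lr_coeff (drop_rows (a1 + a2) \<theta>) (drop_rows a1 \<rho>1) (drop_rows a2 \<rho>2)"
    if w\<rho>: "weight (take_rows a1 \<rho>1) + weight (take_rows a2 \<rho>2) = weight (take_rows (a1 + a2) \<theta>)" and w\<theta>: "weight \<theta> = weight \<rho>1 + weight \<rho>2"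
  proof -
    define S where "S = {((\<kappa>1, \<tau>1), (\<kappa>2, \<tau>2)). is_ptn \<kappa>1 \<and> rows a1 \<kappa>1 \<and> is_ptn \<tau>1 \<and> is_ptn \<kappa>2 \<and> rows a2 \<kappa>2 \<and> is_ptn \<tau>2 \<and>
       weight \<kappa>1 + weight \<tau>1 = n1 \<and> weight \<kappa>2 + weight \<tau>2 = n2 \<and> weight \<kappa>1 + weight \<kappa>2 = D}"
    define Y where "Y = (\<lambda>((\<kappa>1, \<tau>1), (\<kappa>2, \<tau>2)). lr_coeff (take_rows (a1 + a2) \<theta>) \<kappa>1 \<kappa>2 * lr_coeff (drop_rows (a1 + a2) \<theta>) \<tau>1 \<tau>2)"
    have finS: "finite S"
    proof (rule finite_subset)
      show "S \<subseteq> ((\<Union>n\<le>n1. Ptns n) \<times> (\<Union>n\<le>n1. Ptns n)) \<times> ((\<Union>n\<le>n2. Ptns n) \<times> (\<Union>n\<le>n2. Ptns n))"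
        by (auto simp: S_def Ptns_def)
    qed (simp add: finite_Ptns)
    have "X (\<rho>1, \<rho>2) = Y (\<pi> (\<rho>1, \<rho>2))"
    proof (rule lead_eq[where w = w and deg = deg and \<Phi> = \<Phi> and \<pi> = \<pi>, OF ind fin inj sub hi eq ne van, where S = S])
      have r: "rows n \<tau>" if "is_ptn \<tau>" "weight \<tau> \<le> n" for \<tau> n
        using rows_mono[OF is_ptn_rows_weight[OF that(1)], of n] that by simp
      then show "S \<subseteq> A" by (auto simp: S_def A_def)
      show "\<pi> i \<in> S" if "i \<in> I" "w i = D" for i
        using that weight_take_rows_drop_rows[of "fst i" a1] weight_take_rows_drop_rows[of "snd i" a2]
        by (auto simp: \<pi>_def S_def I_def Ptns_def w_def is_ptn_take_rows is_ptn_drop_rows rows_take_rows)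
      show "\<Phi>0 s t = 0" if st: "s \<in> S" "t \<in> T" "deg t \<noteq> D" for s t
      proof -
        obtain \<kappa>1 \<tau>1 \<kappa>2 \<tau>2 u1 v1 u2 v2 where it: "s = ((\<kappa>1, \<tau>1), (\<kappa>2, \<tau>2))" "t = ((u1, v1), (u2, v2))" by (metis prod.exhaust)
        then have "weight \<kappa>1 \<noteq> sum_list u1 \<or> weight \<kappa>2 \<noteq> sum_list u2" using st by (auto simp: S_def deg_def)
        then show ?thesis using kostka_sum_neq[of \<kappa>1 u1] kostka_sum_neq[of \<kappa>2 u2] by (auto simp: it \<Phi>0_def \<Phi>1_def)
      qed
      fix t assume t: "t \<in> T" "deg t = D"
      obtain u1 v1 u2 v2 where uv: "t = ((u1, v1), (u2, v2))" by (metis prod.exhaust)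
      have len: "length u1 = a1" "length u2 = a2" "sum_list u1 + sum_list u2 = D"
        using t uv by (auto simp: T_def deg_def)
      show "(\<Sum>i\<in>I. X i * \<Phi> i t) = (\<Sum>s\<in>S. Y s * \<Phi>0 s t)"
      proof (cases "sum_list (u1 @ v1) = n1 \<and> sum_list (u2 @ v2) = n2")
        case False
        have "Y s * \<Phi>0 s t = 0" if s: "s \<in> S" for s
        proof -
          obtain \<kappa>1 \<tau>1 \<kappa>2 \<tau>2 where it: "s = ((\<kappa>1, \<tau>1), (\<kappa>2, \<tau>2))" by (metis prod.exhaust)
          then have "weight \<kappa>1 \<noteq> sum_list u1 \<or> weight \<kappa>2 \<noteq> sum_list u2 \<or> weight \<tau>1 \<noteq> sum_list v1 \<or> weight \<tau>2 \<noteq> sum_list v2"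
            using s False by (auto simp: S_def)
          then show ?thesis
            using kostka_sum_neq[of \<kappa>1 u1] kostka_sum_neq[of \<kappa>2 u2] kostka_sum_neq[of \<tau>1 v1] kostka_sum_neq[of \<tau>2 v2]
            by (auto simp: it \<Phi>0_def \<Phi>1_def uv)
        qed
        then have "(\<Sum>s\<in>S. Y s * \<Phi>0 s t) = 0" by (intro sum.neutral) blast
        then show ?thesis using False unfolding uv sumI by auto
      next
        case True
        define B where "B = Ptns (sum_list u1) \<times> Ptns (sum_list u2)"
        define C where "C = Ptns (sum_list v1) \<times> Ptns (sum_list v2)"
        define F where "F = (\<lambda>((\<kappa>1, \<kappa>2), (\<tau>1, \<tau>2)). Y ((\<kappa>1, \<tau>1), (\<kappa>2, \<tau>2)) * \<Phi>0 ((\<kappa>1, \<tau>1), (\<kappa>2, \<tau>2)) t)"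
        have "(\<Sum>i\<in>I. X i * \<Phi> i t) = kostka (take_rows (a1 + a2) \<theta>) (u1 @ u2) * kostka (drop_rows (a1 + a2) \<theta>) (v1 @ v2)"
          unfolding uv sumI using True kostka_top(2)[OF \<theta>, of "u1 @ u2" "a1 + a2" "v1 @ v2"] len by (simp add: D_def)
        also have "\<dots> = (\<Sum>p\<in>B \<times> C. F p)"
          unfolding kostka_coproduct sum_product B_def C_def sum.cartesian_product
          by (rule sum.cong) (auto simp: F_def Y_def \<Phi>0_def \<Phi>1_def uv mult_ac)
        \<comment> \<open>The two coproducts group the shapes by first rows and remaining rows,
          while \<open>S\<close> groups them by alphabet. Indices lying in only one of the two sets
          contribute 0 because of a size or a number of rows.\<close>
        also have "\<dots> = (\<Sum>p\<in>{((\<kappa>1, \<kappa>2), (\<tau>1, \<tau>2)). ((\<kappa>1, \<tau>1), (\<kappa>2, \<tau>2)) \<in> S}. F p)"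
        proof (rule sum.mono_neutral_cong)
          show "finite (B \<times> C)" by (simp add: B_def C_def finite_Ptns)
          have "{((\<kappa>1, \<kappa>2), (\<tau>1, \<tau>2)). ((\<kappa>1, \<tau>1), (\<kappa>2, \<tau>2)) \<in> S} = (\<lambda>((\<kappa>1, \<tau>1), (\<kappa>2, \<tau>2)). ((\<kappa>1, \<kappa>2), (\<tau>1, \<tau>2))) ` S"
            by force
          then show "finite {((\<kappa>1, \<kappa>2), (\<tau>1, \<tau>2)). ((\<kappa>1, \<tau>1), (\<kappa>2, \<tau>2)) \<in> S}" using finS by simp
          show "F p = 0" if p: "p \<in> {((\<kappa>1, \<kappa>2), (\<tau>1, \<tau>2)). ((\<kappa>1, \<tau>1), (\<kappa>2, \<tau>2)) \<in> S} - B \<times> C" for p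
          proof -
            obtain \<kappa>1 \<kappa>2 \<tau>1 \<tau>2 where it: "p = ((\<kappa>1, \<kappa>2), (\<tau>1, \<tau>2))" by (metis prod.exhaust)
            then have "weight \<kappa>1 \<noteq> sum_list u1 \<or> weight \<kappa>2 \<noteq> sum_list u2 \<or> weight \<tau>1 \<noteq> sum_list v1 \<or> weight \<tau>2 \<noteq> sum_list v2"
              using p by (auto simp: S_def B_def C_def Ptns_def)
            then show ?thesis
              using kostka_sum_neq[of \<kappa>1 u1] kostka_sum_neq[of \<kappa>2 u2] kostka_sum_neq[of \<tau>1 v1] kostka_sum_neq[of \<tau>2 v2]
              by (auto simp: it F_def \<Phi>0_def \<Phi>1_def uv)
          qed
          show "F p = 0" if p: "p \<in> B \<times> C - {((\<kappa>1, \<kappa>2), (\<tau>1, \<tau>2)). ((\<kappa>1, \<tau>1), (\<kappa>2, \<tau>2)) \<in> S}" for p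
          proof -
            obtain \<kappa>1 \<kappa>2 \<tau>1 \<tau>2 where it: "p = ((\<kappa>1, \<kappa>2), (\<tau>1, \<tau>2))" by (metis prod.exhaust)
            then have "\<not> rows a1 \<kappa>1 \<or> \<not> rows a2 \<kappa>2"
              using p True len by (auto simp: S_def B_def C_def Ptns_def)
            then show ?thesis
              using kostka_nz(2)[of u1 \<kappa>1] kostka_nz(2)[of u2 \<kappa>2] len by (auto simp: it F_def \<Phi>0_def \<Phi>1_def uv)
          qed
        qed auto
        also have "\<dots> = (\<Sum>s\<in>S. Y s * \<Phi>0 s t)"
          by (rule sum.reindex_bij_witness[of _ "\<lambda>((\<kappa>1, \<tau>1), (\<kappa>2, \<tau>2)). ((\<kappa>1, \<kappa>2), (\<tau>1, \<tau>2))" "\<lambda>((\<kappa>1, \<kappa>2), (\<tau>1, \<tau>2)). ((\<kappa>1, \<tau>1), (\<kappa>2, \<tau>2))"])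
            (auto simp: F_def)
        finally show ?thesis .
      qed
    qed (use \<rho> w\<rho> finS in \<open>auto simp: I_def Ptns_def w_def D_def n1_def n2_def\<close>)
    then show ?thesis by (simp add: X_def Y_def \<pi>_def)
  qed
qed

section \<open>Full columns\<close>

definition add_cols :: "nat \<Rightarrow> nat \<Rightarrow> shape \<Rightarrow> shape" where
  "add_cols r d \<kappa> = (\<lambda>i. if i < r then d + \<kappa> i else 0)"

lemma rows_add_cols: "rows r (add_cols r d \<kappa>)"
  by (simp add: rows_def add_cols_def)

lemma is_ptn_add_cols: "is_ptn \<kappa> \<Longrightarrow> is_ptn (add_cols r d \<kappa>)"
  unfolding is_ptn_def by (auto simp: add_cols_def)

lemma weight_add_cols: "rows r \<kappa> \<Longrightarrow> weight (add_cols r d \<kappa>) = r * d + weight \<kappa>"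
  unfolding weight_rows[OF rows_add_cols] by (simp add: add_cols_def sum.distrib weight_rows)

lemma add_cols_inj: "rows r \<kappa> \<Longrightarrow> rows r \<kappa>' \<Longrightarrow> add_cols r d \<kappa> = add_cols r d \<kappa>' \<Longrightarrow> \<kappa> = \<kappa>'"
proof
  fix i assume r: "rows r \<kappa>" "rows r \<kappa>'" and "add_cols r d \<kappa> = add_cols r d \<kappa>'"
  then have "add_cols r d \<kappa> i = add_cols r d \<kappa>' i" by simp
  then show "\<kappa> i = \<kappa>' i" using r by (cases "i < r") (auto simp: add_cols_def rows_def)
qed

lemma add_cols_exists:
  assumes "is_ptn \<rho>" "rows r \<rho>" "\<And>i. i < r \<Longrightarrow> d \<le> \<rho> i"
  obtains \<kappa> where "is_ptn \<kappa>" "rows r \<kappa>" "\<rho> = add_cols r d \<kappa>"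
proof
  let ?\<kappa> = "\<lambda>i. \<rho> i - d"
  show "rows r ?\<kappa>" using assms(2) by (simp add: rows_def)
  then show "is_ptn ?\<kappa>" unfolding is_ptn_def
    using assms(1) by (auto simp: rows_def is_ptn_def diff_le_mono)
  show "\<rho> = add_cols r d ?\<kappa>" using assms by (auto simp: add_cols_def rows_def)
qed

text \<open>In exactly \<open>r\<close> variables, \<open>d\<close> full columns of height
  \<open>r\<close> multiply a Schur polynomial by the \<open>d\<close>-th power of the product of
  all variables. The condition on \<open>m\<close> is divisibility by this monomial.\<close>

lemma kostka_add_cols:
  "is_ptn \<kappa> \<Longrightarrow> rows r \<kappa> \<Longrightarrow> length m = r \<Longrightarrow>
    kostka (add_cols r d \<kappa>) m = (if \<forall>x\<in>set m. d \<le> x then kostka \<kappa> (map (\<lambda>x. x - d) m) else 0)"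
proof (induction r arbitrary: \<kappa> m)
  case 0
  then have "\<kappa> = (\<lambda>_. 0)" by (auto simp: rows_def)
  moreover have "add_cols 0 d \<kappa> = (\<lambda>_. 0)" by (simp add: add_cols_def)
  ultimately show ?case using 0 by simp
next
  case (Suc r)
  obtain ms k where m: "m = ms @ [k]" "length ms = r"
    using Suc.prems(3) by (metis length_Suc_conv_rev)
  define B where "B = {h. is_ptn h \<and> horiz_strip h \<kappa> \<and> rows r h}"
  have finB: "finite B" by (rule finite_subset[OF _ finite_horiz_strip_below[OF Suc.prems(1)]]) (auto simp: B_def)
  have wb: "weight (add_cols (Suc r) d \<kappa>) = r * d + d + weight \<kappa>" using weight_add_cols[OF Suc.prems(2), of d] by simp
  have "kostka (add_cols (Suc r) d \<kappa>) m = (\<Sum>h\<in>{h. is_ptn h \<and> horiz_strip h (add_cols (Suc r) d \<kappa>) \<and> rows r h}. kostka h ms * of_bool (weight (add_cols (Suc r) d \<kappa>) = weight h + k))"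
    unfolding m(1) kostka_snoc_below[OF is_ptn_add_cols[OF Suc.prems(1)]]
    by (rule sum.mono_neutral_right[OF finite_horiz_strip_below[OF is_ptn_add_cols[OF Suc.prems(1)]]])
      (use kostka_nz(2)[of ms] m(2) in auto)
  also have "\<dots> = (\<Sum>h\<in>B. kostka (add_cols r d h) ms * of_bool (d + weight \<kappa> = weight h + k))"
  proof (rule sum.reindex_bij_witness[of _ "add_cols r d" "\<lambda>h i. h i - d"])
    fix h assume h: "h \<in> {h. is_ptn h \<and> horiz_strip h (add_cols (Suc r) d \<kappa>) \<and> rows r h}"
    have il: "h i \<le> add_cols (Suc r) d \<kappa> i" "add_cols (Suc r) d \<kappa> (Suc i) \<le> h i" for i using h by (auto simp: horiz_strip_def)
    \<comment> \<open>Interlacing makes row \<open>i\<close> of \<open>h\<close> at least row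
      \<open>i + 1\<close> of the larger shape, which still contains the \<open>d\<close> full
      columns because \<open>i < r\<close>.\<close>
    have ge: "d + \<kappa> (Suc i) \<le> h i" if "i < r" for i using il(2)[of i] that by (simp add: add_cols_def)
    then have ged: "d \<le> h i" if "i < r" for i using that by fastforce
    have rh: "h i = 0" if "r \<le> i" for i using h that by (simp add: rows_def)
    show e: "add_cols r d (\<lambda>i. h i - d) = h" using ged rh by (auto simp: add_cols_def)
    have I: "horiz_strip (\<lambda>i. h i - d) \<kappa>" unfolding horiz_strip_def
    proof
      fix i
      show "h i - d \<le> \<kappa> i \<and> \<kappa> (Suc i) \<le> h i - d"
      proof (cases "i < r")
        case True
        then have "h i \<le> d + \<kappa> i" using il(1)[of i] by (simp add: add_cols_def)
        then show ?thesis using ge[OF True] by linarith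
      next
        case False then show ?thesis using rh[of i] Suc.prems(2) by (simp add: rows_def)
      qed
    qed
    have R: "rows r (\<lambda>i. h i - d)" using rh by (simp add: rows_def)
    show "(\<lambda>i. h i - d) \<in> B" unfolding B_def using I R horiz_strip_is_ptn[OF I] Suc.prems(1) by simp
    show "kostka (add_cols r d (\<lambda>i. h i - d)) ms * of_bool (d + weight \<kappa> = weight (\<lambda>i. h i - d) + k) = kostka h ms * of_bool (weight (add_cols (Suc r) d \<kappa>) = weight h + k)"
      using weight_add_cols[OF R, of d] unfolding e wb by simp
  next
    fix h assume h: "h \<in> B"
    show "(\<lambda>i. add_cols r d h i - d) = h" using h by (auto simp: add_cols_def B_def rows_def)
    have "horiz_strip (add_cols r d h) (add_cols (Suc r) d \<kappa>)"
      using h by (auto simp: B_def horiz_strip_def add_cols_def)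
    then show "add_cols r d h \<in> {h. is_ptn h \<and> horiz_strip h (add_cols (Suc r) d \<kappa>) \<and> rows r h}"
      using h is_ptn_add_cols rows_add_cols by (auto simp: B_def)
  qed
  also have "\<dots> = (\<Sum>h\<in>B. if \<forall>x\<in>set m. d \<le> x then kostka h (map (\<lambda>x. x - d) ms) * of_bool (weight \<kappa> = weight h + (k - d)) else 0)"
  proof (rule sum.cong[OF refl])
    fix h assume h: "h \<in> B"
    have IH: "kostka (add_cols r d h) ms = (if \<forall>x\<in>set ms. d \<le> x then kostka h (map (\<lambda>x. x - d) ms) else 0)"
      using Suc.IH[of h ms] h m(2) by (simp add: B_def)
    have "weight h \<le> weight \<kappa>" using h horiz_strip_weight Suc.prems(1) by (auto simp: B_def)
    then have "d + weight \<kappa> = weight h + k \<longleftrightarrow> d \<le> k \<and> weight \<kappa> = weight h + (k - d)" by auto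
    then show "kostka (add_cols r d h) ms * of_bool (d + weight \<kappa> = weight h + k) =
       (if \<forall>x\<in>set m. d \<le> x then kostka h (map (\<lambda>x. x - d) ms) * of_bool (weight \<kappa> = weight h + (k - d)) else 0)"
      using IH m(1) by auto
  qed
  also have "\<dots> = (if \<forall>x\<in>set m. d \<le> x then (\<Sum>h\<in>B. kostka h (map (\<lambda>x. x - d) ms) * of_bool (weight \<kappa> = weight h + (k - d))) else 0)"
    by (cases "\<forall>x\<in>set m. d \<le> x") (simp, simp only: if_False sum.neutral_const)
  also have "(\<Sum>h\<in>B. kostka h (map (\<lambda>x. x - d) ms) * of_bool (weight \<kappa> = weight h + (k - d)))
      = (\<Sum>h\<in>{r. is_ptn r \<and> horiz_strip r \<kappa>}. kostka h (map (\<lambda>x. x - d) ms) * of_bool (weight \<kappa> = weight h + (k - d)))"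
    by (rule sum.mono_neutral_left[OF finite_horiz_strip_below[OF Suc.prems(1)]])
      (use kostka_nz(2)[of "map (\<lambda>x. x - d) ms"] m(2) in \<open>auto simp: B_def\<close>)
  also have "\<dots> = kostka \<kappa> (map (\<lambda>x. x - d) m)"
    unfolding m(1) using kostka_snoc_below[OF Suc.prems(1), of "map (\<lambda>x. x - d) ms" "k - d"] by simp
  finally show ?case .
qed

text \<open>If the factors are divisible by the \<open>b\<close>-th and the \<open>b'\<close>-th
  power of the product of all variables, both monomials can be taken out of the product.\<close>

lemma split_sum_shift:
  "split_sum (\<lambda>x y. if (\<forall>i\<in>set x. b \<le> i) \<and> (\<forall>i\<in>set y. b' \<le> i) then H (map (\<lambda>i. i - b) x) (map (\<lambda>i. i - b') y) else 0) m
    = (if \<forall>i\<in>set m. b + b' \<le> i then split_sum H (map (\<lambda>i. i - (b + b')) m) else 0)"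
proof (induction m arbitrary: H)
  case (Cons k m)
  define F where "F H m = (if \<forall>i\<in>set m. b + b' \<le> i then split_sum H (map (\<lambda>i. i - (b + b')) m) else 0)" for H m
  have "split_sum (\<lambda>x y. if (\<forall>i\<in>set x. b \<le> i) \<and> (\<forall>i\<in>set y. b' \<le> i) then H (map (\<lambda>i. i - b) x) (map (\<lambda>i. i - b') y) else 0) (k # m)
      = (\<Sum>j\<le>k. if b \<le> j \<and> b' \<le> k - j then F (\<lambda>x y. H ((j - b) # x) ((k - j - b') # y)) m else 0)"
    unfolding split_sum.simps
  proof (rule sum.cong[OF refl])
    fix j
    show "split_sum (\<lambda>x y. if (\<forall>i\<in>set (j # x). b \<le> i) \<and> (\<forall>i\<in>set ((k - j) # y). b' \<le> i)
         then H (map (\<lambda>i. i - b) (j # x)) (map (\<lambda>i. i - b') ((k - j) # y)) else 0) m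
      = (if b \<le> j \<and> b' \<le> k - j then F (\<lambda>x y. H ((j - b) # x) ((k - j - b') # y)) m else 0)"
    proof (cases "b \<le> j \<and> b' \<le> k - j")
      case True
      then have "split_sum (\<lambda>x y. if (\<forall>i\<in>set (j # x). b \<le> i) \<and> (\<forall>i\<in>set ((k - j) # y). b' \<le> i)
           then H (map (\<lambda>i. i - b) (j # x)) (map (\<lambda>i. i - b') ((k - j) # y)) else 0) m
        = split_sum (\<lambda>x y. if (\<forall>i\<in>set x. b \<le> i) \<and> (\<forall>i\<in>set y. b' \<le> i)
           then H ((j - b) # map (\<lambda>i. i - b) x) ((k - j - b') # map (\<lambda>i. i - b') y) else 0) m"
        by (intro split_sum_cong) auto
      also have "\<dots> = F (\<lambda>x y. H ((j - b) # x) ((k - j - b') # y)) m"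
        unfolding F_def by (rule Cons.IH)
      finally show ?thesis using True by simp
    next
      case False
      then show ?thesis by (auto intro!: split_sum_zero)
    qed
  qed
  also have "\<dots> = F H (k # m)"
  proof (cases "b + b' \<le> k")
    case False
    then have "(\<Sum>j\<le>k. if b \<le> j \<and> b' \<le> k - j then F (\<lambda>x y. H ((j - b) # x) ((k - j - b') # y)) m else 0) = 0"
      by (intro sum.neutral) auto
    then show ?thesis using False by (simp add: F_def)
  next
    case True
    have "(\<Sum>j\<le>k. if b \<le> j \<and> b' \<le> k - j then F (\<lambda>x y. H ((j - b) # x) ((k - j - b') # y)) m else 0)
        = (\<Sum>j\<in>{j. j \<le> k \<and> b \<le> j \<and> b' \<le> k - j}. F (\<lambda>x y. H ((j - b) # x) ((k - j - b') # y)) m)"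
      by (rule sum.mono_neutral_cong_right) auto
    also have "\<dots> = (\<Sum>j\<le>k - (b + b'). F (\<lambda>x y. H (j # x) ((k - (b + b') - j) # y)) m)"
      by (rule sum.reindex_bij_witness[of _ "\<lambda>j. j + b" "\<lambda>j. j - b"])
        (use True in \<open>auto simp: algebra_simps\<close>)
    also have "\<dots> = F H (k # m)"
    proof (cases "\<forall>i\<in>set m. b + b' \<le> i")
      case all: True then show ?thesis using True by (simp add: F_def)
    next
      case False
      then have "F H' m = 0" for H' by (simp only: F_def if_False)
      moreover have "F H (k # m) = 0" using False unfolding F_def by (intro if_not_P) auto
      ultimately show ?thesis by simp
    qed
    finally show ?thesis .
  qed
  finally show ?case by (simp add: F_def)
qed simp

lemma prod_coeff_add_cols:
  assumes "\<forall>(b, \<beta>)\<in>set Bs. is_ptn \<beta> \<and> rows c \<beta>" "length m = c"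
  shows "prod_coeff (map (\<lambda>(b, \<beta>). add_cols c b \<beta>) Bs) m =
    (if \<forall>x\<in>set m. sum_list (map fst Bs) \<le> x then prod_coeff (map snd Bs) (map (\<lambda>x. x - sum_list (map fst Bs)) m) else 0)"
  using assms
proof (induction Bs arbitrary: m)
  case (Cons p Bs)
  obtain b \<beta> where p: "p = (b, \<beta>)" by (cases p)
  define b' where "b' = sum_list (map fst Bs)"
  have "prod_coeff (map (\<lambda>(b, \<beta>). add_cols c b \<beta>) (p # Bs)) m =
    split_sum (\<lambda>x y. if (\<forall>i\<in>set x. b \<le> i) \<and> (\<forall>i\<in>set y. b' \<le> i) then kostka \<beta> (map (\<lambda>i. i - b) x) * prod_coeff (map snd Bs) (map (\<lambda>i. i - b') y) else 0) m"
    unfolding p list.map prod_coeff.simps prod.case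
  proof (rule split_sum_cong)
    fix x y :: "nat list" assume "length x = length m" "length y = length m"
    then show "kostka (add_cols c b \<beta>) x * prod_coeff (map (\<lambda>(b, \<beta>). add_cols c b \<beta>) Bs) y =
      (if (\<forall>i\<in>set x. b \<le> i) \<and> (\<forall>i\<in>set y. b' \<le> i) then kostka \<beta> (map (\<lambda>i. i - b) x) * prod_coeff (map snd Bs) (map (\<lambda>i. i - b') y) else 0)"
      using Cons.prems Cons.IH[of y] kostka_add_cols[of \<beta> c x b] p by (simp add: b'_def)
  qed
  also have "\<dots> = (if \<forall>i\<in>set m. b + b' \<le> i then convolve (kostka \<beta>) (prod_coeff (map snd Bs)) (map (\<lambda>i. i - (b + b')) m) else 0)"
    by (rule split_sum_shift)
  finally show ?case by (simp add: p b'_def)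
qed simp

text \<open>In exactly \<open>c\<close> variables the two products differ by the \<open>b\<close>-th
  power of the product of the variables. Independence matches the shapes with \<open>b\<close> full
  columns and leaves coefficient 0 for all others, which is the second claim.\<close>

lemma
  assumes Bs: "\<forall>(b, \<beta>)\<in>set Bs. is_ptn \<beta> \<and> rows c \<beta>" and b: "b = sum_list (map fst Bs)"
  shows schur_mult_add_cols: "is_ptn \<kappa> \<Longrightarrow> rows c \<kappa> \<Longrightarrow> schur_mult (add_cols c b \<kappa>) (map (\<lambda>(b, \<beta>). add_cols c b \<beta>) Bs) = schur_mult \<kappa> (map snd Bs)"
    and schur_mult_add_cols_nz: "is_ptn \<rho> \<Longrightarrow> rows c \<rho> \<Longrightarrow> schur_mult \<rho> (map (\<lambda>(b, \<beta>). add_cols c b \<beta>) Bs) \<noteq> 0 \<Longrightarrow> i < c \<Longrightarrow> b \<le> \<rho> i"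
proof -
  define L where "L = map (\<lambda>(b, \<beta>). add_cols c b \<beta>) Bs"
  have pL: "\<forall>l\<in>set L. is_ptn l" using Bs is_ptn_add_cols by (auto simp: L_def)
  have pS: "\<forall>l\<in>set (map snd Bs). is_ptn l" using Bs by auto
  have tL: "total_weight L = c * b + total_weight (map snd Bs)"
    using Bs unfolding L_def b by (induction Bs) (auto simp: total_weight_def weight_add_cols algebra_simps)
  define E where "E = {\<kappa>\<in>Ptns (total_weight (map snd Bs)). rows c \<kappa>}"
  define S where "S = {\<rho>\<in>Ptns (total_weight L). rows c \<rho>}"
  have fin: "finite E" "finite S" by (auto simp: E_def S_def finite_Ptns)
  have sub: "S \<subseteq> {f. is_ptn f \<and> rows c f}" by (auto simp: S_def Ptns_def)
  have inj: "inj_on (add_cols c b) E" by (rule inj_onI) (auto simp: E_def intro: add_cols_inj)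
  have im: "add_cols c b ` E \<subseteq> S" by (auto simp: E_def S_def Ptns_def is_ptn_add_cols rows_add_cols weight_add_cols tL)
  have eq: "(\<Sum>e\<in>E. schur_mult e (map snd Bs) * kostka (add_cols c b e) m) = (\<Sum>s\<in>S. schur_mult s L * kostka s m)" if m: "m \<in> {m. length m = c}" for m
  proof -
    have lm: "length m = c" using m by simp
    have "(\<Sum>s\<in>S. schur_mult s L * kostka s m) = prod_coeff L m"
      unfolding prod_coeff_expansion[OF pL] S_def
      by (rule sum.mono_neutral_left[OF finite_Ptns]) (use kostka_nz(2)[of m] lm in auto)
    also have "\<dots> = (if \<forall>x\<in>set m. b \<le> x then prod_coeff (map snd Bs) (map (\<lambda>x. x - b) m) else 0)"
      unfolding L_def b by (rule prod_coeff_add_cols[OF Bs lm])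
    also have "prod_coeff (map snd Bs) (map (\<lambda>x. x - b) m) = (\<Sum>e\<in>E. schur_mult e (map snd Bs) * kostka e (map (\<lambda>x. x - b) m))"
      unfolding prod_coeff_expansion[OF pS] E_def
      by (rule sum.mono_neutral_right[OF finite_Ptns]) (use kostka_nz(2)[of "map (\<lambda>x. x - b) m"] lm in auto)
    also have "(if \<forall>x\<in>set m. b \<le> x then (\<Sum>e\<in>E. schur_mult e (map snd Bs) * kostka e (map (\<lambda>x. x - b) m)) else 0)
       = (\<Sum>e\<in>E. schur_mult e (map snd Bs) * kostka (add_cols c b e) m)"
      using lm by (auto simp: E_def Ptns_def kostka_add_cols intro!: sum.cong sum.neutral)
    finally show ?thesis by simp
  qed
  note * = indep_eq[OF indep_kostka[of c] fin(2) sub fin(1) inj im eq]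
  show "schur_mult (add_cols c b \<kappa>) (map (\<lambda>(b, \<beta>). add_cols c b \<beta>) Bs) = schur_mult \<kappa> (map snd Bs)" if \<kappa>: "is_ptn \<kappa>" "rows c \<kappa>"
  proof (cases "weight \<kappa> = total_weight (map snd Bs)")
    case True
    then have "schur_mult \<kappa> (map snd Bs) = schur_mult (add_cols c b \<kappa>) L" using \<kappa> by (intro *(1)) (auto simp: E_def Ptns_def)
    then show ?thesis by (simp add: L_def)
  next
    case False
    then have "schur_mult \<kappa> (map snd Bs) = 0" using schur_mult_size[OF pS] \<kappa> by simp
    moreover have "schur_mult (add_cols c b \<kappa>) L = 0" using False \<kappa> by (intro schur_mult_size[OF pL]) (auto simp: is_ptn_add_cols weight_add_cols tL)
    ultimately show ?thesis by (simp add: L_def)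
  qed
  show "b \<le> \<rho> i" if \<rho>: "is_ptn \<rho>" "rows c \<rho>" "schur_mult \<rho> (map (\<lambda>(b, \<beta>). add_cols c b \<beta>) Bs) \<noteq> 0" "i < c"
  proof -
    have "\<rho> \<in> S" using schur_mult_size[OF pL \<rho>(1)] \<rho> by (auto simp: S_def Ptns_def L_def)
    then have "\<rho> \<in> add_cols c b ` E" using *(2)[of \<rho>] \<rho>(3) by (auto simp: L_def)
    then show ?thesis using \<rho>(4) by (auto simp: add_cols_def)
  qed
qed

text \<open>The same division by full columns, for a Schur polynomial in two alphabets of
  \<open>a1\<close> and \<open>a2\<close> variables. The second claim concerns \<rho>2, the shape
  still to be determined when one factor is split off a product.\<close>

lemma
  assumes \<kappa>: "is_ptn \<kappa>" "rows (a1 + a2) \<kappa>"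
  shows lr_coeff_add_cols: "is_ptn \<kappa>1 \<Longrightarrow> rows a1 \<kappa>1 \<Longrightarrow> is_ptn \<kappa>2 \<Longrightarrow> rows a2 \<kappa>2 \<Longrightarrow>
      lr_coeff (add_cols (a1 + a2) d \<kappa>) (add_cols a1 d \<kappa>1) (add_cols a2 d \<kappa>2) = lr_coeff \<kappa> \<kappa>1 \<kappa>2"
    and lr_coeff_add_cols_nz: "is_ptn \<rho>1 \<Longrightarrow> rows a1 \<rho>1 \<Longrightarrow> is_ptn \<rho>2 \<Longrightarrow> rows a2 \<rho>2 \<Longrightarrow>
      lr_coeff (add_cols (a1 + a2) d \<kappa>) \<rho>1 \<rho>2 \<noteq> 0 \<Longrightarrow> i < a2 \<Longrightarrow> d \<le> \<rho>2 i"
proof -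
  define \<theta> where "\<theta> = add_cols (a1 + a2) d \<kappa>"
  define \<Phi> where "\<Phi> = (\<lambda>(\<rho>1, \<rho>2) (m1, m2). kostka \<rho>1 m1 * kostka \<rho>2 m2)"
  define A where "A = {f. is_ptn f \<and> rows a1 f} \<times> {f. is_ptn f \<and> rows a2 f}"
  define T where "T = {m::nat list. length m = a1} \<times> {m::nat list. length m = a2}"
  define E where "E n1 n2 = {(\<kappa>1, \<kappa>2). is_ptn \<kappa>1 \<and> rows a1 \<kappa>1 \<and> weight \<kappa>1 + a1 * d = n1 \<and> is_ptn \<kappa>2 \<and> rows a2 \<kappa>2 \<and> weight \<kappa>2 + a2 * d = n2}" for n1 n2
  define S where "S n1 n2 = {\<rho>\<in>Ptns n1. rows a1 \<rho>} \<times> {\<rho>\<in>Ptns n2. rows a2 \<rho>}" for n1 n2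
  define \<pi> where "\<pi> = (\<lambda>(\<kappa>1, \<kappa>2). (add_cols a1 d \<kappa>1, add_cols a2 d \<kappa>2))"
  have ind: "indep A \<Phi> T" unfolding A_def \<Phi>_def T_def by (intro indep_prod indep_kostka)
  have finE: "finite (E n1 n2)" for n1 n2
  proof (rule finite_subset)
    show "E n1 n2 \<subseteq> Ptns (n1 - a1 * d) \<times> Ptns (n2 - a2 * d)" by (auto simp: E_def Ptns_def)
  qed (simp add: finite_Ptns)
  have finS: "finite (S n1 n2)" for n1 n2 by (auto simp: S_def finite_Ptns)
  have sub: "S n1 n2 \<subseteq> A" for n1 n2 by (auto simp: S_def A_def Ptns_def)
  have inj: "inj_on \<pi> (E n1 n2)" for n1 n2
    by (rule inj_onI) (auto simp: E_def \<pi>_def intro: add_cols_inj)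
  have im: "\<pi> ` E n1 n2 \<subseteq> S n1 n2" for n1 n2
    by (auto simp: E_def S_def \<pi>_def Ptns_def is_ptn_add_cols rows_add_cols weight_add_cols)
  have eq: "(\<Sum>e\<in>E n1 n2. (\<lambda>(\<kappa>1, \<kappa>2). lr_coeff \<kappa> \<kappa>1 \<kappa>2) e * \<Phi> (\<pi> e) t) = (\<Sum>s\<in>S n1 n2. (\<lambda>(\<rho>1, \<rho>2). lr_coeff \<theta> \<rho>1 \<rho>2) s * \<Phi> s t)"
    if t: "t \<in> T" for t n1 n2
  proof -
    obtain m1 m2 where m: "t = (m1, m2)" by (cases t)
    have len: "length m1 = a1" "length m2 = a2" using t m by (auto simp: T_def)
    define g where "g = (\<lambda>x::nat. x - d)"
    have KE: "\<Phi> (\<pi> e) t = (if \<forall>x\<in>set (m1 @ m2). d \<le> x then \<Phi> e (map g m1, map g m2) else 0)" if "e \<in> E n1 n2" for e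
      using that len by (auto simp: E_def \<pi>_def \<Phi>_def m kostka_add_cols g_def)
    show ?thesis
    proof (cases "sum_list m1 = n1 \<and> sum_list m2 = n2")
      case False
      have "(\<Sum>s\<in>S n1 n2. (\<lambda>(\<rho>1, \<rho>2). lr_coeff \<theta> \<rho>1 \<rho>2) s * \<Phi> s t) = 0"
        by (rule sum.neutral) (use False in \<open>auto simp: S_def \<Phi>_def m Ptns_def kostka_sum_neq\<close>)
      moreover have "(\<Sum>e\<in>E n1 n2. (\<lambda>(\<kappa>1, \<kappa>2). lr_coeff \<kappa> \<kappa>1 \<kappa>2) e * \<Phi> (\<pi> e) t) = 0"
        by (rule sum.neutral) (use False in \<open>auto simp: E_def \<pi>_def \<Phi>_def m weight_add_cols kostka_sum_neq\<close>)
      ultimately show ?thesis by simp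
    next
      case True
      have "(\<Sum>s\<in>S n1 n2. (\<lambda>(\<rho>1, \<rho>2). lr_coeff \<theta> \<rho>1 \<rho>2) s * \<Phi> s t) = kostka \<theta> (m1 @ m2)"
        unfolding kostka_coproduct True[THEN conjunct1] True[THEN conjunct2]
      proof (rule sum.mono_neutral_cong_left)
        show "\<forall>i\<in>Ptns n1 \<times> Ptns n2 - S n1 n2. (case i of (\<rho>1, \<rho>2) \<Rightarrow> lr_coeff \<theta> \<rho>1 \<rho>2 * (kostka \<rho>1 m1 * kostka \<rho>2 m2)) = 0"
          using kostka_nz(2)[of m1] kostka_nz(2)[of m2] len by (auto simp: S_def)
      qed (auto simp: finite_Ptns S_def \<Phi>_def m)
      also have "\<dots> = (if \<forall>x\<in>set (m1 @ m2). d \<le> x then kostka \<kappa> (map g m1 @ map g m2) else 0)"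
        unfolding \<theta>_def using kostka_add_cols[OF \<kappa>, of "m1 @ m2" d] len by (simp add: g_def)
      also have "\<dots> = (if \<forall>x\<in>set (m1 @ m2). d \<le> x then (\<Sum>e\<in>E n1 n2. (\<lambda>(\<kappa>1, \<kappa>2). lr_coeff \<kappa> \<kappa>1 \<kappa>2) e * \<Phi> e (map g m1, map g m2)) else 0)"
      proof (rule if_cong[OF refl _ refl])
        assume ge: "\<forall>x\<in>set (m1 @ m2). d \<le> x"
        have sg: "sum_list (map g m) + length m * d = sum_list m" if "\<forall>x\<in>set m. d \<le> x" for m
          using that by (induction m) (auto simp: g_def)
        have s1: "sum_list (map g m1) + a1 * d = n1" "sum_list (map g m2) + a2 * d = n2"
          using sg[of m1] sg[of m2] ge len True by auto
        show "kostka \<kappa> (map g m1 @ map g m2) = (\<Sum>e\<in>E n1 n2. (\<lambda>(\<kappa>1, \<kappa>2). lr_coeff \<kappa> \<kappa>1 \<kappa>2) e * \<Phi> e (map g m1, map g m2))"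
          unfolding kostka_coproduct
        proof (rule sum.mono_neutral_cong_right)
          show "\<forall>i\<in>Ptns (sum_list (map g m1)) \<times> Ptns (sum_list (map g m2)) - E n1 n2.
             (case i of (\<rho>1, \<rho>2) \<Rightarrow> lr_coeff \<kappa> \<rho>1 \<rho>2 * (kostka \<rho>1 (map g m1) * kostka \<rho>2 (map g m2))) = 0"
            using kostka_nz(2)[of "map g m1"] kostka_nz(2)[of "map g m2"] len s1 by (auto simp: E_def Ptns_def)
          show "E n1 n2 \<subseteq> Ptns (sum_list (map g m1)) \<times> Ptns (sum_list (map g m2))"
            using s1 by (auto simp: E_def Ptns_def)
        qed (auto simp: finite_Ptns \<Phi>_def)
      qed
      also have "\<dots> = (\<Sum>e\<in>E n1 n2. (\<lambda>(\<kappa>1, \<kappa>2). lr_coeff \<kappa> \<kappa>1 \<kappa>2) e * \<Phi> (\<pi> e) t)"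
        by (cases "\<forall>x\<in>set (m1 @ m2). d \<le> x")
          (simp add: KE, simp only: KE if_False mult_zero_right sum.neutral_const cong: sum.cong)
      finally show ?thesis by simp
    qed
  qed
  note * = indep_eq[OF ind finS sub finE inj im eq]
  show "lr_coeff (add_cols (a1 + a2) d \<kappa>) (add_cols a1 d \<kappa>1) (add_cols a2 d \<kappa>2) = lr_coeff \<kappa> \<kappa>1 \<kappa>2"
    if "is_ptn \<kappa>1" "rows a1 \<kappa>1" "is_ptn \<kappa>2" "rows a2 \<kappa>2"
    using *(1)[of "(\<kappa>1, \<kappa>2)" "weight \<kappa>1 + a1 * d" "weight \<kappa>2 + a2 * d"] that by (simp add: E_def \<theta>_def \<pi>_def)
  show "d \<le> \<rho>2 i" if "is_ptn \<rho>1" "rows a1 \<rho>1" "is_ptn \<rho>2" "rows a2 \<rho>2" "lr_coeff (add_cols (a1 + a2) d \<kappa>) \<rho>1 \<rho>2 \<noteq> 0" "i < a2"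
  proof -
    have "(\<rho>1, \<rho>2) \<in> \<pi> ` E (weight \<rho>1) (weight \<rho>2)"
      using *(2)[of "(\<rho>1, \<rho>2)" "weight \<rho>1" "weight \<rho>2"] that by (auto simp: S_def Ptns_def \<theta>_def)
    then show ?thesis using that(6) by (auto simp: \<pi>_def add_cols_def)
  qed
qed

section \<open>Composed blocks\<close>

text \<open>\<open>\<mu>\<close> to the right of an \<open>a \<times> d\<close> rectangle and \<open>\<alpha>\<close> below it. Both kinds of composed
  conditions, and the conditions \<open>\<gamma>\<close>, are of this form.\<close>

definition block_shape :: "nat \<Rightarrow> nat \<Rightarrow> shape \<Rightarrow> shape \<Rightarrow> shape" where
  "block_shape a d \<mu> \<alpha> = glue a (add_cols a d \<mu>) \<alpha>"

lemma block_shape_apply: "block_shape a d \<mu> \<alpha> i = (if i < a then d + \<mu> i else \<alpha> (i - a))"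
  by (simp add: block_shape_def glue_def add_cols_def)

lemma take_rows_block_shape: "take_rows a (block_shape a d \<mu> \<alpha>) = add_cols a d \<mu>" and drop_rows_block_shape: "drop_rows a (block_shape a d \<mu> \<alpha>) = \<alpha>"
  by (auto simp: block_shape_def glue_def take_rows_def add_cols_def drop_rows_def fun_eq_iff)

lemma is_ptn_block_shape: "is_ptn \<mu> \<Longrightarrow> is_ptn \<alpha> \<Longrightarrow> \<alpha> 0 \<le> d \<Longrightarrow> is_ptn (block_shape a d \<mu> \<alpha>)"
  unfolding block_shape_def by (rule is_ptn_glue[OF is_ptn_add_cols]) (auto simp: add_cols_def)

lemma weight_block_shape: "is_ptn \<mu> \<Longrightarrow> rows a \<mu> \<Longrightarrow> is_ptn \<alpha> \<Longrightarrow> weight (block_shape a d \<mu> \<alpha>) = a * d + weight \<mu> + weight \<alpha>"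
  using weight_glue[of \<alpha> a "add_cols a d \<mu>"] take_rows_block_shape[of a d \<mu> \<alpha>] by (simp add: block_shape_def take_rows_glue weight_add_cols)

lemma block_shape_inj:
  assumes "rows a \<mu>" "rows a \<mu>'" "block_shape a d \<mu> \<alpha> = block_shape a d \<mu>' \<alpha>'" shows "\<mu> = \<mu>' \<and> \<alpha> = \<alpha>'"
  using assms add_cols_inj[OF assms(1,2), of d] take_rows_block_shape[of a d \<mu> \<alpha>] take_rows_block_shape[of a d \<mu>' \<alpha>'] drop_rows_block_shape[of a d \<mu> \<alpha>] drop_rows_block_shape[of a d \<mu>' \<alpha>']
  by simp

lemma schur_mult_Nil: "is_ptn \<kappa> \<Longrightarrow> schur_mult \<kappa> [] = of_bool (\<kappa> = (\<lambda>_. 0))"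
proof -
  assume \<kappa>: "is_ptn \<kappa>"
  have "prod_coeff [] m = (\<Sum>\<theta>\<in>Ptns 0. 1 * kostka \<theta> m)" for m by (simp add: Ptns_zero kostka_zero)
  from schur_mult_unique[OF this \<kappa>] show ?thesis
    using \<kappa> Ptns_zero by (auto simp: Ptns_def)
qed

text \<open>Repeated use of \<open>lr_coeff_bottom_bound\<close>, one factor at a time: a nonzero
  coefficient needs an intermediate shape to which the bound for the remaining factors
  applies.\<close>

lemma schur_mult_bottom_bound:
  assumes "\<forall>(a, l)\<in>set Rs. is_ptn l" "is_ptn \<theta>" "schur_mult \<theta> (map snd Rs) \<noteq> 0"
  shows "sum_list (map (\<lambda>(a, l). weight (take_rows a l)) Rs) \<le> weight (take_rows (sum_list (map fst Rs)) \<theta>)"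
  using assms
proof (induction Rs arbitrary: \<theta>)
  case (Cons p Rs)
  obtain a l where p: "p = (a, l)" by (cases p)
  have pln: "is_ptn l" "\<forall>l\<in>set (map snd Rs). is_ptn l" using Cons.prems p by auto
  have "weight \<theta> = total_weight (map snd (p # Rs))"
    using schur_mult_size[of "map snd (p # Rs)" \<theta>] Cons.prems pln p by auto
  then have \<theta>: "\<theta> \<in> Ptns (weight l + total_weight (map snd Rs))" using Cons.prems p by (simp add: Ptns_def total_weight_def)
  have "(\<Sum>\<sigma>\<in>Ptns (total_weight (map snd Rs)). lr_coeff \<theta> l \<sigma> * schur_mult \<sigma> (map snd Rs)) \<noteq> 0"
    using schur_mult_Cons[OF pln \<theta>] Cons.prems(3) p by simp
  then obtain \<sigma> where \<sigma>: "\<sigma> \<in> Ptns (total_weight (map snd Rs))" "lr_coeff \<theta> l \<sigma> \<noteq> 0" "schur_mult \<sigma> (map snd Rs) \<noteq> 0"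
    by (auto elim!: sum.not_neutral_contains_not_neutral)
  have ps: "is_ptn \<sigma>" using \<sigma>(1) by (simp add: Ptns_def)
  have "sum_list (map (\<lambda>(a, l). weight (take_rows a l)) Rs) \<le> weight (take_rows (sum_list (map fst Rs)) \<sigma>)"
    using Cons.IH[OF _ ps \<sigma>(3)] Cons.prems by auto
  moreover have "weight (take_rows a l) + weight (take_rows (sum_list (map fst Rs)) \<sigma>) \<le> weight (take_rows (a + sum_list (map fst Rs)) \<theta>)"
    by (rule lr_coeff_bottom_bound[OF Cons.prems(2) pln(1) ps \<sigma>(2)])
  ultimately show ?case by (simp add: p)
qed simp

lemma take_rows_rows: "rows a f \<Longrightarrow> take_rows a f = f"
  by (auto simp: rows_def take_rows_def)

lemma weight_zero_iff: "is_ptn f \<Longrightarrow> weight f = 0 \<longleftrightarrow> f = (\<lambda>_. 0)"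
  using Ptns_zero by (auto simp: Ptns_def)

text \<open>If each factor fits into its distinguished rows, the lower bound says that the
  corresponding first rows of \<kappa> already hold all its cells.\<close>

lemma schur_mult_rows:
  assumes "\<forall>(a, l)\<in>set Rs. is_ptn l \<and> rows a l" "is_ptn \<kappa>" "schur_mult \<kappa> (map snd Rs) \<noteq> 0"
  shows "rows (sum_list (map fst Rs)) \<kappa>"
proof -
  let ?a = "sum_list (map fst Rs)"
  have "(\<lambda>(a, l). weight (take_rows a l)) x = weight (snd x)" if "x \<in> set Rs" for x using assms(1) that take_rows_rows by auto
  then have "map (\<lambda>(a, l). weight (take_rows a l)) Rs = map (weight \<circ> snd) Rs" by auto
  then have "sum_list (map (\<lambda>(a, l). weight (take_rows a l)) Rs) = total_weight (map snd Rs)" by (simp only: total_weight_def map_map)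
  moreover have "weight \<kappa> = total_weight (map snd Rs)"
  proof (rule ccontr)
    have "\<forall>l\<in>set (map snd Rs). is_ptn l" using assms(1) by auto
    moreover assume "weight \<kappa> \<noteq> total_weight (map snd Rs)"
    ultimately show False using schur_mult_size assms(2,3) by blast
  qed
  moreover have "sum_list (map (\<lambda>(a, l). weight (take_rows a l)) Rs) \<le> weight (take_rows ?a \<kappa>)"
    by (rule schur_mult_bottom_bound) (use assms in auto)
  ultimately have "weight (drop_rows ?a \<kappa>) = 0" using weight_take_rows_drop_rows[OF assms(2), of ?a] by simp
  then have "drop_rows ?a \<kappa> = (\<lambda>_. 0)" using weight_zero_iff[OF is_ptn_drop_rows[OF assms(2)]] by simp
  then have "drop_rows ?a \<kappa> 0 = 0" by simp
  then show ?thesis using rows_zero_iff[OF assms(2)] by (simp add: drop_rows_def)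
qed

text \<open>The number is the variable side of the rectangle: its rows in \<open>row_blocks\<close>,
  where \<open>d\<close> columns are fixed, and its columns in \<open>col_blocks\<close>, where
  \<open>c\<close> rows are fixed. The first shape sits to the right of the rectangle and the second
  below it, so a column block lists \<beta> before \<nu>.\<close>

type_synonym block = "nat \<times> shape \<times> shape"

abbreviation block_sum :: "block list \<Rightarrow> nat" where "block_sum Ps \<equiv> sum_list (map fst Ps)"
abbreviation first_shapes :: "block list \<Rightarrow> shape list" where "first_shapes Ps \<equiv> map (\<lambda>(a, \<mu>, \<alpha>). \<mu>) Ps"
abbreviation second_shapes :: "block list \<Rightarrow> shape list" where "second_shapes Ps \<equiv> map (\<lambda>(a, \<mu>, \<alpha>). \<alpha>) Ps"

definition row_blocks :: "nat \<Rightarrow> block list \<Rightarrow> shape list" where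
  "row_blocks d Ps = map (\<lambda>(a, \<mu>, \<alpha>). block_shape a d \<mu> \<alpha>) Ps"

definition row_blocks_ok :: "nat \<Rightarrow> block list \<Rightarrow> bool" where
  "row_blocks_ok d Ps \<longleftrightarrow> (\<forall>(a, \<mu>, \<alpha>)\<in>set Ps. is_ptn \<mu> \<and> rows a \<mu> \<and> is_ptn \<alpha> \<and> \<alpha> 0 \<le> d)"

lemma row_blocks_is_ptn: "row_blocks_ok d Ps \<Longrightarrow> \<forall>l\<in>set (row_blocks d Ps). is_ptn l"
  by (auto simp: row_blocks_def row_blocks_ok_def intro: is_ptn_block_shape)

lemma total_weight_row_blocks: "row_blocks_ok d Ps \<Longrightarrow> total_weight (row_blocks d Ps) = block_sum Ps * d + total_weight (first_shapes Ps) + total_weight (second_shapes Ps)"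
  unfolding row_blocks_def row_blocks_ok_def by (induction Ps) (auto simp: total_weight_def weight_block_shape algebra_simps)

lemma schur_mult_row_blocks_bound:
  assumes "row_blocks_ok d Ps" "is_ptn \<theta>" "schur_mult \<theta> (row_blocks d Ps) \<noteq> 0"
  shows "block_sum Ps * d + total_weight (first_shapes Ps) \<le> weight (take_rows (block_sum Ps) \<theta>)"
proof -
  let ?R = "map (\<lambda>(a, \<mu>, \<alpha>). (a, block_shape a d \<mu> \<alpha>)) Ps"
  have s: "map snd ?R = row_blocks d Ps" "map fst ?R = map fst Ps" by (auto simp: row_blocks_def)
  have "sum_list (map (\<lambda>(a, l). weight (take_rows a l)) ?R) \<le> weight (take_rows (sum_list (map fst ?R)) \<theta>)"
  proof (rule schur_mult_bottom_bound[OF _ assms(2)])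
    show "\<forall>(a, l)\<in>set ?R. is_ptn l" using assms(1) by (auto simp: row_blocks_ok_def is_ptn_block_shape)
    show "schur_mult \<theta> (map snd ?R) \<noteq> 0" using assms(3) by (simp only: s not_False_eq_True)
  qed
  moreover have "sum_list (map (\<lambda>(a, l). weight (take_rows a l)) ?R) = block_sum Ps * d + total_weight (first_shapes Ps)"
    using assms(1) unfolding row_blocks_ok_def by (induction Ps) (auto simp: total_weight_def take_rows_block_shape weight_add_cols algebra_simps)
  ultimately show ?thesis by (simp only: s)
qed

text \<open>Induction on the list. In the sum over the shapes \<sigma> of the remaining product, the
  lower bound for \<sigma> and the upper bound imposed by \<theta> coincide. So every contributing
  \<sigma> is itself a block, all coefficients factor, and the sum becomes the product of the
  recursions for the two lists of shapes.\<close>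

lemma schur_mult_row_blocks:
  assumes "row_blocks_ok d Ps" "is_ptn \<kappa>" "rows (block_sum Ps) \<kappa>" "is_ptn \<tau>" "\<tau> 0 \<le> d" "weight \<kappa> = total_weight (first_shapes Ps)"
  shows "schur_mult (block_shape (block_sum Ps) d \<kappa> \<tau>) (row_blocks d Ps) = schur_mult \<kappa> (first_shapes Ps) * schur_mult \<tau> (second_shapes Ps)"
  using assms
proof (induction Ps arbitrary: \<kappa> \<tau>)
  case Nil
  then have "\<kappa> = (\<lambda>_. 0)" by (auto simp: rows_def)
  moreover have "block_shape 0 d \<kappa> \<tau> = \<tau>" by (auto simp: block_shape_apply)
  ultimately show ?case using schur_mult_Nil[of "\<lambda>_. 0"] by (simp add: row_blocks_def)
next
  case (Cons p Ps)
  obtain a1 \<mu> \<alpha> where p: "p = (a1, \<mu>, \<alpha>)" by (cases p)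
  define a2 where "a2 = block_sum Ps"
  define \<theta> where "\<theta> = block_shape (a1 + a2) d \<kappa> \<tau>"
  define l where "l = block_shape a1 d \<mu> \<alpha>"
  have ok: "row_blocks_ok d Ps" and \<mu>: "is_ptn \<mu>" "rows a1 \<mu>" and \<alpha>: "is_ptn \<alpha>" "\<alpha> 0 \<le> d"
    using Cons.prems(1) p by (auto simp: row_blocks_ok_def)
  have pln: "is_ptn l" using \<mu> \<alpha> by (simp add: l_def is_ptn_block_shape)
  have pR: "\<forall>l\<in>set (row_blocks d Ps). is_ptn l" by (rule row_blocks_is_ptn[OF ok])
  have pf: "\<forall>l\<in>set (first_shapes Ps). is_ptn l" "\<forall>l\<in>set (second_shapes Ps). is_ptn l" using ok by (auto simp: row_blocks_ok_def)
  have \<kappa>: "is_ptn \<kappa>" "rows (a1 + a2) \<kappa>" "weight \<kappa> = weight \<mu> + total_weight (first_shapes Ps)"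
    using Cons.prems by (auto simp: p a2_def total_weight_def)
  have \<theta>: "is_ptn \<theta>" using Cons.prems by (simp add: \<theta>_def is_ptn_block_shape)
  have w\<theta>: "weight \<theta> = (a1 + a2) * d + weight \<kappa> + weight \<tau>"
    using Cons.prems \<kappa> by (simp add: \<theta>_def weight_block_shape)
  have wl: "weight l = a1 * d + weight \<mu> + weight \<alpha>" using \<mu> \<alpha> by (simp add: l_def weight_block_shape)
  have goal: "?case \<longleftrightarrow> schur_mult \<theta> (l # row_blocks d Ps) = schur_mult \<kappa> (\<mu> # first_shapes Ps) * schur_mult \<tau> (\<alpha> # second_shapes Ps)"
    by (simp add: p a2_def \<theta>_def l_def row_blocks_def)
  show ?case
  proof (cases "weight \<tau> = weight \<alpha> + total_weight (second_shapes Ps)")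
    case False
    have "schur_mult \<tau> (\<alpha> # second_shapes Ps) = 0" using False \<alpha> pf Cons.prems by (intro schur_mult_size) (auto simp: total_weight_def)
    moreover have "schur_mult \<theta> (l # row_blocks d Ps) = 0"
      using False pR pln \<theta> w\<theta> wl \<kappa> total_weight_row_blocks[OF ok] by (intro schur_mult_size) (auto simp: total_weight_def a2_def algebra_simps)
    ultimately show ?thesis unfolding goal by simp
  next
    case w\<tau>: True
    define M where "M = total_weight (first_shapes Ps)"
    define N where "N = total_weight (second_shapes Ps)"
    have tR: "total_weight (row_blocks d Ps) = a2 * d + M + N" using total_weight_row_blocks[OF ok] by (simp add: a2_def M_def N_def)
    have \<theta>R: "\<theta> \<in> Ptns (weight l + total_weight (row_blocks d Ps))"
      using \<theta> w\<theta> wl tR \<kappa> w\<tau> by (simp add: Ptns_def M_def N_def algebra_simps)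
    define Q where "Q = {\<kappa>\<in>Ptns M. rows a2 \<kappa>} \<times> {\<tau>\<in>Ptns N. \<tau> 0 \<le> d}"
    define \<pi> where "\<pi> = (\<lambda>(\<kappa>, \<tau>). block_shape a2 d \<kappa> \<tau>)"
    have finQ: "finite Q" by (simp add: Q_def finite_Ptns)
    have inj: "inj_on \<pi> Q"
      by (rule inj_onI) (auto simp: \<pi>_def Q_def dest: block_shape_inj)
    have im: "\<pi> ` Q \<subseteq> Ptns (total_weight (row_blocks d Ps))"
      by (auto simp: \<pi>_def Q_def Ptns_def is_ptn_block_shape weight_block_shape tR)
    have tkl: "weight (take_rows a1 l) = a1 * d + weight \<mu>" "take_rows a1 l = add_cols a1 d \<mu>" "drop_rows a1 l = \<alpha>" using \<mu> by (simp_all add: l_def take_rows_block_shape drop_rows_block_shape weight_add_cols)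
    have take_rows\<theta>: "weight (take_rows (a1 + a2) \<theta>) = (a1 + a2) * d + weight \<kappa>" "take_rows (a1 + a2) \<theta> = add_cols (a1 + a2) d \<kappa>" "drop_rows (a1 + a2) \<theta> = \<tau>"
      using \<kappa> by (simp_all add: \<theta>_def take_rows_block_shape drop_rows_block_shape weight_add_cols)
    have fac: "lr_coeff \<theta> l \<sigma> = lr_coeff (add_cols (a1 + a2) d \<kappa>) (add_cols a1 d \<mu>) (take_rows a2 \<sigma>) * lr_coeff \<tau> \<alpha> (drop_rows a2 \<sigma>)"
      if \<sigma>: "\<sigma> \<in> Ptns (total_weight (row_blocks d Ps))" and w: "weight (take_rows a2 \<sigma>) = a2 * d + M" for \<sigma>
    proof -
      have "lr_coeff \<theta> l \<sigma> = lr_coeff (take_rows (a1 + a2) \<theta>) (take_rows a1 l) (take_rows a2 \<sigma>) * lr_coeff (drop_rows (a1 + a2) \<theta>) (drop_rows a1 l) (drop_rows a2 \<sigma>)"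
        by (rule lr_coeff_bottom_factor[OF \<theta> pln])
          (use \<sigma> w \<theta>R \<kappa>(3) in \<open>auto simp: Ptns_def tkl(1) take_rows\<theta>(1) M_def algebra_simps\<close>)
      then show ?thesis by (simp add: tkl(2,3) take_rows\<theta>(2,3))
    qed
    \<comment> \<open>Symmetry of the coefficient puts \<tau>2 inside \<tau>, hence its first row
      within the \<open>d\<close> columns that a block allows below its rectangle.\<close>
    have lr_coeff_le: "\<tau>2 0 \<le> d" if "is_ptn \<tau>2" "lr_coeff \<tau> \<alpha> \<tau>2 \<noteq> 0" for \<tau>2
      using lr_coeff_nz(2)[of \<tau>2 \<alpha> \<tau> 0] lr_coeff_commute[OF \<alpha>(1) that(1)] that \<alpha> Cons.prems(5) by simp
    have nz: "\<sigma> \<in> \<pi> ` Q" if \<sigma>: "\<sigma> \<in> Ptns (total_weight (row_blocks d Ps))" "lr_coeff \<theta> l \<sigma> * schur_mult \<sigma> (row_blocks d Ps) \<noteq> 0" for \<sigma>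
    proof -
      have ps: "is_ptn \<sigma>" using \<sigma> by (simp add: Ptns_def)
      have "a2 * d + M \<le> weight (take_rows a2 \<sigma>)" using schur_mult_row_blocks_bound[OF ok ps] \<sigma>(2) by (simp add: a2_def M_def)
      moreover have "weight (take_rows a1 l) + weight (take_rows a2 \<sigma>) \<le> weight (take_rows (a1 + a2) \<theta>)"
        by (rule lr_coeff_bottom_bound[OF \<theta> pln ps]) (use \<sigma>(2) in auto)
      \<comment> \<open>The lower bound from the remaining blocks meets the upper bound from
        \<theta>; this is the extreme case in which \<open>fac\<close> applies.\<close>
      ultimately have w: "weight (take_rows a2 \<sigma>) = a2 * d + M"
        using \<kappa>(3) by (simp add: tkl(1) take_rows\<theta>(1) M_def algebra_simps)
      have f: "lr_coeff (add_cols (a1 + a2) d \<kappa>) (add_cols a1 d \<mu>) (take_rows a2 \<sigma>) \<noteq> 0" "lr_coeff \<tau> \<alpha> (drop_rows a2 \<sigma>) \<noteq> 0"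
        using fac[OF \<sigma>(1) w] \<sigma>(2) by auto
      have "d \<le> take_rows a2 \<sigma> i" if "i < a2" for i
        by (rule lr_coeff_add_cols_nz[OF \<kappa>(1,2) is_ptn_add_cols[OF \<mu>(1)] rows_add_cols is_ptn_take_rows[OF ps] rows_take_rows f(1) that])
      then obtain \<kappa>2 where \<kappa>2: "is_ptn \<kappa>2" "rows a2 \<kappa>2" "take_rows a2 \<sigma> = add_cols a2 d \<kappa>2"
        using add_cols_exists[OF is_ptn_take_rows[OF ps] rows_take_rows] by blast
      have e: "\<sigma> = block_shape a2 d \<kappa>2 (drop_rows a2 \<sigma>)" unfolding block_shape_def \<kappa>2(3)[symmetric] by (simp add: glue_take_rows_drop_rows)
      have "weight \<kappa>2 = M" using w \<kappa>2 by (simp add: weight_add_cols)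
      moreover have "weight (drop_rows a2 \<sigma>) = N" using weight_take_rows_drop_rows[OF ps, of a2] w \<sigma>(1) tR by (simp add: Ptns_def)
      ultimately have "(\<kappa>2, drop_rows a2 \<sigma>) \<in> Q"
        using \<kappa>2 lr_coeff_le[OF is_ptn_drop_rows[OF ps] f(2)] is_ptn_drop_rows[OF ps] by (simp add: Q_def Ptns_def)
      then show ?thesis using e by (auto simp: \<pi>_def image_iff intro!: bexI[of _ "(\<kappa>2, drop_rows a2 \<sigma>)"])
    qed
    have "schur_mult \<theta> (l # row_blocks d Ps) = (\<Sum>\<sigma>\<in>Ptns (total_weight (row_blocks d Ps)). lr_coeff \<theta> l \<sigma> * schur_mult \<sigma> (row_blocks d Ps))"
      by (rule schur_mult_Cons[OF pln pR \<theta>R])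
    also have "\<dots> = (\<Sum>\<sigma>\<in>\<pi> ` Q. lr_coeff \<theta> l \<sigma> * schur_mult \<sigma> (row_blocks d Ps))"
      by (rule sum.mono_neutral_right[OF finite_Ptns im]) (use nz in blast)
    also have "\<dots> = (\<Sum>q\<in>Q. lr_coeff \<theta> l (\<pi> q) * schur_mult (\<pi> q) (row_blocks d Ps))"
      by (simp add: sum.reindex[OF inj])
    also have "\<dots> = (\<Sum>(\<kappa>2, \<tau>2)\<in>Q. (lr_coeff \<kappa> \<mu> \<kappa>2 * schur_mult \<kappa>2 (first_shapes Ps)) * (lr_coeff \<tau> \<alpha> \<tau>2 * schur_mult \<tau>2 (second_shapes Ps)))"
    proof (rule sum.cong[OF refl])
      fix q assume q: "q \<in> Q"
      obtain \<kappa>2 \<tau>2 where q2: "q = (\<kappa>2, \<tau>2)" by (cases q)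
      have h: "is_ptn \<kappa>2" "rows a2 \<kappa>2" "weight \<kappa>2 = M" "is_ptn \<tau>2" "\<tau>2 0 \<le> d" using q q2 by (auto simp: Q_def Ptns_def)
      have "\<pi> q \<in> Ptns (total_weight (row_blocks d Ps))" using im q by auto
      then have "lr_coeff \<theta> l (\<pi> q) = lr_coeff (add_cols (a1 + a2) d \<kappa>) (add_cols a1 d \<mu>) (add_cols a2 d \<kappa>2) * lr_coeff \<tau> \<alpha> \<tau>2"
        using fac[of "\<pi> q"] h by (simp add: \<pi>_def q2 take_rows_block_shape drop_rows_block_shape weight_add_cols)
      moreover have "lr_coeff (add_cols (a1 + a2) d \<kappa>) (add_cols a1 d \<mu>) (add_cols a2 d \<kappa>2) = lr_coeff \<kappa> \<mu> \<kappa>2"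
        by (rule lr_coeff_add_cols[OF \<kappa>(1,2) \<mu> h(1,2)])
      moreover have "schur_mult (\<pi> q) (row_blocks d Ps) = schur_mult \<kappa>2 (first_shapes Ps) * schur_mult \<tau>2 (second_shapes Ps)"
        using Cons.IH[OF ok h(1) _ h(4,5)] h by (simp add: \<pi>_def q2 a2_def M_def)
      ultimately show "lr_coeff \<theta> l (\<pi> q) * schur_mult (\<pi> q) (row_blocks d Ps) = (case q of (\<kappa>2, \<tau>2) \<Rightarrow> (lr_coeff \<kappa> \<mu> \<kappa>2 * schur_mult \<kappa>2 (first_shapes Ps)) * (lr_coeff \<tau> \<alpha> \<tau>2 * schur_mult \<tau>2 (second_shapes Ps)))"
        by (simp add: q2)
    qed
    also have "\<dots> = (\<Sum>\<kappa>2\<in>{\<kappa>\<in>Ptns M. rows a2 \<kappa>}. lr_coeff \<kappa> \<mu> \<kappa>2 * schur_mult \<kappa>2 (first_shapes Ps)) * (\<Sum>\<tau>2\<in>{\<tau>\<in>Ptns N. \<tau> 0 \<le> d}. lr_coeff \<tau> \<alpha> \<tau>2 * schur_mult \<tau>2 (second_shapes Ps))"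
      unfolding sum_product sum.cartesian_product Q_def ..
    \<comment> \<open>The restrictions in \<open>Q\<close> hold for every nonvanishing term, on
      \<kappa>2 by \<open>schur_mult_rows\<close> and on \<tau>2 by \<open>lr_coeff_le\<close>.
      Dropping them turns the two sums into the recursion \<open>schur_mult_Cons\<close>.\<close>
    also have "(\<Sum>\<kappa>2\<in>{\<kappa>\<in>Ptns M. rows a2 \<kappa>}. lr_coeff \<kappa> \<mu> \<kappa>2 * schur_mult \<kappa>2 (first_shapes Ps)) = schur_mult \<kappa> (\<mu> # first_shapes Ps)"
    proof -
      have "rows a2 \<kappa>2" if "\<kappa>2 \<in> Ptns M" "schur_mult \<kappa>2 (first_shapes Ps) \<noteq> 0" for \<kappa>2
      proof -
        let ?R = "map (\<lambda>(a, \<mu>, \<alpha>). (a, \<mu>)) Ps"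
        have s: "map snd ?R = first_shapes Ps" "map fst ?R = map fst Ps" by auto
        have "rows (sum_list (map fst ?R)) \<kappa>2"
        proof (rule schur_mult_rows)
          show "\<forall>(a, l)\<in>set ?R. is_ptn l \<and> rows a l" using ok by (auto simp: row_blocks_ok_def)
          show "is_ptn \<kappa>2" using that by (simp add: Ptns_def)
          show "schur_mult \<kappa>2 (map snd ?R) \<noteq> 0" using that by (simp only: s not_False_eq_True)
        qed
        then show ?thesis by (simp only: s a2_def)
      qed
      then show ?thesis
        unfolding schur_mult_Cons[OF \<mu>(1) pf(1), of \<kappa>, unfolded Ptns_def mem_Collect_eq, OF conjI, OF \<kappa>(1,3), folded Ptns_def] M_def[symmetric]
        by (intro sum.mono_neutral_left[OF finite_Ptns]) auto
    qed
    also have "(\<Sum>\<tau>2\<in>{\<tau>\<in>Ptns N. \<tau> 0 \<le> d}. lr_coeff \<tau> \<alpha> \<tau>2 * schur_mult \<tau>2 (second_shapes Ps)) = schur_mult \<tau> (\<alpha> # second_shapes Ps)"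
    proof -
      have "\<tau> \<in> Ptns (weight \<alpha> + total_weight (second_shapes Ps))" using Cons.prems w\<tau> by (simp add: Ptns_def)
      then have "schur_mult \<tau> (\<alpha> # second_shapes Ps) = (\<Sum>\<sigma>\<in>Ptns N. lr_coeff \<tau> \<alpha> \<sigma> * schur_mult \<sigma> (second_shapes Ps))"
        unfolding N_def by (rule schur_mult_Cons[OF \<alpha>(1) pf(2)])
      also have "\<dots> = (\<Sum>\<tau>2\<in>{\<tau>\<in>Ptns N. \<tau> 0 \<le> d}. lr_coeff \<tau> \<alpha> \<tau>2 * schur_mult \<tau>2 (second_shapes Ps))"
        by (rule sum.mono_neutral_right[OF finite_Ptns]) (use lr_coeff_le in \<open>auto simp: Ptns_def\<close>)
      finally show ?thesis by simp
    qed
    finally show ?thesis unfolding goal .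
  qed
qed

section \<open>Products of column blocks\<close>

definition col_blocks_ok :: "nat \<Rightarrow> block list \<Rightarrow> bool" where
  "col_blocks_ok c Qs \<longleftrightarrow> (\<forall>(b, \<beta>, \<nu>)\<in>set Qs. is_ptn \<beta> \<and> rows c \<beta> \<and> is_ptn \<nu> \<and> \<nu> 0 \<le> b)"

definition col_blocks :: "nat \<Rightarrow> block list \<Rightarrow> shape list" where
  "col_blocks c Qs = map (\<lambda>(b, \<beta>, \<nu>). block_shape c b \<beta> \<nu>) Qs"

lemma col_blocks_is_ptn: "col_blocks_ok c Qs \<Longrightarrow> \<forall>l\<in>set (col_blocks c Qs). is_ptn l"
  by (auto simp: col_blocks_def col_blocks_ok_def intro: is_ptn_block_shape)

lemma total_weight_col_blocks: "col_blocks_ok c Qs \<Longrightarrow> total_weight (col_blocks c Qs) = c * block_sum Qs + total_weight (first_shapes Qs) + total_weight (second_shapes Qs)"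
  unfolding col_blocks_def col_blocks_ok_def by (induction Qs) (auto simp: total_weight_def weight_block_shape algebra_simps)

lemma col_blocks_take_rows_drop_rows:
  "map (take_rows c) (col_blocks c Qs) = map (\<lambda>(b, \<beta>). add_cols c b \<beta>) (map (\<lambda>(b, \<beta>, \<nu>). (b, \<beta>)) Qs)"
  "map (drop_rows c) (col_blocks c Qs) = second_shapes Qs"
  by (auto simp: col_blocks_def take_rows_block_shape drop_rows_block_shape)

lemma total_weight_take_rows_col_blocks: "col_blocks_ok c Qs \<Longrightarrow> total_weight (map (take_rows c) (col_blocks c Qs)) = c * block_sum Qs + total_weight (first_shapes Qs)"
  unfolding col_blocks_take_rows_drop_rows col_blocks_ok_def by (induction Qs) (auto simp: total_weight_def weight_add_cols algebra_simps)

lemma schur_mult_col_blocks_bound: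
  assumes "col_blocks_ok c Qs" "is_ptn \<eta>" "schur_mult \<eta> (col_blocks c Qs) \<noteq> 0"
  shows "weight (take_rows c \<eta>) \<le> c * block_sum Qs + total_weight (first_shapes Qs)"
  using schur_mult_top_bound[OF col_blocks_is_ptn[OF assms(1)] assms(2,3), of c] total_weight_take_rows_col_blocks[OF assms(1)] by simp

text \<open>In the extreme case both factors of the factorization are nonzero. The one for the first
  \<open>c\<close> rows forces the full columns; the one for the rest bounds its width.\<close>

lemma schur_mult_col_blocks_nz:
  assumes ok: "col_blocks_ok c Qs" and \<eta>: "is_ptn \<eta>" and nz: "schur_mult \<eta> (col_blocks c Qs) \<noteq> 0"
    and w: "weight (take_rows c \<eta>) = c * block_sum Qs + total_weight (first_shapes Qs)"
  shows "i < c \<Longrightarrow> block_sum Qs \<le> \<eta> i" and "\<eta> c \<le> block_sum Qs"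
proof -
  let ?B = "map (\<lambda>(b, \<beta>, \<nu>). (b, \<beta>)) Qs"
  have "schur_mult \<eta> (col_blocks c Qs) = schur_mult (take_rows c \<eta>) (map (take_rows c) (col_blocks c Qs)) * schur_mult (drop_rows c \<eta>) (map (drop_rows c) (col_blocks c Qs))"
    by (rule schur_mult_top_factor[OF col_blocks_is_ptn[OF ok] \<eta>]) (use w total_weight_take_rows_col_blocks[OF ok] in simp)
  then have n1: "schur_mult (take_rows c \<eta>) (map (\<lambda>(b, \<beta>). add_cols c b \<beta>) ?B) \<noteq> 0" and n2: "schur_mult (drop_rows c \<eta>) (second_shapes Qs) \<noteq> 0"
    using nz unfolding col_blocks_take_rows_drop_rows by auto
  have b: "block_sum Qs = sum_list (map fst ?B)" by (rule arg_cong[of _ _ sum_list]) auto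
  have ok': "\<forall>(b, \<beta>)\<in>set ?B. is_ptn \<beta> \<and> rows c \<beta>" using ok by (auto simp: col_blocks_ok_def)
  show "block_sum Qs \<le> \<eta> i" if "i < c"
    using schur_mult_add_cols_nz[OF ok' b is_ptn_take_rows[OF \<eta>] rows_take_rows n1 that] that by (simp add: take_rows_def)
  \<comment> \<open>The top bound with a single distinguished row: the first row of the rest is at
    most the sum of the first rows of the shapes \<nu>, each bounded by its number of
    columns.\<close>
  have "weight (take_rows 1 (drop_rows c \<eta>)) \<le> total_weight (map (take_rows 1) (second_shapes Qs))"
    by (rule schur_mult_top_bound[OF _ is_ptn_drop_rows[OF \<eta>] n2]) (use ok in \<open>auto simp: col_blocks_ok_def\<close>)
  also have "\<dots> \<le> block_sum Qs"
    using ok unfolding col_blocks_ok_def by (induction Qs) (auto simp: total_weight_def weight_take_rows)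
  finally show "\<eta> c \<le> block_sum Qs" by (simp add: weight_take_rows drop_rows_def)
qed

lemma schur_mult_col_blocks:
  assumes ok: "col_blocks_ok c Qs" and \<tau>: "is_ptn \<tau>" "rows c \<tau>" "weight \<tau> = total_weight (first_shapes Qs)" and \<kappa>: "is_ptn \<kappa>" "\<kappa> 0 \<le> block_sum Qs"
  shows "schur_mult (block_shape c (block_sum Qs) \<tau> \<kappa>) (col_blocks c Qs) = schur_mult \<tau> (first_shapes Qs) * schur_mult \<kappa> (second_shapes Qs)"
proof -
  let ?B = "map (\<lambda>(b, \<beta>, \<nu>). (b, \<beta>)) Qs"
  have b: "block_sum Qs = sum_list (map fst ?B)" by (rule arg_cong[of _ _ sum_list]) auto
  have ok': "\<forall>(b, \<beta>)\<in>set ?B. is_ptn \<beta> \<and> rows c \<beta>" using ok by (auto simp: col_blocks_ok_def)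
  have s: "map snd ?B = first_shapes Qs" by auto
  have "schur_mult (block_shape c (block_sum Qs) \<tau> \<kappa>) (col_blocks c Qs) = schur_mult (add_cols c (block_sum Qs) \<tau>) (map (take_rows c) (col_blocks c Qs)) * schur_mult \<kappa> (map (drop_rows c) (col_blocks c Qs))"
    using schur_mult_top_factor[OF col_blocks_is_ptn[OF ok] is_ptn_block_shape[OF \<tau>(1) \<kappa>], of c] \<tau> total_weight_take_rows_col_blocks[OF ok]
    by (simp add: take_rows_block_shape drop_rows_block_shape weight_add_cols)
  also have "schur_mult (add_cols c (block_sum Qs) \<tau>) (map (take_rows c) (col_blocks c Qs)) = schur_mult \<tau> (first_shapes Qs)"
    using schur_mult_add_cols[OF ok' b \<tau>(1,2)] unfolding col_blocks_take_rows_drop_rows s .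
  finally show ?thesis by (simp only: col_blocks_take_rows_drop_rows)
qed

text \<open>The block fills the \<open>a\<close> by \<open>d\<close> corner, has \<kappa> in the
  \<open>a\<close> by \<open>b\<close> rectangle to its right and \<tau> in the \<open>c\<close> by
  \<open>d\<close> rectangle below, and leaves the \<open>c\<close> by \<open>b\<close> corner
  empty. After a half turn of the complement that empty corner is the full one, with the complement
  of \<tau> to its right and that of \<kappa> below.\<close>

lemma box_compl_block_shape:
  assumes "inbox a b \<kappa>" "inbox c d \<tau>"
  shows "box_compl (a + c) (b + d) (block_shape a d \<kappa> \<tau>) = block_shape c b (box_compl c d \<tau>) (box_compl a b \<kappa>)"
proof
  fix i
  consider "i < c" | "c \<le> i" "i < a + c" | "a + c \<le> i" by linarith
  then show "box_compl (a + c) (b + d) (block_shape a d \<kappa> \<tau>) i = block_shape c b (box_compl c d \<tau>) (box_compl a b \<kappa>) i"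
  proof cases
    case 1
    then have "a + c - 1 - i - a = c - 1 - i" "\<not> a + c - 1 - i < a" by auto
    then show ?thesis using 1 inbox_le[OF assms(2), of "c - 1 - i"] by (simp add: box_compl_def block_shape_apply)
  next
    case 2
    then have "a + c - 1 - i = a - 1 - (i - c)" "a + c - 1 - i < a" "i - c < a" by auto
    then show ?thesis using 2 by (simp add: box_compl_def block_shape_apply)
  next
    case 3 then show ?thesis by (simp add: box_compl_def block_shape_apply)
  qed
qed

lemma schur_mult_composition:
  assumes P: "row_blocks_ok d Ps" and Q: "col_blocks_ok c Qs" and c: "0 < c"
    and a: "block_sum Ps = a" and b: "block_sum Qs = b"
    and ab: "total_weight (first_shapes Ps) + total_weight (second_shapes Qs) = a * b"
    and cd: "total_weight (second_shapes Ps) + total_weight (first_shapes Qs) = c * d"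
  shows "schur_mult (box (a + c) (b + d)) (row_blocks d Ps @ col_blocks c Qs) =
    schur_mult (box a b) (first_shapes Ps @ second_shapes Qs) * schur_mult (box c d) (second_shapes Ps @ first_shapes Qs)"
proof -
  define M where "M = total_weight (first_shapes Ps)"
  define N where "N = total_weight (second_shapes Ps)"
  have tP: "total_weight (row_blocks d Ps) = a * d + M + N" using total_weight_row_blocks[OF P] a by (simp add: M_def N_def)
  have tQ: "total_weight (col_blocks c Qs) = c * b + total_weight (first_shapes Qs) + total_weight (second_shapes Qs)" using total_weight_col_blocks[OF Q] b by simp
  have sz: "total_weight (row_blocks d Ps) + total_weight (col_blocks c Qs) = (a + c) * (b + d)"
    using ab cd tP tQ by (simp add: M_def N_def algebra_simps)
  define \<Theta> where "\<Theta> = {\<theta>\<in>Ptns (a * d + M + N). inbox (a + c) (b + d) \<theta>}"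
  define A where "A = {\<kappa>\<in>Ptns M. inbox a b \<kappa>}"
  define B where "B = {\<tau>\<in>Ptns N. inbox c d \<tau>}"
  define \<pi> where "\<pi> = (\<lambda>(\<kappa>, \<tau>). block_shape a d \<kappa> \<tau>)"
  have okP: "\<forall>l\<in>set (first_shapes Ps). is_ptn l" "\<forall>l\<in>set (second_shapes Ps). is_ptn l" using P by (auto simp: row_blocks_ok_def)
  have okQ: "\<forall>l\<in>set (first_shapes Qs). is_ptn l" "\<forall>l\<in>set (second_shapes Qs). is_ptn l" using Q by (auto simp: col_blocks_ok_def)
  have inj: "inj_on \<pi> (A \<times> B)"
    by (rule inj_onI) (auto simp: \<pi>_def A_def B_def dest: block_shape_inj[OF inbox_rows inbox_rows])
  have im: "\<pi> ` (A \<times> B) \<subseteq> \<Theta>"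
  proof
    fix \<theta> assume "\<theta> \<in> \<pi> ` (A \<times> B)"
    then obtain \<kappa> \<tau> where k: "\<kappa> \<in> A" "\<tau> \<in> B" "\<theta> = block_shape a d \<kappa> \<tau>" by (auto simp: \<pi>_def)
    have "inbox (a + c) (b + d) \<theta>" unfolding inbox_def
    proof
      fix i show "\<theta> i \<le> box (a + c) (b + d) i"
      proof (cases "i < a")
        case True then show ?thesis using inbox_le[of a b \<kappa> i] k by (simp add: block_shape_apply box_def A_def)
      next
        case False
        have "\<tau> (i - a) \<le> box c d (i - a)" using k by (simp add: B_def inbox_def)
        then show ?thesis using False k by (auto simp: block_shape_apply box_def split: if_splits)
      qed
    qed
    moreover have "\<tau> 0 \<le> d" using k inbox_le[of c d \<tau> 0] by (simp add: B_def)
    ultimately show "\<theta> \<in> \<Theta>"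
      using k inbox_rows[of a b \<kappa>] by (auto simp: \<Theta>_def A_def B_def Ptns_def is_ptn_block_shape weight_block_shape)
  qed
  have nz: "\<theta> \<in> \<pi> ` (A \<times> B)"
    if \<theta>: "\<theta> \<in> \<Theta>" "schur_mult \<theta> (row_blocks d Ps) * schur_mult (box_compl (a + c) (b + d) \<theta>) (col_blocks c Qs) \<noteq> 0" for \<theta>
  proof -
    define \<eta> where "\<eta> = box_compl (a + c) (b + d) \<theta>"
    have p\<theta>: "is_ptn \<theta>" "inbox (a + c) (b + d) \<theta>" "weight \<theta> = a * d + M + N" using \<theta>(1) by (auto simp: \<Theta>_def Ptns_def)
    have p\<eta>: "is_ptn \<eta>" using p\<theta> by (simp add: \<eta>_def is_ptn_box_compl)
    have le: "\<theta> i \<le> b + d" for i by (rule inbox_le[OF p\<theta>(2)])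
    have w1: "a * d + M \<le> weight (take_rows a \<theta>)" using schur_mult_row_blocks_bound[OF P p\<theta>(1)] \<theta>(2) by (simp add: a M_def)
    have w2: "weight (take_rows c \<eta>) \<le> c * b + total_weight (first_shapes Qs)"
      using schur_mult_col_blocks_bound[OF Q p\<eta>] \<theta>(2) by (simp add: b \<eta>_def)
    \<comment> \<open>The first \<open>c\<close> rows of \<eta> are the complements, in reverse
      order, of the last \<open>c\<close> rows of \<theta>.\<close>
    have wtk: "weight (take_rows c \<eta>) + weight (drop_rows a \<theta>) = c * (b + d)"
    proof -
      have "rows c (drop_rows a \<theta>)" using inbox_rows[OF p\<theta>(2)] by (auto simp: rows_def drop_rows_def)
      then have "weight (drop_rows a \<theta>) = (\<Sum>i<c. \<theta> (i + a))" by (simp add: weight_rows drop_rows_def)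
      also have "\<dots> = (\<Sum>i<c. \<theta> (c - Suc i + a))" by (rule sum.nat_diff_reindex[symmetric])
      also have "\<dots> = (\<Sum>i<c. \<theta> (a + c - 1 - i))" by (rule sum.cong) (auto intro!: arg_cong[of _ _ \<theta>])
      finally have "weight (take_rows c \<eta>) + weight (drop_rows a \<theta>) = (\<Sum>i<c. \<eta> i + \<theta> (a + c - 1 - i))"
        by (simp add: weight_take_rows sum.distrib)
      also have "\<dots> = (\<Sum>i<c. b + d)" by (rule sum.cong) (use le in \<open>auto simp: \<eta>_def box_compl_def\<close>)
      finally show ?thesis by simp
    qed
    have "weight (take_rows a \<theta>) + weight (drop_rows a \<theta>) = a * d + M + N" using weight_take_rows_drop_rows[OF p\<theta>(1), of a] p\<theta>(3) by simp
    \<comment> \<open>The rows of \<theta> from \<open>a\<close> on hold at most \<open>N\<close>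
      cells by \<open>w1\<close>, and at least \<open>N\<close> by \<open>w2\<close>,
      \<open>wtk\<close> and \<open>cd\<close>, so all these inequalities are equalities.\<close>
    then have w3: "weight (take_rows a \<theta>) = a * d + M" "weight (drop_rows a \<theta>) = N" and w4: "weight (take_rows c \<eta>) = c * b + total_weight (first_shapes Qs)"
      using w1 w2 wtk cd by (auto simp: N_def algebra_simps)
    have q: "i < c \<Longrightarrow> b \<le> \<eta> i" "\<eta> c \<le> b" for i
      using schur_mult_col_blocks_nz(1)[OF Q p\<eta>, of i] schur_mult_col_blocks_nz(2)[OF Q p\<eta>] \<theta>(2) w4 by (auto simp: \<eta>_def b)
    \<comment> \<open>Row \<open>c - 1\<close> of \<eta> exists because \<open>c\<close> is
      positive, and it is the complement of row \<open>a\<close> of \<theta>. Its length is at least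
      \<open>b\<close>, which leaves at most \<open>d\<close> for \<theta>.\<close>
    have ta: "\<theta> a \<le> d"
    proof -
      have "\<eta> (c - 1) = b + d - \<theta> a" using c by (simp add: \<eta>_def box_compl_def)
      then show ?thesis using q(1)[of "c - 1"] le[of a] c by simp
    qed
    \<comment> \<open>Row \<open>c\<close> of \<eta> is the complement of row \<open>a - 1\<close>
      of \<theta> and has length at most \<open>b\<close>, so row \<open>a - 1\<close>, and with it
      every earlier row, reaches \<open>d\<close>.\<close>
    have ge: "d \<le> \<theta> i" if "i < a" for i
    proof -
      have "\<eta> c = b + d - \<theta> (a - 1)" using that by (simp add: \<eta>_def box_compl_def)
      then have "d \<le> \<theta> (a - 1)" using q(2) by linarith
      also have "\<theta> (a - 1) \<le> \<theta> i" using that by (intro is_ptn_mono[OF p\<theta>(1)]) simp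
      finally show ?thesis .
    qed
    obtain \<kappa> where \<kappa>: "is_ptn \<kappa>" "rows a \<kappa>" "take_rows a \<theta> = add_cols a d \<kappa>"
      by (rule add_cols_exists[OF is_ptn_take_rows[OF p\<theta>(1)] rows_take_rows, of a d]) (use ge in \<open>auto simp: take_rows_def\<close>)
    have e: "\<theta> = block_shape a d \<kappa> (drop_rows a \<theta>)" unfolding block_shape_def \<kappa>(3)[symmetric] by (simp add: glue_take_rows_drop_rows)
    have "inbox a b \<kappa>" unfolding inbox_def
    proof
      fix i show "\<kappa> i \<le> box a b i"
      proof (cases "i < a")
        case True
        then have "\<theta> i = d + \<kappa> i" using e block_shape_apply[of a d \<kappa> "drop_rows a \<theta>" i] by simp
        then show ?thesis using le[of i] True by (simp add: box_def)
      qed (use \<kappa> in \<open>simp add: rows_def\<close>)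
    qed
    moreover have "inbox c d (drop_rows a \<theta>)" unfolding inbox_def
    proof
      fix i
      have "\<theta> (i + a) \<le> \<theta> a" by (rule is_ptn_mono[OF p\<theta>(1)]) simp
      moreover have "c \<le> i \<Longrightarrow> \<theta> (i + a) = 0" using inbox_rows[OF p\<theta>(2)] by (simp add: rows_def)
      ultimately show "drop_rows a \<theta> i \<le> box c d i" using ta by (auto simp: drop_rows_def box_def)
    qed
    moreover have "weight \<kappa> = M" using w3(1) \<kappa> by (simp add: weight_add_cols)
    ultimately have "(\<kappa>, drop_rows a \<theta>) \<in> A \<times> B" using \<kappa> w3 is_ptn_drop_rows[OF p\<theta>(1)] by (simp add: A_def B_def Ptns_def)
    then show ?thesis using e unfolding \<pi>_def by (metis (no_types, lifting) case_prod_conv image_eqI)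
  qed
  have "schur_mult (box (a + c) (b + d)) (row_blocks d Ps @ col_blocks c Qs)
      = (\<Sum>\<theta>\<in>\<Theta>. schur_mult \<theta> (row_blocks d Ps) * schur_mult (box_compl (a + c) (b + d) \<theta>) (col_blocks c Qs))"
    unfolding \<Theta>_def tP[symmetric]
    by (rule schur_mult_box[OF _ sz]) (use row_blocks_is_ptn[OF P] col_blocks_is_ptn[OF Q] in auto)
  also have "\<dots> = (\<Sum>\<theta>\<in>\<pi> ` (A \<times> B). schur_mult \<theta> (row_blocks d Ps) * schur_mult (box_compl (a + c) (b + d) \<theta>) (col_blocks c Qs))"
    by (rule sum.mono_neutral_right[OF _ im]) (use nz in \<open>auto simp: \<Theta>_def finite_Ptns\<close>)
  also have "\<dots> = (\<Sum>p\<in>A \<times> B. schur_mult (\<pi> p) (row_blocks d Ps) * schur_mult (box_compl (a + c) (b + d) (\<pi> p)) (col_blocks c Qs))"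
    by (simp add: sum.reindex[OF inj])
  also have "\<dots> = (\<Sum>(\<kappa>, \<tau>)\<in>A \<times> B. (schur_mult \<kappa> (first_shapes Ps) * schur_mult (box_compl a b \<kappa>) (second_shapes Qs)) * (schur_mult \<tau> (second_shapes Ps) * schur_mult (box_compl c d \<tau>) (first_shapes Qs)))"
  proof (rule sum.cong[OF refl])
    fix p assume p: "p \<in> A \<times> B"
    obtain \<kappa> \<tau> where k: "p = (\<kappa>, \<tau>)" by (cases p)
    have h: "is_ptn \<kappa>" "weight \<kappa> = M" "inbox a b \<kappa>" "is_ptn \<tau>" "weight \<tau> = N" "inbox c d \<tau>"
      using p k by (auto simp: A_def B_def Ptns_def)
    have "schur_mult (\<pi> p) (row_blocks d Ps) = schur_mult \<kappa> (first_shapes Ps) * schur_mult \<tau> (second_shapes Ps)"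
      using schur_mult_row_blocks[OF P h(1) _ h(4) inbox_le[OF h(6)]] inbox_rows[OF h(3)] h(2) a by (simp add: \<pi>_def k M_def)
    moreover have "schur_mult (box_compl (a + c) (b + d) (\<pi> p)) (col_blocks c Qs) = schur_mult (box_compl c d \<tau>) (first_shapes Qs) * schur_mult (box_compl a b \<kappa>) (second_shapes Qs)"
    proof -
      have "weight (box_compl c d \<tau>) = total_weight (first_shapes Qs)" using weight_box_compl[OF h(6)] h(5) cd by (simp add: N_def)
      then show ?thesis
        using schur_mult_col_blocks[OF Q is_ptn_box_compl[OF h(4)] inbox_rows[OF inbox_box_compl] _ is_ptn_box_compl[OF h(1)]] inbox_le[OF inbox_box_compl, of a b \<kappa> 0] b
        by (simp add: \<pi>_def k box_compl_block_shape[OF h(3,6)])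
    qed
    ultimately show "schur_mult (\<pi> p) (row_blocks d Ps) * schur_mult (box_compl (a + c) (b + d) (\<pi> p)) (col_blocks c Qs) =
      (case p of (\<kappa>, \<tau>) \<Rightarrow> (schur_mult \<kappa> (first_shapes Ps) * schur_mult (box_compl a b \<kappa>) (second_shapes Qs)) * (schur_mult \<tau> (second_shapes Ps) * schur_mult (box_compl c d \<tau>) (first_shapes Qs)))"
      by (simp add: k)
  qed
  also have "\<dots> = (\<Sum>\<kappa>\<in>A. schur_mult \<kappa> (first_shapes Ps) * schur_mult (box_compl a b \<kappa>) (second_shapes Qs)) * (\<Sum>\<tau>\<in>B. schur_mult \<tau> (second_shapes Ps) * schur_mult (box_compl c d \<tau>) (first_shapes Qs))"
    unfolding sum_product sum.cartesian_product ..
  also have "(\<Sum>\<kappa>\<in>A. schur_mult \<kappa> (first_shapes Ps) * schur_mult (box_compl a b \<kappa>) (second_shapes Qs)) = schur_mult (box a b) (first_shapes Ps @ second_shapes Qs)"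
    unfolding A_def M_def by (rule schur_mult_box[symmetric, OF _ ab]) (use okP okQ in auto)
  also have "(\<Sum>\<tau>\<in>B. schur_mult \<tau> (second_shapes Ps) * schur_mult (box_compl c d \<tau>) (first_shapes Qs)) = schur_mult (box c d) (second_shapes Ps @ first_shapes Qs)"
    unfolding B_def N_def by (rule schur_mult_box[symmetric, OF _ cd]) (use okP okQ in auto)
  finally show ?thesis .
qed

section \<open>Schur polynomials as sums over tableaux\<close>

definition shape_cells :: "shape \<Rightarrow> (nat \<times> nat) set" where
  "shape_cells f = {(i, j). j < f i}"

definition tableaux :: "nat \<Rightarrow> shape \<Rightarrow> (nat \<times> nat \<Rightarrow> nat) set" where
  "tableaux N f = {T. (\<forall>c. c \<notin> shape_cells f \<longrightarrow> T c = 0)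
     \<and> (\<forall>c\<in>shape_cells f. T c < N)
     \<and> (\<forall>i j. (i, Suc j) \<in> shape_cells f \<longrightarrow> T (i, j) \<le> T (i, Suc j))
     \<and> (\<forall>i j. (Suc i, j) \<in> shape_cells f \<longrightarrow> T (i, j) < T (Suc i, j))}"

definition content :: "shape \<Rightarrow> (nat \<times> nat \<Rightarrow> nat) \<Rightarrow> nat \<Rightarrow> nat" where
  "content f T k = card {c\<in>shape_cells f. T c = k}"

lemma cells_part: "cells l = shape_cells (part l)"
  by (auto simp: cells_def shape_cells_def part_def split: if_splits)

lemma ssyt_part: "ssyt N l = tableaux N (part l)"
  by (simp add: ssyt_def tableaux_def cells_part)

lemma shape_cells_Sigma: assumes "rows n f" shows "shape_cells f = (SIGMA i:{..<n}. {..<f i})"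
proof -
  have "i < n" if "j < f i" for i j using assms that unfolding rows_def by (metis not_less not_less_zero)
  then show ?thesis by (auto simp: shape_cells_def)
qed

lemma finite_shape_cells: "is_ptn f \<Longrightarrow> finite (shape_cells f)" and card_shape_cells: "is_ptn f \<Longrightarrow> card (shape_cells f) = weight f"
proof -
  assume "is_ptn f"
  then obtain n where n: "rows n f" using is_ptn_rows by blast
  show "finite (shape_cells f)" "card (shape_cells f) = weight f"
    unfolding shape_cells_Sigma[OF n] weight_rows[OF n] by simp_all
qed

lemma finite_tableaux: assumes "is_ptn f" shows "finite (tableaux N f)"
proof (rule finite_subset)
  show "tableaux N f \<subseteq> {T. \<forall>c. (c \<in> shape_cells f \<longrightarrow> T c \<in> {..<N}) \<and> (c \<notin> shape_cells f \<longrightarrow> T c = 0)}"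
    by (auto simp: tableaux_def)
  show "finite {T. \<forall>c. (c \<in> shape_cells f \<longrightarrow> T c \<in> {..<N}) \<and> (c \<notin> shape_cells f \<longrightarrow> T c = 0)}"
    by (rule finite_set_of_finite_funs) (simp_all add: finite_shape_cells[OF assms])
qed

lemma tableaux_row_mono:
  assumes "T \<in> tableaux N f" "j \<le> j'" "j' < f i" shows "T (i, j) \<le> T (i, j')"
  using assms(2,3)
proof (induction rule: dec_induct)
  case (step n)
  then have "T (i, n) \<le> T (i, Suc n)" using assms(1) by (auto simp: tableaux_def shape_cells_def)
  then show ?case using step by simp
qed simp

lemma downward_closed_eq_lessThan:
  assumes "finite A" "\<And>x y. x \<in> A \<Longrightarrow> y < x \<Longrightarrow> y \<in> A" shows "A = {..<card (A::nat set)}"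
proof (cases "A = {}")
  case False
  define M where "M = Max A"
  have "M \<in> A" using assms(1) False by (simp add: M_def)
  have "A = {..<Suc M}"
  proof
    show "A \<subseteq> {..<Suc M}" using assms(1) by (auto simp: M_def less_Suc_eq_le)
    show "{..<Suc M} \<subseteq> A" using \<open>M \<in> A\<close> assms(2) by (auto simp: less_Suc_eq)
  qed
  then show ?thesis by (metis card_lessThan)
qed simp

text \<open>Letters start at 0, so in a member of \<open>tableaux (Suc N) f\<close> only the letter
  \<open>N\<close> is removed. Counting the cells of each row describes what is left because rows
  increase weakly, as \<open>inner_iff\<close> shows.\<close>

definition inner :: "nat \<Rightarrow> shape \<Rightarrow> (nat \<times> nat \<Rightarrow> nat) \<Rightarrow> shape" where
  "inner N f T = (\<lambda>i. card {j. j < f i \<and> T (i, j) < N})"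

definition restr :: "shape \<Rightarrow> (nat \<times> nat \<Rightarrow> nat) \<Rightarrow> (nat \<times> nat \<Rightarrow> nat)" where
  "restr h T = (\<lambda>c. if c \<in> shape_cells h then T c else 0)"

definition extend :: "nat \<Rightarrow> shape \<Rightarrow> shape \<Rightarrow> (nat \<times> nat \<Rightarrow> nat) \<Rightarrow> (nat \<times> nat \<Rightarrow> nat)" where
  "extend N f h T = (\<lambda>c. if c \<in> shape_cells h then T c else if c \<in> shape_cells f then N else 0)"

lemma inner_iff:
  assumes "T \<in> tableaux M f" shows "j < inner N f T i \<longleftrightarrow> j < f i \<and> T (i, j) < N"
proof -
  have "{j. j < f i \<and> T (i, j) < N} = {..<card {j. j < f i \<and> T (i, j) < N}}" (is "?S = _")
  proof (rule downward_closed_eq_lessThan)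
    fix x y assume "x \<in> {j. j < f i \<and> T (i, j) < N}" "y < x"
    then show "y \<in> {j. j < f i \<and> T (i, j) < N}" using tableaux_row_mono[OF assms, of y x i] by auto
  qed simp
  then have "j \<in> ?S \<longleftrightarrow> j \<in> {..<card ?S}" by (rule arg_cong)
  then show ?thesis by (simp add: inner_def)
qed

text \<open>Columns increase strictly, so the cell directly above any cell of \<open>f\<close>
  carries a letter below \<open>N\<close>; hence no column contains two of the removed
  cells.\<close>

lemma inner_horiz_strip:
  assumes "T \<in> tableaux (Suc N) f" "is_ptn f" shows "horiz_strip (inner N f T) f"
  unfolding horiz_strip_def
proof
  fix i
  have "inner N f T i \<le> f i"
    using inner_iff[OF assms(1), of "f i" N i] by (simp add: not_less[symmetric])
  moreover have "f (Suc i) \<le> inner N f T i"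
  proof (rule ccontr)
    assume "\<not> ?thesis"
    then have j: "inner N f T i < f (Suc i)" by simp
    define j where "j = inner N f T i"
    have c: "(Suc i, j) \<in> shape_cells f" using j by (simp add: shape_cells_def j_def)
    then have "T (i, j) < T (Suc i, j)" "T (Suc i, j) < Suc N" using assms(1) by (auto simp: tableaux_def)
    moreover have "j < f i" using j assms(2) unfolding is_ptn_def j_def by (meson less_le_trans)
    ultimately have "j < inner N f T i" using inner_iff[OF assms(1)] by simp
    then show False by (simp add: j_def)
  qed
  ultimately show "inner N f T i \<le> f i \<and> f (Suc i) \<le> inner N f T i" by simp
qed

lemma horiz_strip_shape_cells: "horiz_strip h f \<Longrightarrow> shape_cells h \<subseteq> shape_cells f"
  unfolding shape_cells_def horiz_strip_def by (auto intro: less_le_trans)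

lemma restr_tableaux:
  assumes T: "T \<in> tableaux (Suc N) f" and f: "is_ptn f" defines "h \<equiv> inner N f T"
  shows "restr h T \<in> tableaux N h" "extend N f h (restr h T) = T"
    "k < N \<Longrightarrow> content h (restr h T) k = content f T k" "content f T N + weight h = weight f"
proof -
  have I: "horiz_strip h f" using inner_horiz_strip[OF T f] by (simp add: h_def)
  have ph: "is_ptn h" using horiz_strip_is_ptn[OF I] f by simp
  have sub: "shape_cells h \<subseteq> shape_cells f" by (rule horiz_strip_shape_cells[OF I])
  have iff: "(i, j) \<in> shape_cells h \<longleftrightarrow> (i, j) \<in> shape_cells f \<and> T (i, j) < N" for i j
    using inner_iff[OF T, of j N i] by (simp add: h_def shape_cells_def)
  have iff': "c \<in> shape_cells h \<longleftrightarrow> c \<in> shape_cells f \<and> T c < N" for c using iff by (cases c) auto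
  have lt: "T c < Suc N" if "c \<in> shape_cells f" for c using T that by (simp add: tableaux_def)
  have left: "(i, j) \<in> shape_cells h" if "(i, Suc j) \<in> shape_cells h" for i j using that by (simp add: shape_cells_def)
  have up: "(i, j) \<in> shape_cells h" if "(Suc i, j) \<in> shape_cells h" for i j
    using that ph unfolding shape_cells_def is_ptn_def by (auto intro: less_le_trans)
  show "restr h T \<in> tableaux N h"
    unfolding tableaux_def
  proof (intro CollectI conjI allI impI ballI)
    show "restr h T c = 0" if "c \<notin> shape_cells h" for c using that by (simp add: restr_def)
    show "restr h T c < N" if "c \<in> shape_cells h" for c using that iff'[of c] by (simp add: restr_def)
    show "restr h T (i, j) \<le> restr h T (i, Suc j)" if "(i, Suc j) \<in> shape_cells h" for i j
      using that left[OF that] sub T by (auto simp: restr_def tableaux_def)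
    show "restr h T (i, j) < restr h T (Suc i, j)" if "(Suc i, j) \<in> shape_cells h" for i j
      using that up[OF that] sub T by (auto simp: restr_def tableaux_def)
  qed
  show "extend N f h (restr h T) = T"
  proof
    fix c
    show "extend N f h (restr h T) c = T c"
    proof -
      have "c \<notin> shape_cells f \<Longrightarrow> T c = 0" using T unfolding tableaux_def by blast
      then show ?thesis using iff'[of c] lt[of c] unfolding extend_def restr_def by auto
    qed
  qed
  show "content h (restr h T) k = content f T k" if "k < N"
    unfolding content_def by (rule arg_cong[of _ _ card]) (use that iff' in \<open>auto simp: restr_def\<close>)
  have "{c\<in>shape_cells f. T c = N} = shape_cells f - shape_cells h"
    using iff' lt by (auto simp: less_Suc_eq)
  then have "content f T N = card (shape_cells f) - card (shape_cells h)"
    unfolding content_def using card_Diff_subset[OF finite_shape_cells[OF ph] sub] by simp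
  moreover have "card (shape_cells h) \<le> card (shape_cells f)" by (rule card_mono[OF finite_shape_cells[OF f] sub])
  ultimately show "content f T N + weight h = weight f" by (simp add: card_shape_cells f ph)
qed

lemma extend_tableaux:
  assumes T: "T \<in> tableaux N h" and I: "horiz_strip h f" and f: "is_ptn f"
  shows "extend N f h T \<in> tableaux (Suc N) f" "inner N f (extend N f h T) = h" "restr h (extend N f h T) = T"
proof -
  have sub: "shape_cells h \<subseteq> shape_cells f" by (rule horiz_strip_shape_cells[OF I])
  have lt: "T c < N" if "c \<in> shape_cells h" for c using T that by (simp add: tableaux_def)
  have up: "(i, j) \<in> shape_cells h" if "(Suc i, j) \<in> shape_cells f" for i j
    using that I unfolding shape_cells_def horiz_strip_def by (auto intro: less_le_trans)
  have left: "(i, j) \<in> shape_cells h" if "(i, Suc j) \<in> shape_cells h" for i j using that by (simp add: shape_cells_def)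
  show E: "extend N f h T \<in> tableaux (Suc N) f"
    unfolding tableaux_def
  proof (intro CollectI conjI allI impI ballI)
    show "extend N f h T c = 0" if "c \<notin> shape_cells f" for c using that sub by (auto simp: extend_def)
    show "extend N f h T c < Suc N" if "c \<in> shape_cells f" for c using that lt[of c] by (auto simp: extend_def)
    show "extend N f h T (i, j) \<le> extend N f h T (i, Suc j)" if "(i, Suc j) \<in> shape_cells f" for i j
    proof (cases "(i, Suc j) \<in> shape_cells h")
      case True
      then show ?thesis using left[OF True] T by (auto simp: extend_def tableaux_def)
    next
      case False then show ?thesis using that lt[of "(i, j)"] by (auto simp: extend_def)
    qed
    show "extend N f h T (i, j) < extend N f h T (Suc i, j)" if "(Suc i, j) \<in> shape_cells f" for i j
      using up[OF that] lt[of "(i, j)"] that T by (auto simp: extend_def tableaux_def)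
  qed
  show "inner N f (extend N f h T) = h"
  proof
    fix i
    have "j < inner N f (extend N f h T) i \<longleftrightarrow> j < h i" for j
    proof -
      have "j < h i \<Longrightarrow> j < f i" using I unfolding horiz_strip_def by (meson less_le_trans)
      then show ?thesis
        using inner_iff[OF E, of j N i] lt[of "(i, j)"] by (auto simp: extend_def shape_cells_def)
    qed
    from this[of "h i"] this[of "inner N f (extend N f h T) i"]
    show "inner N f (extend N f h T) i = h i" by simp
  qed
  show "restr h (extend N f h T) = T" using T by (auto simp: restr_def extend_def tableaux_def)
qed

text \<open>Removing the largest letter is a bijection onto pairs of a shape below \<open>f\<close>,
  differing by a horizontal strip, and a tableau of that shape. This is the recursion
  \<open>kostka_snoc_below\<close>.\<close>

lemma card_tableaux_content:
  "is_ptn f \<Longrightarrow> length m = N \<Longrightarrow> int (card {T\<in>tableaux N f. \<forall>k<N. content f T k = m ! k}) = kostka f m"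
proof (induction N arbitrary: f m)
  case 0
  show ?case
  proof (cases "f = (\<lambda>_. 0)")
    case True
    then have "tableaux 0 f = {\<lambda>_. 0}" by (auto simp: tableaux_def shape_cells_def)
    then show ?thesis using 0 True by simp
  next
    case False
    then obtain i where "0 < f i" by fastforce
    then have "(i, 0) \<in> shape_cells f" by (simp add: shape_cells_def)
    then have "tableaux 0 f = {}" by (auto simp: tableaux_def)
    then show ?thesis using 0 False by auto
  qed
next
  case (Suc N)
  obtain ms k where m: "m = ms @ [k]" "length ms = N"
    using Suc.prems(2) by (metis length_Suc_conv_rev)
  define D where "D = {h. is_ptn h \<and> horiz_strip h f \<and> weight f = weight h + k}"
  define B where "B h = {T\<in>tableaux N h. \<forall>k<N. content h T k = ms ! k}" for h
  define A where "A = {T\<in>tableaux (Suc N) f. \<forall>k<Suc N. content f T k = m ! k}"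
  have finD: "finite D" by (rule finite_subset[OF _ finite_horiz_strip_below[OF Suc.prems(1)]]) (auto simp: D_def)
  have finB: "finite (B h)" if "h \<in> D" for h
    using finite_tableaux[of h N] that by (auto simp: B_def D_def)
  have m_lt: "m ! j = ms ! j" if "j < N" for j using that m by (simp add: nth_append)
  have m_N: "m ! N = k" using m by (simp add: nth_append)
  have "bij_betw (\<lambda>T. (inner N f T, restr (inner N f T) T)) A (Sigma D B)"
  proof (rule bij_betw_byWitness[where f' = "\<lambda>(h, T). extend N f h T"])
    show "\<forall>T\<in>A. (case (inner N f T, restr (inner N f T) T) of (h, T) \<Rightarrow> extend N f h T) = T"
      using restr_tableaux(2)[OF _ Suc.prems(1)] by (auto simp: A_def)
    show "\<forall>p\<in>Sigma D B. (inner N f (case p of (h, T) \<Rightarrow> extend N f h T), restr (inner N f (case p of (h, T) \<Rightarrow> extend N f h T)) (case p of (h, T) \<Rightarrow> extend N f h T)) = p"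
      using extend_tableaux(2,3)[OF _ _ Suc.prems(1)] by (auto simp: B_def D_def)
    show "(\<lambda>T. (inner N f T, restr (inner N f T) T)) ` A \<subseteq> Sigma D B"
    proof (rule image_subsetI)
      fix T assume T: "T \<in> A"
      then have T': "T \<in> tableaux (Suc N) f" by (simp add: A_def)
      note r = restr_tableaux[OF T' Suc.prems(1)]
      have I: "horiz_strip (inner N f T) f" by (rule inner_horiz_strip[OF T' Suc.prems(1)])
      have "inner N f T \<in> D" using I horiz_strip_is_ptn[OF I] Suc.prems(1) r(4) T m_N by (simp add: D_def A_def)
      moreover have "restr (inner N f T) T \<in> B (inner N f T)"
        using r(1,3) T m_lt by (simp add: B_def A_def)
      ultimately show "(inner N f T, restr (inner N f T) T) \<in> Sigma D B" by simp
    qed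
    show "(\<lambda>(h, T). extend N f h T) ` Sigma D B \<subseteq> A"
    proof (rule image_subsetI)
      fix p assume p: "p \<in> Sigma D B"
      obtain h T where hT: "p = (h, T)" by (cases p)
      have h: "is_ptn h" "horiz_strip h f" "weight f = weight h + k" and T: "T \<in> tableaux N h" "\<forall>k<N. content h T k = ms ! k"
        using p hT by (auto simp: D_def B_def)
      note e = extend_tableaux[OF T(1) h(2) Suc.prems(1)]
      note r = restr_tableaux[OF e(1) Suc.prems(1), unfolded e(2,3)]
      have "content f (extend N f h T) j = m ! j" if "j < Suc N" for j
      proof (cases "j = N")
        case True then show ?thesis using r(4) h(3) m_N by simp
      next
        case False then show ?thesis using that r(3)[of j] T(2) m_lt by simp
      qed
      then show "(case p of (h, T) \<Rightarrow> extend N f h T) \<in> A" using e(1) by (simp add: A_def hT)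
    qed
  qed
  then have "card A = card (Sigma D B)" by (rule bij_betw_same_card)
  also have "\<dots> = (\<Sum>h\<in>D. card (B h))" using finD finB by simp
  finally have "int (card A) = (\<Sum>h\<in>D. kostka h ms)"
    using Suc.IH[OF _ m(2)] by (simp add: B_def D_def)
  also have "\<dots> = kostka f m"
    unfolding m(1) kostka_snoc_below[OF Suc.prems(1)]
    by (rule sum.mono_neutral_cong_left[OF finite_horiz_strip_below[OF Suc.prems(1)]]) (auto simp: D_def)
  finally show ?case by (simp add: A_def)
qed

section \<open>Polynomials and their coefficients at exponent lists\<close>

definition exponent :: "nat list \<Rightarrow> nat \<Rightarrow>\<^sub>0 nat" where
  "exponent m = (\<Sum>i<length m. Poly_Mapping.single i (m ! i))"

lemma lookup_exponent: "Poly_Mapping.lookup (exponent m) k = part m k"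
proof -
  have "Poly_Mapping.lookup (exponent m) k = (\<Sum>i<length m. if i = k then m ! k else 0)"
    unfolding exponent_def lookup_sum by (rule sum.cong) (auto simp: lookup_single when_def)
  then show ?thesis by (simp add: part_def)
qed

text \<open>Trailing zeros of a list leave no trace in \<open>exponent\<close>, so the lengths have
  to agree in advance.\<close>

lemma exponent_inj: "length m = length m' \<Longrightarrow> exponent m = exponent m' \<Longrightarrow> m = m'"
proof (rule nth_equalityI)
  fix i assume "length m = length m'" "exponent m = exponent m'" "i < length m"
  then show "m ! i = m' ! i" using lookup_exponent[of m i] lookup_exponent[of m' i] by (simp add: part_def)
qed

lemma exponent_exists:
  assumes "\<And>k. N \<le> k \<Longrightarrow> Poly_Mapping.lookup e k = 0"
  obtains m where "length m = N" "e = exponent m"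
proof
  show "length (map (Poly_Mapping.lookup e) [0..<N]) = N" by simp
  show "e = exponent (map (Poly_Mapping.lookup e) [0..<N])"
    by (rule poly_mapping_eqI) (use assms in \<open>auto simp: lookup_exponent part_def\<close>)
qed

text \<open>For such a polynomial the values at exponent lists of length \<open>N\<close> include
  all nonzero coefficients, so identities can be checked there.\<close>

definition in_vars :: "nat \<Rightarrow> ipoly \<Rightarrow> bool" where
  "in_vars N p \<longleftrightarrow> (\<forall>e. Poly_Mapping.lookup p e \<noteq> 0 \<longrightarrow> (\<exists>m. length m = N \<and> e = exponent m))"

lemma lookup_content:
  assumes "is_ptn (part l)"
  shows "Poly_Mapping.lookup (\<Sum>c\<in>cells l. Poly_Mapping.single (T c) (1::nat)) k = content (part l) T k"
proof -
  have "Poly_Mapping.lookup (\<Sum>c\<in>cells l. Poly_Mapping.single (T c) (1::nat)) k = (\<Sum>c\<in>cells l. if T c = k then 1 else 0)"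
    unfolding lookup_sum by (rule sum.cong) (auto simp: lookup_single when_def)
  also have "\<dots> = card {c\<in>cells l. T c = k}"
    using finite_shape_cells[OF assms] by (simp add: sum.inter_filter[symmetric] cells_part)
  finally show ?thesis by (simp add: content_def cells_part)
qed

lemma lookup_schur:
  assumes l: "is_ptn (part l)"
  shows "Poly_Mapping.lookup (schur N l) e = int (card {T\<in>tableaux N (part l). (\<Sum>c\<in>cells l. Poly_Mapping.single (T c) 1) = e})"
proof -
  have "Poly_Mapping.lookup (schur N l) e = (\<Sum>T\<in>tableaux N (part l). if (\<Sum>c\<in>cells l. Poly_Mapping.single (T c) 1) = e then 1 else 0)"
    unfolding schur_def lookup_sum ssyt_part tab_monomial_def by (rule sum.cong) (auto simp: lookup_single when_def)
  then show ?thesis using finite_tableaux[OF l] by (simp add: sum.inter_filter[symmetric])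
qed

lemma content_zero: "T \<in> tableaux N f \<Longrightarrow> N \<le> k \<Longrightarrow> content f T k = 0"
  unfolding content_def tableaux_def by (auto simp: card_eq_0_iff)

lemma schur_coeff_kostka:
  assumes l: "is_ptn (part l)" and m: "length m = N"
  shows "Poly_Mapping.lookup (schur N l) (exponent m) = kostka (part l) m"
proof -
  have "(\<Sum>c\<in>cells l. Poly_Mapping.single (T c) 1) = exponent m \<longleftrightarrow> (\<forall>k<N. content (part l) T k = m ! k)" (is "?A \<longleftrightarrow> ?B") if T: "T \<in> tableaux N (part l)" for T
  proof
    assume ?A
    show ?B
    proof (intro allI impI)
      fix k assume "k < N"
      then show "content (part l) T k = m ! k"
        using lookup_content[OF l, of T k] \<open>?A\<close> m by (simp add: lookup_exponent part_def)
    qed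
  next
    assume ?B
    show ?A
    proof (rule poly_mapping_eqI)
      fix k
      show "Poly_Mapping.lookup (\<Sum>c\<in>cells l. Poly_Mapping.single (T c) 1) k = Poly_Mapping.lookup (exponent m) k"
        unfolding lookup_content[OF l] lookup_exponent using \<open>?B\<close> content_zero[OF T, of k] m by (simp add: part_def)
    qed
  qed
  then have "{T\<in>tableaux N (part l). (\<Sum>c\<in>cells l. Poly_Mapping.single (T c) 1) = exponent m} = {T\<in>tableaux N (part l). \<forall>k<N. content (part l) T k = m ! k}"
    by blast
  then show ?thesis unfolding lookup_schur[OF l] using card_tableaux_content[OF l m] by simp
qed

lemma in_vars_schur: assumes l: "is_ptn (part l)" shows "in_vars N (schur N l)"
  unfolding in_vars_def
proof (intro allI impI)
  fix e assume "Poly_Mapping.lookup (schur N l) e \<noteq> 0"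
  then have "{T\<in>tableaux N (part l). (\<Sum>c\<in>cells l. Poly_Mapping.single (T c) 1) = e} \<noteq> {}"
    unfolding lookup_schur[OF l] by (metis card.empty of_nat_0)
  then obtain T where T: "T \<in> tableaux N (part l)" "e = (\<Sum>c\<in>cells l. Poly_Mapping.single (T c) 1)" by blast
  have "Poly_Mapping.lookup e k = 0" if "N \<le> k" for k
    unfolding T(2) lookup_content[OF l] by (rule content_zero[OF T(1) that])
  then show "\<exists>m. length m = N \<and> e = exponent m" using exponent_exists by metis
qed

text \<open>The index set behind \<open>split_sum\<close>, wanted as a set because the product of
  polynomials is defined by a sum over pairs of exponents.\<close>

definition splittings :: "nat list \<Rightarrow> (nat list \<times> nat list) set" where
  "splittings m = {(x, y). length x = length m \<and> length y = length m \<and> (\<forall>i<length m. x ! i + y ! i = m ! i)}"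

lemma splittings_Cons: "splittings (k # m) = (\<lambda>(j, x, y). (j # x, (k - j) # y)) ` ({..k} \<times> splittings m)"
proof
  show "(\<lambda>(j, x, y). (j # x, (k - j) # y)) ` ({..k} \<times> splittings m) \<subseteq> splittings (k # m)"
    by (auto simp: splittings_def less_Suc_eq_0_disj)
  show "splittings (k # m) \<subseteq> (\<lambda>(j, x, y). (j # x, (k - j) # y)) ` ({..k} \<times> splittings m)"
  proof
    fix p assume p: "p \<in> splittings (k # m)"
    obtain x y where xy: "p = (x, y)" by (cases p)
    have h: "length x = Suc (length m)" "length y = Suc (length m)" "\<forall>i<Suc (length m). x ! i + y ! i = (k # m) ! i"
      using p xy by (auto simp: splittings_def)
    obtain j x' where x: "x = j # x'" using h(1) by (cases x) auto
    obtain j' y' where y: "y = j' # y'" using h(2) by (cases y) auto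
    have "j + j' = k" using h(3)[rule_format, of 0] x y by simp
    moreover have "x' ! i + y' ! i = m ! i" if "i < length m" for i
      using h(3)[rule_format, of "Suc i"] x y that by simp
    ultimately have "(j, x', y') \<in> {..k} \<times> splittings m" "p = (\<lambda>(j, x, y). (j # x, (k - j) # y)) (j, x', y')"
      using h x y xy by (auto simp: splittings_def)
    then show "p \<in> (\<lambda>(j, x, y). (j # x, (k - j) # y)) ` ({..k} \<times> splittings m)" by (rule rev_image_eqI)
  qed
qed

lemma splittings_Nil: "splittings [] = {([], [])}"
  by (auto simp: splittings_def)

lemma finite_splittings: "finite (splittings m)"
  by (induction m) (simp_all add: splittings_Nil splittings_Cons)

lemma split_sum_splittings: "split_sum H m = (\<Sum>(x, y)\<in>splittings m. H x y)"
proof (induction m arbitrary: H)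
  case Nil
  then show ?case by (simp add: splittings_Nil)
next
  case (Cons k m)
  have inj: "inj_on (\<lambda>(j, x, y). (j # x, (k - j) # y)) ({..k} \<times> splittings m)" by (auto simp: inj_on_def)
  have "(\<Sum>(x, y)\<in>splittings (k # m). H x y) = (\<Sum>(j, x, y)\<in>{..k} \<times> splittings m. H (j # x) ((k - j) # y))"
    unfolding splittings_Cons sum.reindex[OF inj] by (rule sum.cong) auto
  also have "\<dots> = (\<Sum>j\<le>k. \<Sum>(x, y)\<in>splittings m. H (j # x) ((k - j) # y))"
    unfolding sum.cartesian_product by (rule sum.cong) auto
  finally show ?case by (simp add: Cons.IH)
qed

lemma exponent_add:
  assumes l: "length x = length m" "length y = length m"
  shows "exponent x + exponent y = exponent m \<longleftrightarrow> (\<forall>i<length m. x ! i + y ! i = m ! i)"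
proof -
  have "exponent x + exponent y = exponent m \<longleftrightarrow> (\<forall>i. part x i + part y i = part m i)"
    unfolding poly_mapping_eq_iff fun_eq_iff lookup_add lookup_exponent ..
  also have "\<dots> \<longleftrightarrow> (\<forall>i<length m. x ! i + y ! i = m ! i)"
  proof safe
    fix i assume "\<forall>i. part x i + part y i = part m i" "i < length m"
    from this(1)[rule_format, of i] this(2) show "x ! i + y ! i = m ! i" by (simp add: part_def l)
  next
    fix i assume a: "\<forall>i<length m. x ! i + y ! i = m ! i"
    show "part x i + part y i = part m i" using a[rule_format, of i] by (simp add: part_def l)
  qed
  finally show ?thesis .
qed

text \<open>Exponents are natural numbers and cannot cancel, so neither summand involves a variable
  beyond \<open>length m\<close>.\<close>

lemma exponent_sum_split:
  assumes "a + b = exponent m"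
  obtains x y where "(x, y) \<in> splittings m" "a = exponent x" "b = exponent y"
proof -
  have z: "Poly_Mapping.lookup a k = 0 \<and> Poly_Mapping.lookup b k = 0" if "length m \<le> k" for k
  proof -
    have "Poly_Mapping.lookup (a + b) k = 0" unfolding assms lookup_exponent using that by (simp add: part_def)
    then show ?thesis by (simp add: lookup_add)
  qed
  obtain x where x: "length x = length m" "a = exponent x"
    by (rule exponent_exists[of "length m" a]) (use z in auto)
  obtain y where y: "length y = length m" "b = exponent y"
    by (rule exponent_exists[of "length m" b]) (use z in auto)
  have "(x, y) \<in> splittings m" using exponent_add[OF x(1) y(1)] assms x y unfolding splittings_def by simp
  from that[OF this x(2) y(2)] show ?thesis .
qed

lemma lookup_mult_exponent:
  fixes p q :: ipoly
  shows "Poly_Mapping.lookup (p * q) (exponent m) = convolve (\<lambda>x. Poly_Mapping.lookup p (exponent x)) (\<lambda>y. Poly_Mapping.lookup q (exponent y)) m"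
proof -
  let ?P = "(\<lambda>(x, y). (exponent x, exponent y)) ` splittings m"
  have inj: "inj_on (\<lambda>(x, y). (exponent x, exponent y)) (splittings m)"
    by (rule inj_onI) (auto simp: splittings_def intro: exponent_inj)
  have "Poly_Mapping.lookup (p * q) (exponent m) = (\<Sum>(a, b). Poly_Mapping.lookup p a * Poly_Mapping.lookup q b when exponent m = a + b)"
    unfolding times_poly_mapping.rep_eq by (rule prod_fun_unfold_prod) simp_all
  also have "\<dots> = (\<Sum>(a, b)\<in>?P. Poly_Mapping.lookup p a * Poly_Mapping.lookup q b when exponent m = a + b)"
  proof (rule Sum_any.expand_superset)
    show "finite ?P" by (simp add: finite_splittings)
    show "{c. (case c of (a, b) \<Rightarrow> Poly_Mapping.lookup p a * Poly_Mapping.lookup q b when exponent m = a + b) \<noteq> 0} \<subseteq> ?P"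
    proof
      fix c assume c: "c \<in> {c. (case c of (a, b) \<Rightarrow> Poly_Mapping.lookup p a * Poly_Mapping.lookup q b when exponent m = a + b) \<noteq> 0}"
      obtain a b where ab: "c = (a, b)" by (cases c)
      have "a + b = exponent m" using c ab by (auto simp: when_def split: if_splits)
      then obtain x y where "(x, y) \<in> splittings m" "a = exponent x" "b = exponent y" by (rule exponent_sum_split)
      then show "c \<in> ?P" using ab by force
    qed
  qed
  also have "\<dots> = (\<Sum>(x, y)\<in>splittings m. Poly_Mapping.lookup p (exponent x) * Poly_Mapping.lookup q (exponent y))"
    unfolding sum.reindex[OF inj]
  proof (rule sum.cong[OF refl])
    fix z assume z: "z \<in> splittings m"
    obtain x y where xy: "z = (x, y)" by (cases z)
    have "exponent x + exponent y = exponent m" using exponent_add[of x m y] z xy by (simp add: splittings_def)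
    then show "((\<lambda>(a, b). Poly_Mapping.lookup p a * Poly_Mapping.lookup q b when exponent m = a + b) \<circ> (\<lambda>(x, y). (exponent x, exponent y))) z
       = (case z of (x, y) \<Rightarrow> Poly_Mapping.lookup p (exponent x) * Poly_Mapping.lookup q (exponent y))"
      by (simp add: xy)
  qed
  finally show ?thesis by (simp add: split_sum_splittings)
qed

lemma in_vars_mult: assumes "in_vars N p" "in_vars N q" shows "in_vars N (p * q)"
  unfolding in_vars_def
proof (intro allI impI)
  fix e assume "Poly_Mapping.lookup (p * q) e \<noteq> 0"
  then have "e \<in> Poly_Mapping.keys (p * q)" by (simp add: in_keys_iff)
  then obtain a b where ab: "e = a + b" "a \<in> Poly_Mapping.keys p" "b \<in> Poly_Mapping.keys q"
    using keys_mult[of p q] by blast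
  then obtain x y where xy: "length x = N" "a = exponent x" "length y = N" "b = exponent y"
    using assms unfolding in_vars_def by (metis in_keys_iff)
  have "Poly_Mapping.lookup e k = 0" if "N \<le> k" for k
    using that xy by (simp add: ab(1) lookup_add lookup_exponent part_def)
  then show "\<exists>m. length m = N \<and> e = exponent m" using exponent_exists by metis
qed

lemma in_vars_one: "in_vars N 1"
  unfolding in_vars_def
proof (intro allI impI)
  fix e :: "nat \<Rightarrow>\<^sub>0 nat" assume "Poly_Mapping.lookup (1 :: ipoly) e \<noteq> 0"
  then have "e = 0" by (simp add: lookup_one when_def split: if_splits)
  then show "\<exists>m. length m = N \<and> e = exponent m" using exponent_exists[of N e] by (metis lookup_zero)
qed

lemma schur_product:
  assumes "\<forall>l\<in>set L. is_ptn (part l)"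
  shows "in_vars N (prod_list (map (schur N) L))"
    and "length m = N \<Longrightarrow> Poly_Mapping.lookup (prod_list (map (schur N) L)) (exponent m) = prod_coeff (map part L) m"
  using assms
proof (induction L arbitrary: m)
  case Nil
  { case 1 show ?case by (simp add: in_vars_one) }
  { case 2
    have "exponent m = 0 \<longleftrightarrow> sum_list m = 0"
    proof
      assume "exponent m = 0"
      then have "part m k = 0" for k using lookup_exponent[of m k] by simp
      then show "sum_list m = 0" by (auto simp: part_def in_set_conv_nth) (metis)
    next
      assume "sum_list m = 0"
      then show "exponent m = 0" by (intro poly_mapping_eqI) (auto simp: lookup_exponent part_def)
    qed
    then show ?case by (simp add: lookup_one when_def hom_sym_def) }
next
  case (Cons l L)
  { case 1 then show ?case using Cons.IH(1) by (simp add: in_vars_mult in_vars_schur) }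
  { case 2
    show ?case unfolding list.map prod_list.Cons lookup_mult_exponent prod_coeff.simps
      by (rule split_sum_cong) (use 2 Cons.IH(2) in \<open>simp add: schur_coeff_kostka\<close>) }
qed

section \<open>Schur expansions of polynomials and the value of \<open>schur_coeff\<close>\<close>

lemma lookup_of_int_mult:
  fixes q :: ipoly shows "Poly_Mapping.lookup (of_int c * q) e = c * Poly_Mapping.lookup q e"
proof -
  have "of_int c * q = Poly_Mapping.single 0 c * q" by (simp only: of_int_eq_id id_apply single_of_int[symmetric])
  also have "\<dots> = Poly_Mapping.map ((*) c) q" by (rule mult_map_scale_conv_mult[symmetric])
  finally show ?thesis by (simp add: Poly_Mapping.map.rep_eq when_def)
qed

lemma part_inj: "is_partition k \<Longrightarrow> is_partition k' \<Longrightarrow> part k = part k' \<Longrightarrow> k = k'"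
proof -
  assume k: "is_partition k" "is_partition k'" and e: "part k = part k'"
  have *: "length k \<le> length k'" if "is_partition k" "is_partition k'" "part k = part k'" for k k'
  proof (rule ccontr)
    assume "\<not> ?thesis"
    then have lt: "length k' < length k" by simp
    then have "part k (length k') > 0" using that(1) by (simp add: part_def is_partition_def)
    then show False using that(3) by (simp add: part_def)
  qed
  have "length k = length k'" using *[OF k e] *[OF k(2,1) e[symmetric]] by simp
  then show "k = k'"
  proof (rule nth_equalityI)
    fix i assume "i < length k"
    then show "k ! i = k' ! i" using fun_cong[OF e, of i] \<open>length k = length k'\<close> by (simp add: part_def)
  qed
qed

lemma is_ptn_part_exists:
  assumes "is_ptn f" obtains k where "is_partition k" "part k = f"
proof -
  define n where "n = (LEAST n. f n = 0)"
  have fn: "f n = 0" unfolding n_def by (rule LeastI_ex) (use assms in \<open>simp add: is_ptn_def\<close>)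
  have pos: "0 < f i" if "i < n" for i using not_less_Least[of i "\<lambda>n. f n = 0"] that by (simp add: n_def)
  have "rows n f" using rows_zero_iff[OF assms] fn by simp
  then have "part (map f [0..<n]) = f" by (rule part_map_rows)
  moreover have "is_partition (map f [0..<n])"
    unfolding is_partition_def using pos is_ptn_mono[OF assms]
    by (auto simp: sorted_rev_iff_nth_mono)
  ultimately show ?thesis using that by blast
qed

text \<open>The condition under \<open>THE\<close> in \<open>schur_coeff\<close>, isolated so that
  existence and uniqueness can be proved separately.\<close>

definition expands :: "nat \<Rightarrow> ipoly \<Rightarrow> (nat list \<Rightarrow> int) \<Rightarrow> bool" where
  "expands N p c \<longleftrightarrow> finite {k. c k \<noteq> 0}
      \<and> (\<forall>k. c k \<noteq> 0 \<longrightarrow> is_partition k \<and> length k \<le> N)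
      \<and> p = (\<Sum>k\<in>{k. c k \<noteq> 0}. of_int (c k) * schur N k)"

text \<open>Both expansions are extended by zero to the union of their supports and compared at
  exponents of length \<open>N\<close>, where the shapes with at most \<open>N\<close> rows are
  independent.\<close>

lemma expands_unique:
  assumes "expands N p c" "expands N p c'" shows "c = c'"
proof -
  define S where "S = {k. c k \<noteq> 0} \<union> {k. c' k \<noteq> 0}"
  have finS: "finite S" using assms by (simp add: S_def expands_def)
  have pS: "is_partition k \<and> length k \<le> N" if "k \<in> S" for k
    using assms that by (auto simp: S_def expands_def)
  have p: "p = (\<Sum>k\<in>S. of_int (c k) * schur N k)" "p = (\<Sum>k\<in>S. of_int (c' k) * schur N k)"
  proof -
    have "(\<Sum>k\<in>{k. d k \<noteq> 0}. of_int (d k) * schur N k) = (\<Sum>k\<in>S. of_int (d k) * schur N k)"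
      if "{k. d k \<noteq> 0} \<subseteq> S" for d :: "nat list \<Rightarrow> int"
      by (rule sum.mono_neutral_left) (use finS that in auto)
    note ext = this
    have "p = (\<Sum>k\<in>{k. c k \<noteq> 0}. of_int (c k) * schur N k)" using assms(1) unfolding expands_def by blast
    also have "\<dots> = (\<Sum>k\<in>S. of_int (c k) * schur N k)" by (rule ext) (simp add: S_def)
    finally show "p = (\<Sum>k\<in>S. of_int (c k) * schur N k)" .
    have "p = (\<Sum>k\<in>{k. c' k \<noteq> 0}. of_int (c' k) * schur N k)" using assms(2) unfolding expands_def by blast
    also have "\<dots> = (\<Sum>k\<in>S. of_int (c' k) * schur N k)" by (rule ext) (simp add: S_def)
    finally show "p = (\<Sum>k\<in>S. of_int (c' k) * schur N k)" .
  qed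
  have inj: "inj_on part S" by (rule inj_onI) (use pS part_inj in blast)
  have "(c k - c' k) = 0" if "k \<in> S" for k
  proof (rule indep_eq(1)[OF indep_kostka[of N], where S = "part ` S" and E = S and \<pi> = part and Y = "\<lambda>_. 0" and X = "\<lambda>k. c k - c' k"])
    show "part ` S \<subseteq> {f. is_ptn f \<and> rows N f}"
    proof (rule image_subsetI)
      fix k assume "k \<in> S"
      then show "part k \<in> {f. is_ptn f \<and> rows N f}"
        using pS[of k] is_partition_is_ptn(1,3)[of k] rows_mono[of "length k" "part k" N] by simp
    qed
    fix m :: "nat list" assume m: "m \<in> {m. length m = N}"
    have lk: "Poly_Mapping.lookup (\<Sum>k\<in>S. of_int (d k) * schur N k) (exponent m) = (\<Sum>k\<in>S. d k * kostka (part k) m)" for d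
      unfolding lookup_sum lookup_of_int_mult
    proof (rule sum.cong[OF refl])
      fix k assume "k \<in> S"
      then have "is_ptn (part k)" using pS is_partition_is_ptn(1) by blast
      then show "d k * Poly_Mapping.lookup (schur N k) (exponent m) = d k * kostka (part k) m"
        using schur_coeff_kostka[of k m N] m by simp
    qed
    have "(\<Sum>k\<in>S. c k * kostka (part k) m) = (\<Sum>k\<in>S. c' k * kostka (part k) m)"
      unfolding lk[symmetric] p[symmetric] ..
    then show "(\<Sum>k\<in>S. (c k - c' k) * kostka (part k) m) = (\<Sum>s\<in>part ` S. 0 * kostka s m)"
      by (simp add: left_diff_distrib sum_subtractf)
  qed (use finS inj that in auto)
  then show ?thesis
  proof (intro ext)
    fix k show "c k = c' k" using \<open>\<And>k. k \<in> S \<Longrightarrow> c k - c' k = 0\<close>[of k] by (cases "k \<in> S") (auto simp: S_def)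
  qed
qed

lemma schur_coeff_eqI:
  assumes "expands N p c" shows "schur_coeff N p k = c k"
proof -
  have "schur_coeff N p k = (THE c. expands N p c) k"
    unfolding schur_coeff_def expands_def ..
  also have "(THE c. expands N p c) = c"
    by (rule the_equality[of "expands N p"]) (use assms expands_unique in blast)+
  finally show ?thesis .
qed

text \<open>Truncating the expansion of the symmetric function to lists with at most
  \<open>N\<close> parts loses nothing, as longer shapes vanish in \<open>N\<close> variables. So
  the coefficient in \<open>N\<close> variables is the coefficient in the ring of symmetric
  functions.\<close>

lemma schur_coeff_product:
  assumes L: "\<forall>l\<in>set L. is_partition l" and k: "is_partition k" "length k \<le> N"
  shows "schur_coeff N (prod_list (map (schur N) L)) k = schur_mult (part k) (map part L)"
proof -
  define c where "c k = (if is_partition k \<and> length k \<le> N then schur_mult (part k) (map part L) else 0)" for k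
  define n where "n = total_weight (map part L)"
  have pL: "\<forall>l\<in>set (map part L). is_ptn l" "\<forall>l\<in>set L. is_ptn (part l)" using L is_partition_is_ptn by auto
  define C where "C = {k. c k \<noteq> 0}"
  have sub: "part ` C \<subseteq> Ptns n"
    using schur_mult_size[OF pL(1)] is_partition_is_ptn(1) by (auto simp: C_def c_def Ptns_def n_def split: if_splits)
  have inj: "inj_on part C" by (rule inj_onI) (auto simp: C_def c_def split: if_splits intro: part_inj)
  have finC: "finite C" using finite_subset[OF sub finite_Ptns] finite_imageD inj by blast
  let ?p = "prod_list (map (schur N) L)"
  have "?p = (\<Sum>k\<in>C. of_int (c k) * schur N k)"
  proof (rule poly_mapping_eqI)
    fix e
    show "Poly_Mapping.lookup ?p e = Poly_Mapping.lookup (\<Sum>k\<in>C. of_int (c k) * schur N k) e"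
    proof (cases "\<exists>m. length m = N \<and> e = exponent m")
      case False
      then have "Poly_Mapping.lookup ?p e = 0" using schur_product(1)[OF pL(2), of N] unfolding in_vars_def by blast
      moreover have "Poly_Mapping.lookup (schur N k) e = 0" if "k \<in> C" for k
        using in_vars_schur[of k N] that False is_partition_is_ptn(1)[of k] unfolding in_vars_def by (auto simp: C_def c_def split: if_splits)
      ultimately show ?thesis by (simp add: lookup_sum lookup_of_int_mult)
    next
      case True
      then obtain m where m: "length m = N" "e = exponent m" by blast
      have "Poly_Mapping.lookup ?p e = (\<Sum>\<theta>\<in>Ptns n. schur_mult \<theta> (map part L) * kostka \<theta> m)"
        unfolding m(2) schur_product(2)[OF pL(2) m(1)] n_def by (rule prod_coeff_expansion[OF pL(1)])
      also have "\<dots> = (\<Sum>\<theta>\<in>part ` C. schur_mult \<theta> (map part L) * kostka \<theta> m)"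
      proof (rule sum.mono_neutral_right[OF finite_Ptns sub], rule ballI, rule ccontr)
        fix \<theta> assume \<theta>: "\<theta> \<in> Ptns n - part ` C" and nz: "schur_mult \<theta> (map part L) * kostka \<theta> m \<noteq> 0"
        obtain k where k: "is_partition k" "part k = \<theta>" using is_ptn_part_exists[of \<theta>] \<theta> by (auto simp: Ptns_def)
        have "rows N \<theta>" using kostka_nz(2)[of m \<theta>] nz m by auto
        then have "part k N = 0" using k by (simp add: rows_def)
        then have "length k \<le> N" using k(1) nth_mem[of N k]
          by (cases "N < length k") (auto simp: part_def is_partition_def)
        then have "k \<in> C" using k nz by (auto simp: C_def c_def)
        then show False using \<theta> k by auto
      qed
      also have "\<dots> = (\<Sum>k\<in>C. c k * Poly_Mapping.lookup (schur N k) e)"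
        unfolding sum.reindex[OF inj] m(2)
        by (rule sum.cong) (auto simp: C_def c_def schur_coeff_kostka m(1) is_partition_is_ptn split: if_splits)
      finally show ?thesis by (simp add: lookup_sum lookup_of_int_mult)
    qed
  qed
  then have "expands N ?p c"
    unfolding expands_def using finC by (auto simp: C_def c_def split: if_splits)
  from schur_coeff_eqI[OF this, of k] show ?thesis using k by (simp add: c_def)
qed

lemma part_pbox: "part (pbox a b) = box a b"
  by (auto simp: part_def pbox_def box_def)

lemma is_partition_pbox: "is_partition (pbox a b)"
  by (auto simp: is_partition_def pbox_def sorted_replicate)

lemma delta_eq_schur_mult:
  assumes "schubert_problem a b L" shows "delta a b L = schur_mult (box a b) (map part L)"
proof -
  \<comment> \<open>\<open>pbox a 0\<close> is the empty list, so the bound holds for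
    \<open>b = 0\<close> as well.\<close>
  have "length (pbox a b) \<le> a * b" by (auto simp: pbox_def)
  then show ?thesis unfolding delta_def part_pbox[symmetric]
    by (intro schur_coeff_product is_partition_pbox) (use assms in \<open>auto simp: schubert_problem_def\<close>)
qed

section \<open>The composition theorem\<close>

lemma pcontained_inbox: "pcontained l (pbox a b) \<longleftrightarrow> inbox a b (part l)"
  by (simp add: pcontained_def inbox_def part_pbox)

lemma part_padd: "part (padd l m) i = part l i + part m i"
  by (auto simp: padd_def part_def)

lemma is_partition_iff:
  "is_partition l \<longleftrightarrow> (\<forall>i. part l (Suc i) \<le> part l i) \<and> (\<forall>i<length l. 0 < part l i)"
proof
  assume l: "is_partition l"
  show "(\<forall>i. part l (Suc i) \<le> part l i) \<and> (\<forall>i<length l. 0 < part l i)"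
    using is_partition_is_ptn(1)[OF l] l by (auto simp: is_ptn_def part_def is_partition_def)
next
  assume a: "(\<forall>i. part l (Suc i) \<le> part l i) \<and> (\<forall>i<length l. 0 < part l i)"
  have "l ! Suc i \<le> l ! i" if "Suc i < length l" for i
    using a[THEN conjunct1, rule_format, of i] that by (simp add: part_def)
  moreover have "0 < x" if x: "x \<in> set l" for x
  proof -
    obtain i where "i < length l" "x = l ! i" using x by (auto simp: in_set_conv_nth)
    then show ?thesis using a[THEN conjunct2, rule_format, of i] by (simp add: part_def)
  qed
  ultimately show "is_partition l" by (simp add: is_partition_def sorted_rev_iff_nth_Suc)
qed

lemma is_partition_padd:
  assumes "is_partition l" "is_partition m" shows "is_partition (padd l m)"
  unfolding is_partition_iff
proof (intro conjI allI impI)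
  show "part (padd l m) (Suc i) \<le> part (padd l m) i" for i
    using assms unfolding is_partition_iff part_padd by (meson add_mono)
  fix i assume "i < length (padd l m)"
  then have "i < length l \<or> i < length m" by (auto simp: padd_def)
  then show "0 < part (padd l m) i"
    using assms unfolding is_partition_iff part_padd by (metis add_gr_0)
qed

lemma is_partition_pjoin: "is_partition l \<Longrightarrow> is_partition m \<Longrightarrow> is_partition (pjoin l m)"
  by (auto simp: is_partition_def pjoin_def)

lemma pjoin_eq_append:
  assumes "is_partition l" "is_partition m" "\<And>x y. x \<in> set l \<Longrightarrow> y \<in> set m \<Longrightarrow> y \<le> x"
  shows "pjoin l m = l @ m"
proof -
  have "sorted (rev (l @ m))" using assms by (auto simp: is_partition_def sorted_append)
  then have "sort (rev (l @ m)) = rev (l @ m)" by (rule sorted_sort_id)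
  moreover have "sort (rev (l @ m)) = sort (l @ m)" by (rule properties_for_sort) simp_all
  ultimately have "sort (l @ m) = rev (l @ m)" by metis
  then show ?thesis unfolding pjoin_def by (metis rev_rev_ident)
qed

lemma part_append: "part (l @ m) i = (if i < length l then part l i else part m (i - length l))"
  by (auto simp: part_def nth_append)

lemma part_zero_length: "is_partition l \<Longrightarrow> part l n = 0 \<longleftrightarrow> length l \<le> n"
  unfolding is_partition_iff by (metis not_less part_def less_numeral_extra(3))

lemma set_le_part_0: assumes "is_partition l" "x \<in> set l" shows "x \<le> part l 0"
proof -
  obtain i where i: "i < length l" "x = l ! i" using assms(2) by (auto simp: in_set_conv_nth)
  then have "x = part l i" by (simp add: part_def)
  also have "\<dots> \<le> part l 0" by (rule is_ptn_mono[OF is_partition_is_ptn(1)[OF assms(1)]]) simp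
  finally show ?thesis .
qed

text \<open>Every part of \<alpha> is at most \<open>d\<close> and every part of the sum at least
  \<open>d\<close>, so the rearrangement in \<open>pjoin\<close> is plain concatenation.\<close>

lemma part_row_block:
  assumes "is_partition \<mu>" "is_partition \<alpha>" "length \<mu> \<le> a" "part \<alpha> 0 \<le> d" "0 < d"
  shows "part (pjoin (padd (pbox a d) \<mu>) \<alpha>) = block_shape a d (part \<mu>) (part \<alpha>)"
proof -
  \<comment> \<open>As \<open>d\<close> is positive, \<open>pbox a d\<close> really has
    \<open>a\<close> entries, and the sum has \<open>a\<close> rows even where \<mu> is
    shorter.\<close>
  have len: "length (padd (pbox a d) \<mu>) = a" using assms by (simp add: padd_def pbox_def)
  have pt: "part (padd (pbox a d) \<mu>) i = d + part \<mu> i" if "i < a" for i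
    using that by (simp add: part_padd part_pbox box_def)
  have "pjoin (padd (pbox a d) \<mu>) \<alpha> = padd (pbox a d) \<mu> @ \<alpha>"
  proof (rule pjoin_eq_append[OF is_partition_padd[OF is_partition_pbox assms(1)] assms(2)])
    fix x y assume x: "x \<in> set (padd (pbox a d) \<mu>)" and y: "y \<in> set \<alpha>"
    obtain i where i: "i < a" "x = part (padd (pbox a d) \<mu>) i" using x len by (auto simp: in_set_conv_nth part_def)
    have "y \<le> d" using set_le_part_0[OF assms(2) y] assms(4) by simp
    then show "y \<le> x" using i pt by simp
  qed
  then show ?thesis by (auto simp: part_append len pt block_shape_apply)
qed

lemma part_col_block:
  assumes "is_partition \<nu>" "is_partition \<beta>" "length \<beta> \<le> c" "part \<nu> 0 \<le> b"
  shows "part (padd (pjoin (pbox c b) \<nu>) \<beta>) = block_shape c b (part \<beta>) (part \<nu>)"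
proof (cases "b = 0")
  case True
  \<comment> \<open>For \<open>b = 0\<close> the list \<open>pbox c b\<close> is empty instead of
    having \<open>c\<close> entries, so concatenation would not place \<nu> below row
    \<open>c\<close>; but \<nu> is then empty too.\<close>
  then have "\<nu> = []" using assms(1,4) part_zero_length[OF assms(1), of 0] by simp
  show ?thesis
  proof
    fix i show "part (padd (pjoin (pbox c b) \<nu>) \<beta>) i = block_shape c b (part \<beta>) (part \<nu>) i"
      unfolding part_padd using \<open>\<nu> = []\<close> True assms(3) by (simp add: pbox_def pjoin_def block_shape_apply part_def)
  qed
next
  case False
  then have pb: "pbox c b = replicate c b" by (simp add: pbox_def)
  have "pjoin (pbox c b) \<nu> = pbox c b @ \<nu>"
  proof (rule pjoin_eq_append[OF is_partition_pbox assms(1)])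
    fix x y assume "x \<in> set (pbox c b)" "y \<in> set \<nu>"
    then show "y \<le> x" using set_le_part_0[OF assms(1), of y] assms(4) pb by simp
  qed
  moreover have "part \<beta> i = 0" if "c \<le> i" for i using that assms(3) by (simp add: part_def)
  ultimately show ?thesis
    by (auto simp: part_padd part_append pb block_shape_apply part_def[of "replicate c b"])
qed

text \<open>The slack in \<open>A\<close> and \<open>B\<close> allows for a single block using only
  part of the \<open>a\<close> rows, or of the \<open>b\<close> columns, that all blocks of its kind
  use together.\<close>

lemma inbox_block_shape:
  assumes "inbox a' b \<mu>" "inbox c d \<alpha>" "a' \<le> A" "a + c \<le> A" "b + d \<le> B"
  shows "inbox A B (block_shape a d \<mu> \<alpha>)"
  unfolding inbox_def
proof
  fix i
  have "\<mu> i \<le> b" "\<alpha> (i - a) \<le> d" using inbox_le assms(1,2) by auto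
  moreover have "c \<le> i - a \<Longrightarrow> \<alpha> (i - a) = 0" using inbox_rows[OF assms(2)] by (simp add: rows_def)
  ultimately show "block_shape a d \<mu> \<alpha> i \<le> box A B i" using assms(3-5) by (auto simp: block_shape_apply box_def)
qed

lemma prod_coeff_append_zeros: "prod_coeff (L @ replicate t (\<lambda>_. 0)) = prod_coeff L"
proof (induction t)
  case (Suc t)
  have "prod_coeff (L @ replicate (Suc t) (\<lambda>_. 0)) = prod_coeff ((\<lambda>_. 0) # (L @ replicate t (\<lambda>_. 0)))"
    by (rule prod_coeff_mset) simp
  also have "\<dots> = prod_coeff (L @ replicate t (\<lambda>_. 0))"
    by (rule ext) (simp add: kostka_zero convolve_hom_sym_0)
  finally show ?case using Suc by simp
qed simp

lemma sum_list_psize: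
  "\<forall>l\<in>set L. is_partition l \<Longrightarrow> sum_list (map psize L) = total_weight (map part L)"
  by (induction L) (auto simp: total_weight_def psize_def is_partition_is_ptn)

theorem theorem2p9:
  fixes a b c d :: nat and L mu nu alpha beta gamma :: "nat list list"
    and as bs :: "nat list"
  assumes "schubert_problem a b L"
    and "composable a b L mu nu as bs"
    and "0 < c" and "0 < d"
    and "length alpha = length mu" and "length beta = length nu"
    and "schubert_problem c d (alpha @ beta @ gamma)"
  shows "schubert_problem (a + c) (b + d) (compose c d mu nu as bs alpha beta gamma)
    \<and> delta (a + c) (b + d) (compose c d mu nu as bs alpha beta gamma)
        = delta a b L * delta c d (alpha @ beta @ gamma)"
proof -
  let ?composed = "compose c d mu nu as bs alpha beta gamma"
  define Ps where "Ps = map (\<lambda>i. (as ! i, part (mu ! i), part (alpha ! i))) [0..<length mu]"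
  \<comment> \<open>A condition from \<open>gamma\<close> is a column block with no full columns and
    an empty lower shape: it leaves the sum \<open>b\<close> unchanged and adds a factor 1 to the
    product belonging to \<open>L\<close>.\<close>
  define Qs where "Qs = map (\<lambda>j. (bs ! j, part (beta ! j), part (nu ! j))) [0..<length nu]
    @ map (\<lambda>g. (0, part g, \<lambda>_. 0)) gamma"
  have ms: "mset (mu @ nu) = mset L" and las: "length as = length mu" "length bs = length nu"
    and sab: "sum_list as = a" "sum_list bs = b"
    and bmu: "\<And>i. i < length mu \<Longrightarrow> length (mu ! i) \<le> as ! i"
    and bnu: "\<And>j. j < length nu \<Longrightarrow> part (nu ! j) 0 \<le> bs ! j"
    using assms(2) by (auto simp: composable_def)
  have setL: "set L = set mu \<union> set nu" using ms by (metis set_append set_mset_mset)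
  have pL: "is_partition l \<and> inbox a b (part l)" if "l \<in> set mu \<union> set nu" for l
    using assms(1) that setL by (simp add: schubert_problem_def pcontained_inbox)
  have pR: "is_partition l \<and> inbox c d (part l)" if "l \<in> set alpha \<union> set beta \<union> set gamma" for l
    using assms(7) that by (auto simp: schubert_problem_def pcontained_inbox)
  have mu: "is_partition (mu ! i)" "inbox a b (part (mu ! i))" if "i < length mu" for i
    using pL[of "mu ! i"] that by auto
  have nu: "is_partition (nu ! i)" "inbox a b (part (nu ! i))" if "i < length nu" for i
    using pL[of "nu ! i"] that by auto
  have al: "is_partition (alpha ! i)" "inbox c d (part (alpha ! i))" if "i < length mu" for i
    using pR[of "alpha ! i"] that assms(5) by auto
  have be: "is_partition (beta ! i)" "inbox c d (part (beta ! i))" if "i < length nu" for i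
    using pR[of "beta ! i"] that assms(6) by auto
  have lbe: "length l \<le> c" if "is_partition l" "inbox c d (part l)" for l
    using part_zero_length[OF that(1), of c] inbox_rows[OF that(2)] by (simp add: rows_def)
  have as_le: "as ! i \<le> a" if "i < length mu" for i
    using member_le_sum_list[of "as ! i" as] that las sab by auto
  have bs_le: "bs ! j \<le> b" if "j < length nu" for j
    using member_le_sum_list[of "bs ! j" bs] that las sab by auto
  have row_blocks_ok: "row_blocks_ok d Ps"
    using mu al bmu inbox_le[OF al(2)] is_partition_is_ptn rows_mono[OF is_partition_is_ptn(3)] by (auto simp: row_blocks_ok_def Ps_def)
  have col_blocks_ok: "col_blocks_ok c Qs"
    using nu be bnu pR inbox_rows[of c d] is_partition_is_ptn(1) by (auto simp: col_blocks_ok_def Qs_def)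
  have bf: "first_shapes Ps = map part mu" "second_shapes Ps = map part alpha"
    "first_shapes Qs = map part (beta @ gamma)" "second_shapes Qs = map part nu @ replicate (length gamma) (\<lambda>_. 0)"
    "map fst Ps = as" "map fst Qs = bs @ replicate (length gamma) 0"
    using assms(5,6) las by (auto simp: Ps_def Qs_def intro!: nth_equalityI simp: nth_append)
  have bl: "block_sum Ps = a" "block_sum Qs = b" unfolding bf using sab by (simp_all add: sum_list_replicate)
  have pc: "map part ?composed = row_blocks d Ps @ col_blocks c Qs"
  proof -
    have "part (pjoin (padd (pbox (as ! i) d) (mu ! i)) (alpha ! i)) = block_shape (as ! i) d (part (mu ! i)) (part (alpha ! i))"
      if "i < length mu" for i
      by (rule part_row_block) (use that mu al bmu inbox_le[OF al(2)] assms(4) in auto)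
    moreover have "part (padd (pjoin (pbox c (bs ! j)) (nu ! j)) (beta ! j)) = block_shape c (bs ! j) (part (beta ! j)) (part (nu ! j))"
      if "j < length nu" for j
      by (rule part_col_block) (use that nu be bnu lbe in auto)
    moreover have "part g = block_shape c 0 (part g) (\<lambda>_. 0)" if "g \<in> set gamma" for g
      using pR[of g] that inbox_rows[of c d "part g"] by (auto simp: block_shape_apply rows_def)
    ultimately show ?thesis
      unfolding compose_def row_blocks_def col_blocks_def Ps_def Qs_def by auto
  qed
  have isp: "\<forall>l\<in>set ?composed. is_partition l"
    using mu nu al be pR by (auto simp: compose_def intro!: is_partition_pjoin is_partition_padd is_partition_pbox)
  have inb: "inbox (a + c) (b + d) f" if f: "f \<in> set (row_blocks d Ps @ col_blocks c Qs)" for f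
  proof -
    consider i where "i < length mu" "f = block_shape (as ! i) d (part (mu ! i)) (part (alpha ! i))"
      | j where "j < length nu" "f = block_shape c (bs ! j) (part (beta ! j)) (part (nu ! j))"
      | g where "g \<in> set gamma" "f = block_shape c 0 (part g) (\<lambda>_. 0)"
      using f by (auto simp: row_blocks_def col_blocks_def Ps_def Qs_def)
    then show ?thesis
    proof cases
      case 1
      show ?thesis unfolding 1(2)
        by (rule inbox_block_shape[OF mu(2)[OF 1(1)] al(2)[OF 1(1)]]) (use as_le[OF 1(1)] in auto)
    next
      case 2
      \<comment> \<open>In \<open>inbox_block_shape\<close> the width allowed to the lower shape is
        also the number of full columns, here \<open>bs ! j\<close>, so the box for this part of
        \<open>nu\<close> has to be narrowed from \<open>b\<close>.\<close>
      have "inbox a (bs ! j) (part (nu ! j))" unfolding inbox_def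
      proof
        fix i
        have "part (nu ! j) i \<le> part (nu ! j) 0"
          by (rule is_ptn_mono[OF is_partition_is_ptn(1)[OF nu(1)[OF 2(1)]]]) simp
        moreover have "a \<le> i \<Longrightarrow> part (nu ! j) i = 0"
          using inbox_rows[OF nu(2)[OF 2(1)]] by (simp add: rows_def)
        ultimately show "part (nu ! j) i \<le> box a (bs ! j) i"
          using bnu[OF 2(1)] by (auto simp: box_def)
      qed
      then show ?thesis unfolding 2(2)
        by (rule inbox_block_shape[OF be(2)[OF 2(1)]]) (use bs_le[OF 2(1)] in auto)
    next
      case 3
      have "inbox c d (part g)" "inbox a 0 (\<lambda>_. 0)" using 3 pR[of g] by (auto simp: inbox_def)
      then show ?thesis unfolding 3(2) by (rule inbox_block_shape) auto
    qed
  qed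
  have tL: "total_weight (map part mu) + total_weight (map part nu) = a * b"
  proof -
    have "sum_list (map psize L) = sum_list (map psize (mu @ nu))"
      using arg_cong[OF ms, of "\<lambda>M. sum_mset (image_mset psize M)"] by (simp add: sum_mset_sum_list[symmetric])
    also have "\<dots> = total_weight (map part (mu @ nu))" by (rule sum_list_psize) (use pL in auto)
    finally show ?thesis using assms(1) by (simp add: schubert_problem_def total_weight_append)
  qed
  have tR: "total_weight (map part alpha) + total_weight (map part (beta @ gamma)) = c * d"
  proof -
    have "sum_list (map psize (alpha @ beta @ gamma)) = total_weight (map part (alpha @ beta @ gamma))"
      by (rule sum_list_psize) (use pR in auto)
    then show ?thesis using assms(7) by (simp add: schubert_problem_def total_weight_append)
  qed
  have tz: "total_weight (replicate t (\<lambda>_. 0)) = 0" for t by (simp add: total_weight_def sum_list_replicate)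
  have "total_weight (map part ?composed) = (a + c) * (b + d)"
    unfolding pc total_weight_append total_weight_row_blocks[OF row_blocks_ok] total_weight_col_blocks[OF col_blocks_ok] bl bf(1-4)
    using tL tR by (simp add: total_weight_append tz algebra_simps)
  then have sp: "schubert_problem (a + c) (b + d) ?composed"
    unfolding schubert_problem_def sum_list_psize[OF isp]
    using isp inb unfolding pc[symmetric] pcontained_inbox by simp
  have "delta (a + c) (b + d) ?composed = schur_mult (box (a + c) (b + d)) (row_blocks d Ps @ col_blocks c Qs)"
    unfolding delta_eq_schur_mult[OF sp] pc ..
  also have "\<dots> = schur_mult (box a b) (first_shapes Ps @ second_shapes Qs) * schur_mult (box c d) (second_shapes Ps @ first_shapes Qs)"
    by (rule schur_mult_composition[OF row_blocks_ok col_blocks_ok assms(3) bl])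
      (use tL tR in \<open>simp_all only: bf total_weight_append tz add_0_right\<close>)
  also have "schur_mult (box a b) (first_shapes Ps @ second_shapes Qs) = delta a b L"
  proof -
    \<comment> \<open>The empty shapes stemming from \<open>gamma\<close> are removed, and what
      remains is a rearrangement of \<open>L\<close>.\<close>
    have "prod_coeff (first_shapes Ps @ second_shapes Qs) = prod_coeff (map part (mu @ nu))"
      using prod_coeff_append_zeros[of "map part (mu @ nu)"] by (simp only: bf map_append append_assoc)
    also have "\<dots> = prod_coeff (map part L)" by (rule prod_coeff_mset) (use ms in \<open>simp only: mset_map\<close>)
    finally show ?thesis unfolding delta_eq_schur_mult[OF assms(1)] schur_mult_def by simp
  qed
  also have "schur_mult (box c d) (second_shapes Ps @ first_shapes Qs) = delta c d (alpha @ beta @ gamma)"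
    unfolding delta_eq_schur_mult[OF assms(7)] bf by simp
  finally show ?thesis using sp by blast
qed

end
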